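(* The correspondence $\widehat f\longmapsto\Phi(f)$ identifies the stable algebra $(\mathscr A,\times)$ with the algebra $\Lambda^*$ of shifted symmetric functions, i.e. it is an isomorphism of algebras $\mathscr A\to\Lambda^*$ (with ordinary multiplication on $\Lambda^*$). In particular, if $\widehat f\times\widehat g=\widehat h$, then $\Phi(h)=\Phi(f)\Phi(g)$.
   Context: $\Lambda=\bigoplus_n\Lambda_n$ is the algebra of symmetric functions over $\mathbb C$, with Schur functions $s_\lambda$. The class product $\times$ on $\Lambda_n$ is the bilinear product with $s_\lambda\times s_\mu=\delta_{\lambda\mu}\frac{1}{f^\lambda}s_\lambda$ for $\lambda,\mu\vdash n$, where $f^\lambda$ is the number of standard Young tableaux of shape $\lambda$; it is extended componentwise to the completion $\widehat\Lambda=\prod_{n\ge0}\Lambda_n$. For $f\in\Lambda_m$ homogeneous, $\widehat f=\frac{m!f}{(1-p_1)^{m+1}}=\sum_{n\ge m}(n)_m f p_1^{n-m}\in\widehat\Lambda$, with $(n)_m=n(n-1)\cdots(n-m+1)$; the map $f\mapsto\widehat f$ is extended linearly to $\Lambda$. The stable algebra is $\mathscr A=\operatorname{span}_{\mathbb C}\{\widehat p_\mu\mid\mu\text{ a partition}\}=\{\widehat f\mid f\in\Lambda\}$. For $\lambda\vdash n$, $\times$-multiplication by the degree-$n$ component of $\widehat f$ is diagonal on $s_\lambda$, and $\Phi(f)(\lambda)$ denotes the eigenvalue: $\widehat f\times s_\lambda=\Phi(f)(\lambda)\,s_\lambda$. A shifted symmetric function is a sequence $(g_N)_{N\ge1}$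 of polynomials $g_N\in\mathbb C[x_1,\dots,x_N]$ of bounded degree, with $g_N$ symmetric in the shifted variables $x_i-i$ and $g_{N+1}(x_1,\dots,x_N,0)=g_N(x_1,\dots,x_N)$. These form an algebra $\Lambda^*$ under ordinary multiplication; an element of $\Lambda^*$ is identified with the function $\lambda\mapsto g(\lambda_1,\lambda_2,\dots)$ on partitions. The shifted Schur functions $$s_\mu^*(x_1,\dots,x_N)=\frac{\det[(x_i+N-i)_{\mu_j+N-j}]_{1\le i,j\le N}}{\det[(x_i+N-i)_{N-j}]_{1\le i,j\le N}}$$ form a basis of $\Lambda^*$, and $\Phi(s_\mu)=s_\mu^*$. *)

theory Defs
  imports
    Complex_Main
    "HOL-Library.Poly_Mapping"
    "HOL-Library.FuncSet"
    "HOL-Combinatorics.Permutations"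
    "HOL-Algebra.Module"
    "HOL-Algebra.QuotRing"
begin

section \<open>Partitions and tableaux\<close>

typedef partition = "{xs :: nat list. sorted_wrt (\<ge>) xs \<and> 0 \<notin> set xs}"
  morphisms parts Abs_partition
  by (rule exI[of _ "[]"]) simp

definition psize :: "partition \<Rightarrow> nat" where
  "psize \<mu> = sum_list (parts \<mu>)"

definition plength :: "partition \<Rightarrow> nat" where
  "plength \<mu> = length (parts \<mu>)"

text \<open>Parts are numbered from 1, and \<open>part \<mu> i = 0\<close> beyond the length.\<close>
definition part :: "partition \<Rightarrow> nat \<Rightarrow> nat" where
  "part \<mu> i = (if 1 \<le> i \<and> i \<le> plength \<mu> then parts \<mu> ! (i - 1) else 0)"

definition partitions_of :: "nat \<Rightarrow> partition set" where
  "partitions_of n = {\<mu>. psize \<mu> = n}"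

definition diagram :: "partition \<Rightarrow> (nat \<times> nat) set" where
  "diagram \<mu> = {(i, j). 1 \<le> i \<and> 1 \<le> j \<and> j \<le> part \<mu> i}"

definition standard_tableaux :: "partition \<Rightarrow> (nat \<times> nat \<Rightarrow> nat) set" where
  "standard_tableaux \<mu> = {T \<in> diagram \<mu> \<rightarrow>\<^sub>E {1..psize \<mu>}.
     bij_betw T (diagram \<mu>) {1..psize \<mu>} \<and>
     (\<forall>i j. (i, Suc j) \<in> diagram \<mu> \<and> (i, j) \<in> diagram \<mu> \<longrightarrow> T (i, j) < T (i, Suc j)) \<and>
     (\<forall>i j. (Suc i, j) \<in> diagram \<mu> \<and> (i, j) \<in> diagram \<mu> \<longrightarrow> T (i, j) < T (Suc i, j))}"

definition num_syt :: "partition \<Rightarrow> nat" where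
  "num_syt \<mu> = card (standard_tableaux \<mu>)"

text \<open>Entries range over all of \<^typ>\<open>nat\<close>, the index set of the variables of a symmetric function.\<close>
definition semistandard_tableaux :: "partition \<Rightarrow> (nat \<times> nat \<Rightarrow> nat) set" where
  "semistandard_tableaux \<mu> = {T \<in> diagram \<mu> \<rightarrow>\<^sub>E UNIV.
     (\<forall>i j. (i, Suc j) \<in> diagram \<mu> \<and> (i, j) \<in> diagram \<mu> \<longrightarrow> T (i, j) \<le> T (i, Suc j)) \<and>
     (\<forall>i j. (Suc i, j) \<in> diagram \<mu> \<and> (i, j) \<in> diagram \<mu> \<longrightarrow> T (i, j) < T (Suc i, j))}"


section \<open>Formal power series in countably many variables\<close>

abbreviation "lookup \<equiv> Poly_Mapping.lookup"
abbreviation "keys \<equiv> Poly_Mapping.keys"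
abbreviation "map_key \<equiv> Poly_Mapping.map_key"

type_synonym monomial = "nat \<Rightarrow>\<^sub>0 nat"

definition mdeg :: "monomial \<Rightarrow> nat" where
  "mdeg m = (\<Sum>i\<in>keys m. lookup m i)"

definition splits :: "monomial \<Rightarrow> (monomial \<times> monomial) set" where
  "splits m = {(a, b). a + b = m}"

lemma finite_splits: "finite (splits m)"
proof -
  have "finite {a :: monomial. \<forall>i. lookup a i \<le> lookup m i}" (is "finite ?A")
  proof (rule finite_imageD)
    let ?B = "{0..(\<Sum>i\<in>keys m. lookup m i)}"
    let ?F = "{f :: nat \<Rightarrow> nat. \<forall>x. (x \<in> keys m \<longrightarrow> f x \<in> ?B) \<and> (x \<notin> keys m \<longrightarrow> f x = 0)}"
    have "lookup ` ?A \<subseteq> ?F"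
    proof clarify
      fix a :: monomial and x
      assume a: "\<forall>i. lookup a i \<le> lookup m i"
      have "lookup a x \<le> (\<Sum>i\<in>keys m. lookup m i)" if "x \<in> keys m"
      proof -
        have "lookup m x \<le> (\<Sum>i\<in>keys m. lookup m i)"
          using that by (intro member_le_sum) simp_all
        with a show ?thesis
          using le_trans by blast
      qed
      moreover have "lookup a x = 0" if "x \<notin> keys m"
      proof -
        have "lookup m x = 0"
          using that by (simp add: in_keys_iff)
        with a[rule_format, of x] show ?thesis
          by simp
      qed
      ultimately show "(x \<in> keys m \<longrightarrow> lookup a x \<in> ?B) \<and> (x \<notin> keys m \<longrightarrow> lookup a x = 0)"
        by simp
    qed
    then show "finite (lookup ` ?A)"
      by (rule finite_subset) (rule finite_set_of_finite_funs; simp)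
    show "inj_on lookup ?A"
      by (rule inj_onI) (rule poly_mapping_eqI, simp)
  qed
  then have "finite (?A \<times> ?A)" by simp
  moreover have "splits m \<subseteq> ?A \<times> ?A"
    by (auto simp: splits_def lookup_add)
  ultimately show ?thesis by (rule rev_finite_subset)
qed

typedef series = "UNIV :: (monomial \<Rightarrow> complex) set"
  morphisms series_nth Abs_series ..

setup_lifting type_definition_series

lemma series_eqI: "(\<And>m. series_nth f m = series_nth g m) \<Longrightarrow> f = g"
  by (simp add: series_nth_inject[symmetric] fun_eq_iff)

instantiation series :: comm_ring_1
begin

lift_definition zero_series :: series is "\<lambda>_. 0" .
lift_definition one_series :: series is "\<lambda>m. if m = 0 then 1 else 0" .
lift_definition plus_series :: "series \<Rightarrow> series \<Rightarrow> series" is "\<lambda>f g m. f m + g m" .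
lift_definition minus_series :: "series \<Rightarrow> series \<Rightarrow> series" is "\<lambda>f g m. f m - g m" .
lift_definition uminus_series :: "series \<Rightarrow> series" is "\<lambda>f m. - f m" .
lift_definition times_series :: "series \<Rightarrow> series \<Rightarrow> series"
  is "\<lambda>f g m. \<Sum>(a, b)\<in>splits m. f a * g b" .

instance
proof
  fix f g h :: series
  show "f + g + h = f + (g + h)" "f + g = g + f" "0 + f = f" "- f + f = 0" "f - g = f + - g"
    by (transfer; simp add: algebra_simps)+
  show "(0 :: series) \<noteq> 1"
    by transfer (auto simp: fun_eq_iff)
  show "(f + g) * h = f * h + g * h"
    by transfer (simp add: fun_eq_iff algebra_simps sum.distrib case_prod_unfold)
  show "f * g = g * f"
  proof transfer
    fix f g :: "monomial \<Rightarrow> complex"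
    have "(\<Sum>(a, b)\<in>splits m. f a * g b) = (\<Sum>(a, b)\<in>splits m. g a * f b)" for m
      by (rule sum.reindex_bij_witness[of _ prod.swap prod.swap])
         (auto simp: splits_def add.commute)
    then show "(\<lambda>m. \<Sum>(a, b)\<in>splits m. f a * g b) = (\<lambda>m. \<Sum>(a, b)\<in>splits m. g a * f b)"
      by simp
  qed
  show "1 * f = f"
  proof transfer
    fix f :: "monomial \<Rightarrow> complex"
    have "(\<Sum>(a, b)\<in>splits m. (if a = 0 then 1 else 0) * f b) = f m" for m
    proof -
      have "(\<Sum>(a, b)\<in>splits m. (if a = 0 then 1 else 0) * f b)
          = (\<Sum>p\<in>splits m. if p = (0, m) then f m else 0)"
        by (rule sum.cong) (auto simp: splits_def split: if_splits)
      then show ?thesis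
        by (simp add: finite_splits) (simp add: splits_def)
    qed
    then show "(\<lambda>m. \<Sum>(a, b)\<in>splits m. (if a = 0 then 1 else 0) * f b) = f"
      by simp
  qed
  show "f * g * h = f * (g * h)"
  proof transfer
    fix f g h :: "monomial \<Rightarrow> complex"
    have "(\<Sum>(a, b)\<in>splits m. (\<Sum>(a, b)\<in>splits a. f a * g b) * h b)
        = (\<Sum>(a, b)\<in>splits m. f a * (\<Sum>(a, b)\<in>splits b. g a * h b))" for m
    proof -
      have "(\<Sum>(a, b)\<in>splits m. (\<Sum>(a, b)\<in>splits a. f a * g b) * h b)
          = (\<Sum>p\<in>splits m. \<Sum>q\<in>splits (fst p). f (fst q) * g (snd q) * h (snd p))"
        by (simp only: case_prod_unfold sum_distrib_right)
      also have "\<dots> = (\<Sum>(p, q)\<in>Sigma (splits m) (\<lambda>p. splits (fst p)).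
          f (fst q) * g (snd q) * h (snd p))"
        by (rule sum.Sigma) (simp_all add: finite_splits)
      also have "\<dots> = (\<Sum>(p, q)\<in>Sigma (splits m) (\<lambda>p. splits (snd p)).
          f (fst p) * (g (fst q) * h (snd q)))"
        by (rule sum.reindex_bij_witness[of _
              "\<lambda>(p, q). ((fst p + fst q, snd q), (fst p, fst q))"
              "\<lambda>(p, q). ((fst q, snd q + snd p), (snd q, snd p))"])
           (auto simp: splits_def add.assoc mult.assoc)
      also have "\<dots> = (\<Sum>p\<in>splits m. \<Sum>q\<in>splits (snd p). f (fst p) * (g (fst q) * h (snd q)))"
        by (rule sum.Sigma[symmetric]) (simp_all add: finite_splits)
      also have "\<dots> = (\<Sum>(a, b)\<in>splits m. f a * (\<Sum>(a, b)\<in>splits b. g a * h b))"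
        by (simp only: case_prod_unfold sum_distrib_left)
      finally show ?thesis .
    qed
    then show "(\<lambda>m. \<Sum>(a, b)\<in>splits m. (\<Sum>(a, b)\<in>splits a. f a * g b) * h b)
        = (\<lambda>m. \<Sum>(a, b)\<in>splits m. f a * (\<Sum>(a, b)\<in>splits b. g a * h b))"
      by simp
  qed
qed

end

lift_definition scale :: "complex \<Rightarrow> series \<Rightarrow> series" is "\<lambda>c f m. c * f m" .

interpretation series: vector_space scale
  by unfold_locales (transfer; simp add: fun_eq_iff algebra_simps)+


section \<open>Symmetric functions and the class product\<close>

definition symmetric_series :: "series \<Rightarrow> bool" where
  "symmetric_series f \<longleftrightarrow>
     (\<forall>\<pi> m. bij \<pi> \<longrightarrow> series_nth f (map_key \<pi> m) = series_nth f m)"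

definition Lambda :: "series set" where
  "Lambda = {f. symmetric_series f \<and> (\<exists>d. \<forall>m. series_nth f m \<noteq> 0 \<longrightarrow> mdeg m \<le> d)}"

lift_definition hom_component :: "nat \<Rightarrow> series \<Rightarrow> series"
  is "\<lambda>n f m. if mdeg m = n then f m else 0" .

lift_definition p1 :: series
  is "\<lambda>m. if \<exists>i. m = Poly_Mapping.single i 1 then 1 else 0" .

lift_definition schur :: "partition \<Rightarrow> series"
  is "\<lambda>\<mu> m. of_nat (card {T \<in> semistandard_tableaux \<mu>.
        \<forall>k. card {c \<in> diagram \<mu>. T c = k} = lookup m k})" .

text \<open>The coordinates of an element of \<open>\<Lambda>\<^sub>n\<close> in the basis of Schur functions.\<close>
definition schur_coord :: "nat \<Rightarrow> series \<Rightarrow> partition \<Rightarrow> complex" where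
  "schur_coord n f \<mu> = series.representation (schur ` partitions_of n) f (schur \<mu>)"

text \<open>The class product on \<open>\<Lambda>\<^sub>n\<close>: the bilinear extension of
  \<open>s\<^sub>\<mu> \<times> s\<^sub>\<nu> = \<delta>\<^sub>\<mu>\<^sub>\<nu> s\<^sub>\<mu> / f\<^sup>\<mu>\<close>.\<close>
definition class_prod :: "nat \<Rightarrow> series \<Rightarrow> series \<Rightarrow> series" where
  "class_prod n f g = (\<Sum>\<mu>\<in>partitions_of n.
     scale (schur_coord n f \<mu> * schur_coord n g \<mu> / of_nat (num_syt \<mu>)) (schur \<mu>))"

text \<open>Elements of the completion \<open>\<Prod>\<^sub>n \<Lambda>\<^sub>n\<close> are given by the sequence of their components.\<close>
type_synonym completed = "nat \<Rightarrow> series"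

definition completed_class_prod :: "completed \<Rightarrow> completed \<Rightarrow> completed" where
  "completed_class_prod F G = (\<lambda>n. class_prod n (F n) (G n))"

text \<open>The factor \<open>\<Prod>i<m. (n - i)\<close> is the falling factorial; for \<open>m \<le> n\<close> no subtraction truncates.\<close>
definition hat :: "series \<Rightarrow> completed" where
  "hat f = (\<lambda>n. \<Sum>m\<le>n. of_nat (\<Prod>i<m. (n - i)) * hom_component m f * p1 ^ (n - m))"

definition Phi :: "series \<Rightarrow> partition \<Rightarrow> complex" where
  "Phi f \<mu> = (THE c. class_prod (psize \<mu>) (hat f (psize \<mu>)) (schur \<mu>) = scale c (schur \<mu>))"

text \<open>The unit for the class product is \<open>\<Sum>\<^sub>\<mu> f\<^sup>\<mu> s\<^sub>\<mu>\<close>, which in degree \<open>n\<close> is \<open>p\<^sub>1\<^sup>n\<close>,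
  the degree \<open>n\<close> component of \<^term>\<open>hat 1\<close>.\<close>
definition stable_algebra :: "(complex, completed) module" where
  "stable_algebra = \<lparr>
     carrier = hat ` Lambda,
     monoid.mult = completed_class_prod,
     one = hat 1,
     ring.zero = (\<lambda>n. 0),
     add = (\<lambda>F G n. F n + G n),
     module.smult = (\<lambda>c F n. scale c (F n)) \<rparr>"


section \<open>Shifted symmetric functions\<close>

type_synonym mpoly = "monomial \<Rightarrow>\<^sub>0 complex"

definition variables :: "mpoly \<Rightarrow> nat set" where
  "variables p = (\<Union>m\<in>keys p. keys m)"

definition mpoly_var :: "nat \<Rightarrow> mpoly" where
  "mpoly_var i = Poly_Mapping.single (Poly_Mapping.single i 1) 1"

definition mpoly_eval :: "(nat \<Rightarrow> complex) \<Rightarrow> mpoly \<Rightarrow> complex" where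
  "mpoly_eval x p = (\<Sum>m\<in>keys p. lookup p m * (\<Prod>i\<in>keys m. x i ^ lookup m i))"

definition mpoly_subst :: "(nat \<Rightarrow> mpoly) \<Rightarrow> mpoly \<Rightarrow> mpoly" where
  "mpoly_subst x p = (\<Sum>m\<in>keys p. Poly_Mapping.single 0 (lookup p m) * (\<Prod>i\<in>keys m. x i ^ lookup m i))"

definition symmetric_poly :: "nat \<Rightarrow> mpoly \<Rightarrow> bool" where
  "symmetric_poly N q \<longleftrightarrow> variables q \<subseteq> {1..N} \<and>
     (\<forall>\<pi> m. \<pi> permutes {1..N} \<longrightarrow> lookup q (map_key \<pi> m) = lookup q m)"

text \<open>The polynomial \<open>g N\<close> uses the variables with indices \<open>1, \<dots>, N\<close>; the value \<open>g 0\<close> is irrelevant.\<close>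
definition shifted_symmetric :: "(nat \<Rightarrow> mpoly) \<Rightarrow> bool" where
  "shifted_symmetric g \<longleftrightarrow>
     (\<forall>N\<ge>1. variables (g N) \<subseteq> {1..N}) \<and>
     (\<exists>d. \<forall>N\<ge>1. \<forall>m\<in>keys (g N). mdeg m \<le> d) \<and>
     (\<forall>N\<ge>1. \<exists>q. symmetric_poly N q \<and> g N = mpoly_subst (\<lambda>i. mpoly_var i - of_nat i) q) \<and>
     (\<forall>N\<ge>1. mpoly_subst (mpoly_var (N + 1 := 0)) (g (N + 1)) = g N)"

text \<open>The value \<open>g(\<mu>\<^sub>1, \<mu>\<^sub>2, \<dots>)\<close>. By stability every \<open>g N\<close> with \<open>N \<ge> 1\<close> at least
  the length of \<open>\<mu>\<close> gives the same value.\<close>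
definition shifted_value :: "(nat \<Rightarrow> mpoly) \<Rightarrow> partition \<Rightarrow> complex" where
  "shifted_value g \<mu> = mpoly_eval (\<lambda>i. of_nat (part \<mu> i)) (g (max 1 (plength \<mu>)))"

text \<open>Shifted symmetric functions are identified with the functions they define on partitions.\<close>
definition shifted_symmetric_algebra :: "(complex, partition \<Rightarrow> complex) module" where
  "shifted_symmetric_algebra = \<lparr>
     carrier = shifted_value ` Collect shifted_symmetric,
     monoid.mult = (\<lambda>\<phi> \<psi> \<mu>. \<phi> \<mu> * \<psi> \<mu>),
     one = (\<lambda>\<mu>. 1),
     ring.zero = (\<lambda>\<mu>. 0),
     add = (\<lambda>\<phi> \<psi> \<mu>. \<phi> \<mu> + \<psi> \<mu>),
     module.smult = (\<lambda>c \<phi> \<mu>. c * \<phi> \<mu>) \<rparr>"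

definition complex_ring :: "complex ring" where
  "complex_ring = \<lparr> carrier = UNIV, monoid.mult = (*), one = 1, ring.zero = 0, add = (+) \<rparr>"

definition algebra_iso :: "'r ring \<Rightarrow> ('r, 'a) module \<Rightarrow> ('r, 'b) module \<Rightarrow> ('a \<Rightarrow> 'b) set" where
  "algebra_iso R A B = {\<theta> \<in> ring_iso A B.
     \<forall>c\<in>carrier R. \<forall>x\<in>carrier A. \<theta> (c \<odot>\<^bsub>A\<^esub> x) = c \<odot>\<^bsub>B\<^esub> \<theta> x}"

end

theory Submission
  imports Defs "Jordan_Normal_Form.Determinant"
begin

text \<open>
  The eigenvalue of \<open>\<times>\<close>-multiplication by \<open>hat f\<close> on \<open>s\<^sub>\<rho>\<close> is the coordinate of \<open>hat f\<close> at \<open>s\<^sub>\<rho>\<close>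
  divided by \<open>f\<^sup>\<rho>\<close>. So \<open>hat f\<close> and its eigenvalue function \<open>Phi f\<close> determine each other,
  \<open>\<times>\<close> becomes the pointwise product of eigenvalue functions, and everything reduces to one claim: the
  functions \<open>Phi f\<close> for \<open>f \<in> Lambda\<close> are exactly the functions on partitions that are
  given by shifted symmetric functions (\<open>Phi_image\<close>). Closure of the stable algebra under \<open>\<times>\<close> is a
  consequence of this claim, because shifted symmetric functions are closed under products.

  The Schur functions, defined by tableaux, have to be shown to be a basis of the symmetric functions.
  Removing the largest entries of a tableau turns coefficients into numbers of chains of
  horizontal strips. Reflecting the middle partition of a two-step chain shows that the
  coefficients are symmetric. The coefficient of \<open>s\<^sub>\<mu>\<close> at the monomial \<open>x\<^sup>\<nu>\<close> is triangular with
  respect to \<open>\<Sum> k \<nu>\<^bsub>k+1\<^esub>\<close> (\<open>schur_coeff_triangular\<close>), so that the Schur functions of degree \<open>n\<close>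
  are a basis (\<open>schur_expansion\<close>, \<open>schur_coord_sum\<close>). The relation
  \<open>D U\<^sub>k = U\<^sub>k D + U\<^bsub>k-1\<^esub>\<close> between removing a box and adding a horizontal strip gives the
  product with \<open>p\<^sub>1\<close> (\<open>Pieri\<close>).

  Hence the coefficient of \<open>s\<^sub>\<rho>\<close> in \<open>p\<^sub>1\<^sup>k s\<^sub>\<mu>\<close> counts the paths from \<open>\<mu>\<close> to \<open>\<rho>\<close> in Young's graph.
  With \<open>l\<^sub>i = \<rho>\<^bsub>N-i\<^esub> + i\<close> and \<open>m\<^sub>j = \<mu>\<^bsub>N-j\<^esub> + j\<close> this number is \<open>k! det[(l\<^sub>i)\<^bsub>m\<^sub>j\<^esub>] / \<Prod> l\<^sub>i!\<close>, since
  both sides obey the same recursion (\<open>young_paths_falling_det\<close>). The case of empty \<open>\<mu>\<close> computes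
  \<open>f\<^sup>\<rho>\<close>, and the quotient of the two formulas is \<open>Phi s\<^sub>\<mu> = det[(l\<^sub>i)\<^bsub>m\<^sub>j\<^esub>] / det[(l\<^sub>i)\<^sub>j]\<close>. Newton
  interpolation splits the Vandermonde determinant off the numerator
  (\<open>falling_det_factorization\<close>), so that the quotient is a symmetric polynomial of degree at
  most \<open>|\<mu>|\<close> in the \<open>l\<^sub>i\<close>. Therefore \<open>Phi s\<^sub>\<mu>\<close> is shifted symmetric of degree at most \<open>|\<mu>|\<close>.

  Conversely, let \<open>\<phi>\<close> be shifted symmetric of degree at most \<open>d\<close>. Since \<open>Phi s\<^sub>\<mu>\<close> vanishes at all
  \<open>\<rho> \<noteq> \<mu>\<close> with \<open>|\<rho>| \<le> |\<mu>|\<close> and not at \<open>\<mu>\<close>, some combination of the \<open>Phi s\<^sub>\<mu>\<close> with \<open>|\<mu>| \<le> d\<close> agrees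
  with \<open>\<phi>\<close> at all partitions of size at most \<open>d\<close>. A shifted symmetric function of degree at most
  \<open>d\<close> that vanishes at all these partitions is zero (\<open>sym_polyfun_eq_0\<close>), so \<open>\<phi>\<close> is this combination.
\<close>

section \<open>Partitions as decreasing sequences\<close>

lemma parts_sorted: "sorted_wrt (\<ge>) (parts \<mu>)"
  and parts_nonzero: "0 \<notin> set (parts \<mu>)"
  using parts[of \<mu>] by auto

lemma part_0 [simp]: "part \<mu> 0 = 0"
  by (simp add: part_def)

lemma part_eq_0_iff: "1 \<le> i \<Longrightarrow> part \<mu> i = 0 \<longleftrightarrow> plength \<mu> < i"
proof -
  assume i: "1 \<le> i"
  show ?thesis
  proof (cases "i \<le> plength \<mu>")
    case True
    then have "parts \<mu> ! (i - 1) \<in> set (parts \<mu>)" using i by (simp add: plength_def)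
    then have "parts \<mu> ! (i - 1) \<noteq> 0" using parts_nonzero[of \<mu>] by metis
    then show ?thesis using True i by (simp add: part_def)
  qed (auto simp: part_def)
qed

lemma part_antimono: "1 \<le> i \<Longrightarrow> i \<le> j \<Longrightarrow> part \<mu> j \<le> part \<mu> i"
  using parts_sorted[of \<mu>] unfolding part_def plength_def sorted_wrt_iff_nth_less
  by (cases "i = j") auto

lemma part_Suc_le: "1 \<le> i \<Longrightarrow> part \<mu> (Suc i) \<le> part \<mu> i"
  by (rule part_antimono) auto

lemma partition_eqI:
  assumes "\<And>i. 1 \<le> i \<Longrightarrow> part \<mu> i = part \<nu> i"
  shows "\<mu> = \<nu>"
proof -
  have "plength \<mu> < i \<longleftrightarrow> plength \<nu> < i" if "1 \<le> i" for i
    using assms[OF that] part_eq_0_iff[OF that] by metis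
  from this[of "Suc (plength \<mu>)"] this[of "Suc (plength \<nu>)"]
  have len: "plength \<mu> = plength \<nu>" by simp
  have "parts \<mu> = parts \<nu>"
  proof (rule nth_equalityI)
    show "length (parts \<mu>) = length (parts \<nu>)" using len by (simp add: plength_def)
    fix i assume "i < length (parts \<mu>)"
    then show "parts \<mu> ! i = parts \<nu> ! i"
      using assms[of "Suc i"] len by (simp add: part_def plength_def)
  qed
  then show ?thesis by (simp add: parts_inject)
qed

lemma partition_exists:
  assumes dec: "\<And>i. 1 \<le> i \<Longrightarrow> f (Suc i) \<le> f i" and fin: "f (Suc N) = 0"
  shows "\<exists>\<mu>. \<forall>i\<ge>1. part \<mu> i = f i"
proof -
  define L where "L = (LEAST i. f (Suc i) = 0)"
  have dec': "f j \<le> f i" if "1 \<le> i" "i \<le> j" for i j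
    using that(2)
  proof (induction j rule: dec_induct)
    case (step n)
    then show ?case using dec[of n] that(1) by simp
  qed simp
  have L: "f (Suc L) = 0" unfolding L_def using fin by (rule LeastI)
  have big: "f i = 0" if "i > L" for i
    using dec'[of "Suc L" i] L that by simp
  have small: "f i > 0" if "1 \<le> i" "i \<le> L" for i
    using not_less_Least[of "i - 1" "\<lambda>i. f (Suc i) = 0"] that unfolding L_def[symmetric] by simp
  define xs where "xs = map (\<lambda>i. f (Suc i)) [0..<L]"
  have xs: "sorted_wrt (\<ge>) xs \<and> 0 \<notin> set xs"
  proof
    show "sorted_wrt (\<ge>) xs" unfolding sorted_wrt_iff_nth_less xs_def by (auto intro: dec')
    show "0 \<notin> set xs" 
    proof
      assume "0 \<in> set xs"
      then obtain i where "i < L" "f (Suc i) = 0" by (auto simp: xs_def)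
      then show False using small[of "Suc i"] by simp
    qed
  qed
  then have p: "parts (Abs_partition xs) = xs" by (intro Abs_partition_inverse) simp
  have "part (Abs_partition xs) i = f i" if "1 \<le> i" for i
    using that big[of i] by (auto simp: part_def plength_def p) (auto simp: xs_def)
  then show ?thesis by blast
qed

lemma psize_eq_sum: "plength \<mu> \<le> N \<Longrightarrow> psize \<mu> = (\<Sum>i=1..N. part \<mu> i)"
proof -
  assume N: "plength \<mu> \<le> N"
  have "psize \<mu> = (\<Sum>i<plength \<mu>. parts \<mu> ! i)"
    by (simp add: psize_def plength_def sum_list_sum_nth atLeast0LessThan)
  also have "\<dots> = (\<Sum>i=1..plength \<mu>. part \<mu> i)"
    by (rule sum.reindex_bij_witness[of _ "\<lambda>i. i - 1" Suc]) (auto simp: part_def)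
  also have "\<dots> = (\<Sum>i=1..N. part \<mu> i)"
    by (rule sum.mono_neutral_left) (use N in \<open>auto simp: part_def\<close>)
  finally show ?thesis .
qed

lemma part_le_psize: "part \<mu> i \<le> psize \<mu>"
  using member_le_sum[of i "{1..plength \<mu>}" "part \<mu>"] psize_eq_sum[of \<mu> "plength \<mu>"]
  by (cases "i \<in> {1..plength \<mu>}") (auto simp: part_def)

lemma plength_le_psize: "plength \<mu> \<le> psize \<mu>"
proof -
  have "part \<mu> i \<ge> 1" if "i \<in> {1..plength \<mu>}" for i
    using that part_eq_0_iff[of i \<mu>] by (cases "part \<mu> i") auto
  then have "(\<Sum>i=1..plength \<mu>. 1) \<le> (\<Sum>i=1..plength \<mu>. part \<mu> i)" by (intro sum_mono)
  then show ?thesis by (simp add: psize_eq_sum[of \<mu> "plength \<mu>"])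
qed

lemma finite_psize_le: "finite {\<mu>. psize \<mu> \<le> n}"
proof -
  have "parts ` {\<mu>. psize \<mu> \<le> n} \<subseteq> {xs. set xs \<subseteq> {0..n} \<and> length xs \<le> n}"
  proof clarsimp
    fix \<mu> assume n: "psize \<mu> \<le> n"
    then have "length (parts \<mu>) \<le> n" using plength_le_psize[of \<mu>] by (simp add: plength_def)
    moreover have "x \<le> n" if "x \<in> set (parts \<mu>)" for x
      using member_le_sum_list[OF that] n by (simp add: psize_def)
    ultimately show "set (parts \<mu>) \<subseteq> {0..n} \<and> length (parts \<mu>) \<le> n" by auto
  qed
  then have "finite (parts ` {\<mu>. psize \<mu> \<le> n})"
    by (rule finite_subset) (rule finite_lists_length_le; simp)
  then show ?thesis by (rule finite_imageD) (auto intro: inj_onI simp: parts_inject)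
qed

lemma finite_partitions_of [simp]: "finite (partitions_of n)"
  by (rule finite_subset[OF _ finite_psize_le[of n]]) (auto simp: partitions_of_def)

lemma psize_0_part: "psize \<mu> = 0 \<Longrightarrow> part \<mu> i = 0"
  using part_le_psize[of \<mu> i] by simp

definition empty_partition :: partition where "empty_partition = Abs_partition []"

lemma parts_empty_partition [simp]: "parts empty_partition = []"
  by (simp add: empty_partition_def Abs_partition_inverse)

lemma part_empty_partition [simp]: "part empty_partition i = 0"
  by (simp add: part_def plength_def)

lemma psize_empty_partition [simp]: "psize empty_partition = 0"
  by (simp add: psize_def)

lemma psize_eq_0_iff: "psize \<mu> = 0 \<longleftrightarrow> \<mu> = empty_partition"
  by (auto intro: partition_eqI simp: psize_0_part)

lemma diagram_eq_Sigma: "plength \<mu> \<le> N \<Longrightarrow> diagram \<mu> = Sigma {1..N} (\<lambda>i. {1..part \<mu> i})"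
  by (auto simp: diagram_def) (auto simp: part_def split: if_splits)

lemma finite_diagram [simp]: "finite (diagram \<mu>)"
  by (simp add: diagram_eq_Sigma[of \<mu> "plength \<mu>"])

lemma card_diagram: "card (diagram \<mu>) = psize \<mu>"
  using diagram_eq_Sigma[of \<mu> "plength \<mu>"] psize_eq_sum[of \<mu> "plength \<mu>"] by simp

section \<open>Horizontal strips and Kostka numbers\<close>

definition hstrip :: "partition \<Rightarrow> partition \<Rightarrow> bool" where
  "hstrip \<nu> \<mu> \<longleftrightarrow> (\<forall>i\<ge>1. part \<nu> i \<le> part \<mu> i \<and> part \<mu> (Suc i) \<le> part \<nu> i)"

definition adds_box :: "partition \<Rightarrow> partition \<Rightarrow> bool" where
  "adds_box \<mu> \<nu> \<longleftrightarrow> (\<exists>i\<ge>1. part \<nu> = (part \<mu>)(i := Suc (part \<mu> i)))"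

text \<open>
  The number of chains of partitions from the empty one to \<open>\<mu>\<close> in which step \<open>i\<close> adds a horizontal strip
  of size \<open>a i\<close>, for \<open>i < N\<close>; these are Gelfand-Tsetlin patterns.
\<close>

primrec kostka :: "nat \<Rightarrow> partition \<Rightarrow> (nat \<Rightarrow> nat) \<Rightarrow> nat" where
  "kostka 0 \<mu> a = (if psize \<mu> = 0 then 1 else 0)"
| "kostka (Suc N) \<mu> a = (\<Sum>\<nu> | hstrip \<nu> \<mu> \<and> psize \<nu> + a N = psize \<mu>. kostka N \<nu> a)"

text \<open>
  Since every weakly decreasing \<open>f\<close> that is eventually zero is the sequence of parts of exactly one
  partition, the choice is unique in all uses.
\<close>

definition partition_of_fun :: "(nat \<Rightarrow> nat) \<Rightarrow> partition" where
  "partition_of_fun f = (SOME \<mu>. \<forall>i\<ge>1. part \<mu> i = f i)"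

lemma part_partition_of_fun:
  assumes "\<And>i. 1 \<le> i \<Longrightarrow> f (Suc i) \<le> f i" and "f (Suc N) = 0" and "1 \<le> i"
  shows "part (partition_of_fun f) i = f i"
  using someI_ex[OF partition_exists[of f N, OF assms(1,2)]] assms(3)
  unfolding partition_of_fun_def by blast

lemma plength_mono:
  assumes "\<And>i. 1 \<le> i \<Longrightarrow> part \<nu> i \<le> part \<mu> i"
  shows "plength \<nu> \<le> plength \<mu>"
  using assms[of "Suc (plength \<mu>)"] part_eq_0_iff[of "Suc (plength \<mu>)" \<mu>]
    part_eq_0_iff[of "Suc (plength \<mu>)" \<nu>] by simp

lemma psize_mono:
  assumes "\<And>i. 1 \<le> i \<Longrightarrow> part \<nu> i \<le> part \<mu> i"
  shows "psize \<nu> \<le> psize \<mu>"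
  using psize_eq_sum[OF plength_mono[OF assms]] psize_eq_sum[of \<mu> "plength \<mu>"]
  by (auto intro!: sum_mono assms)

lemma hstrip_psize: "hstrip \<nu> \<mu> \<Longrightarrow> psize \<nu> \<le> psize \<mu>"
  by (rule psize_mono) (simp add: hstrip_def)

lemma finite_hstrip [simp]: "finite {\<nu>. hstrip \<nu> \<mu> \<and> P \<nu>}"
  by (rule finite_subset[OF _ finite_psize_le[of "psize \<mu>"]]) (auto dest: hstrip_psize)

lemma adds_box_psize: "adds_box \<mu> \<nu> \<Longrightarrow> psize \<nu> = Suc (psize \<mu>)"
proof -
  assume "adds_box \<mu> \<nu>"
  then obtain i where i: "i \<ge> 1" "part \<nu> = (part \<mu>)(i := Suc (part \<mu> i))"
    by (auto simp: adds_box_def)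
  define N where "N = max i (max (plength \<mu>) (plength \<nu>))"
  have "psize \<nu> = (\<Sum>j=1..N. part \<nu> j)" by (rule psize_eq_sum) (simp add: N_def)
  also have "\<dots> = part \<nu> i + (\<Sum>j\<in>{1..N} - {i}. part \<nu> j)"
    by (rule sum.remove) (use i in \<open>auto simp: N_def\<close>)
  also have "\<dots> = Suc (part \<mu> i + (\<Sum>j\<in>{1..N} - {i}. part \<mu> j))" by (simp add: i)
  also have "part \<mu> i + (\<Sum>j\<in>{1..N} - {i}. part \<mu> j) = (\<Sum>j=1..N. part \<mu> j)"
    by (rule sum.remove[symmetric]) (use i in \<open>auto simp: N_def\<close>)
  also have "\<dots> = psize \<mu>" by (rule psize_eq_sum[symmetric]) (simp add: N_def)
  finally show ?thesis .
qed

lemma finite_adds_box [simp]: "finite {\<nu>. adds_box \<mu> \<nu> \<and> P \<nu>}"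
  by (rule finite_subset[OF _ finite_psize_le[of "Suc (psize \<mu>)"]]) (auto dest: adds_box_psize)

section \<open>Symmetry of the Kostka numbers\<close>

text \<open>
  If \<open>\<kappa> \<subseteq> \<nu> \<subseteq> \<mu>\<close> is a chain of horizontal strips, then the part \<open>\<nu>\<^sub>i\<close> ranges over the interval
  between \<open>max \<mu>\<^bsub>i+1\<^esub> \<kappa>\<^sub>i\<close> and \<open>min \<mu>\<^sub>i \<kappa>\<^bsub>i-1\<^esub>\<close>, where for \<open>i = 1\<close> the upper end is \<open>\<mu>\<^sub>1\<close>,
  independently of the other parts. This is the sum of the two ends, and reflecting every part in
  its interval is the Bender-Knuth involution.
\<close>

definition toggle_sum :: "partition \<Rightarrow> partition \<Rightarrow> nat \<Rightarrow> nat" where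
  "toggle_sum \<kappa> \<mu> i = max (part \<mu> (Suc i)) (part \<kappa> i)
     + (if i = 1 then part \<mu> 1 else min (part \<mu> i) (part \<kappa> (i - 1)))"

definition toggle :: "partition \<Rightarrow> partition \<Rightarrow> partition \<Rightarrow> partition" where
  "toggle \<kappa> \<mu> \<nu> = partition_of_fun (\<lambda>i. toggle_sum \<kappa> \<mu> i - part \<nu> i)"

lemma part_toggle:
  assumes \<kappa>: "hstrip \<kappa> \<nu>" and \<mu>: "hstrip \<nu> \<mu>" and "1 \<le> i"
  shows "part (toggle \<kappa> \<mu> \<nu>) i = toggle_sum \<kappa> \<mu> i - part \<nu> i"
  unfolding toggle_def
proof (rule part_partition_of_fun[where N = "Suc (plength \<mu> + plength \<kappa>)", OF _ _ \<open>1 \<le> i\<close>])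
  have \<kappa>': "part \<kappa> i \<le> part \<nu> i" "part \<nu> (Suc i) \<le> part \<kappa> i" if "1 \<le> i" for i
    using \<kappa> that by (auto simp: hstrip_def)
  have \<mu>': "part \<nu> i \<le> part \<mu> i" "part \<mu> (Suc i) \<le> part \<nu> i" if "1 \<le> i" for i
    using \<mu> that by (auto simp: hstrip_def)
  fix i :: nat assume "1 \<le> i"
  then obtain j where j: "i = Suc j" by (cases i) auto
  show "toggle_sum \<kappa> \<mu> (Suc i) - part \<nu> (Suc i) \<le> toggle_sum \<kappa> \<mu> i - part \<nu> i"
    using \<kappa>'[of i] \<kappa>'[of j] \<mu>'[of i] \<mu>'[of "Suc i"] \<kappa>'[of "Suc i"] j
    by (cases "j = 0") (auto simp: toggle_sum_def)
next
  have "part \<mu> k = 0" "part \<kappa> k = 0" if "k > plength \<mu> + plength \<kappa>" for k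
    using part_eq_0_iff[of k \<mu>] part_eq_0_iff[of k \<kappa>] that by auto
  then show "toggle_sum \<kappa> \<mu> (Suc (Suc (plength \<mu> + plength \<kappa>)))
      - part \<nu> (Suc (Suc (plength \<mu> + plength \<kappa>))) = 0"
    by (simp add: toggle_sum_def)
qed

text \<open>
  The size identity holds because \<open>max \<mu>\<^bsub>i+1\<^esub> \<kappa>\<^sub>i + min \<mu>\<^bsub>i+1\<^esub> \<kappa>\<^sub>i = \<mu>\<^bsub>i+1\<^esub> + \<kappa>\<^sub>i\<close>: summed over
  \<open>i\<close>, the interval ends telescope to \<open>|\<kappa>| + |\<mu>|\<close>. So the reflection exchanges the sizes of the
  two strips.
\<close>

lemma toggle:
  assumes \<kappa>: "hstrip \<kappa> \<nu>" and \<mu>: "hstrip \<nu> \<mu>"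
  shows "hstrip \<kappa> (toggle \<kappa> \<mu> \<nu>)" "hstrip (toggle \<kappa> \<mu> \<nu>) \<mu>"
    "toggle \<kappa> \<mu> (toggle \<kappa> \<mu> \<nu>) = \<nu>"
    "psize (toggle \<kappa> \<mu> \<nu>) + psize \<nu> = psize \<kappa> + psize \<mu>"
proof -
  have \<kappa>': "part \<kappa> i \<le> part \<nu> i" "part \<nu> (Suc i) \<le> part \<kappa> i" if "1 \<le> i" for i
    using \<kappa> that by (auto simp: hstrip_def)
  have \<mu>': "part \<nu> i \<le> part \<mu> i" "part \<mu> (Suc i) \<le> part \<nu> i" if "1 \<le> i" for i
    using \<mu> that by (auto simp: hstrip_def)
  note t = part_toggle[OF \<kappa> \<mu>]
  show 1: "hstrip \<kappa> (toggle \<kappa> \<mu> \<nu>)" unfolding hstrip_def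
  proof (intro allI impI)
    fix i :: nat assume "1 \<le> i"
    then obtain j where "i = Suc j" by (cases i) auto
    then show "part \<kappa> i \<le> part (toggle \<kappa> \<mu> \<nu>) i \<and> part (toggle \<kappa> \<mu> \<nu>) (Suc i) \<le> part \<kappa> i"
      using \<kappa>'[of i] \<kappa>'[of j] \<mu>'[of i] \<mu>'[of "Suc i"] \<kappa>'[of "Suc i"] t[of i] t[of "Suc i"]
      by (cases "j = 0") (auto simp: toggle_sum_def)
  qed
  show 2: "hstrip (toggle \<kappa> \<mu> \<nu>) \<mu>" unfolding hstrip_def
  proof (intro allI impI)
    fix i :: nat assume "1 \<le> i"
    then obtain j where "i = Suc j" by (cases i) auto
    then show "part (toggle \<kappa> \<mu> \<nu>) i \<le> part \<mu> i \<and> part \<mu> (Suc i) \<le> part (toggle \<kappa> \<mu> \<nu>) i"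
      using \<kappa>'[of i] \<kappa>'[of j] \<mu>'[of i] \<mu>'[of "Suc i"] \<kappa>'[of "Suc i"] t[of i] t[of "Suc i"]
      by (cases "j = 0") (auto simp: toggle_sum_def)
  qed
  have sum2: "part (toggle \<kappa> \<mu> \<nu>) i + part \<nu> i = toggle_sum \<kappa> \<mu> i" if "1 \<le> i" for i
  proof -
    from that obtain j where "i = Suc j" by (cases i) auto
    then show ?thesis
      using \<kappa>'[of i] \<kappa>'[of j] \<mu>'[of i] t[of i] by (cases "j = 0") (auto simp: toggle_sum_def)
  qed
  show "toggle \<kappa> \<mu> (toggle \<kappa> \<mu> \<nu>) = \<nu>"
  proof (rule partition_eqI)
    fix i :: nat assume i: "1 \<le> i"
    show "part (toggle \<kappa> \<mu> (toggle \<kappa> \<mu> \<nu>)) i = part \<nu> i"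
      unfolding part_toggle[OF 1 2 i] sum2[OF i, symmetric] by simp
  qed
  define N where "N = Suc (plength \<mu>)"
  have N: "part \<mu> (Suc N) = 0" "part \<mu> N = 0" unfolding N_def by (simp_all add: part_eq_0_iff)
  (* The term at \<open>Suc n\<close> on the left is the part of the telescoping sum that is still unpaired. *)
  have *: "(\<Sum>i=1..n. part (toggle \<kappa> \<mu> \<nu>) i + part \<nu> i) + min (part \<mu> (Suc n)) (part \<kappa> n)
     = (\<Sum>i=1..n. part \<kappa> i + part \<mu> i) + part \<mu> (Suc n)" if "n \<ge> 1" for n
    using that
  proof (induction n rule: dec_induct)
    case base
    then show ?case using sum2[of 1] by (simp add: toggle_sum_def)
  next
    case (step n)
    then show ?case using sum2[of "Suc n"] by (simp add: toggle_sum_def max_def min_def split: if_splits)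
  qed
  have len: "plength \<nu> \<le> plength \<mu>" "plength \<kappa> \<le> plength \<nu>" "plength (toggle \<kappa> \<mu> \<nu>) \<le> plength \<mu>"
    using \<kappa> \<mu> 2 by (auto intro!: plength_mono simp: hstrip_def)
  have "psize \<nu> = (\<Sum>i=1..N. part \<nu> i)" "psize \<mu> = (\<Sum>i=1..N. part \<mu> i)"
    "psize \<kappa> = (\<Sum>i=1..N. part \<kappa> i)"
    "psize (toggle \<kappa> \<mu> \<nu>) = (\<Sum>i=1..N. part (toggle \<kappa> \<mu> \<nu>) i)"
    by (rule psize_eq_sum; use len in \<open>simp add: N_def\<close>)+
  then show "psize (toggle \<kappa> \<mu> \<nu>) + psize \<nu> = psize \<kappa> + psize \<mu>"
    using *[of N] N by (simp add: sum.distrib N_def)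
qed

lemma kostka_cong: "(\<And>i. i < N \<Longrightarrow> b i = b' i) \<Longrightarrow> kostka N \<nu> b = kostka N \<nu> b'"
  by (induction N arbitrary: \<nu>) (auto intro!: sum.cong)

lemma kostka_swap_top:
  "kostka (Suc (Suc N)) \<mu> a = kostka (Suc (Suc N)) \<mu> (a(N := a (Suc N), Suc N := a N))"
proof -
  define P where "P = Sigma {\<nu>. hstrip \<nu> \<mu> \<and> psize \<nu> + a (Suc N) = psize \<mu>}
      (\<lambda>\<nu>. {\<kappa>. hstrip \<kappa> \<nu> \<and> psize \<kappa> + a N = psize \<nu>})"
  define Q where "Q = Sigma {\<nu>. hstrip \<nu> \<mu> \<and> psize \<nu> + a N = psize \<mu>}
      (\<lambda>\<nu>. {\<kappa>. hstrip \<kappa> \<nu> \<and> psize \<kappa> + a (Suc N) = psize \<nu>})"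
  have "kostka (Suc (Suc N)) \<mu> a = (\<Sum>(\<nu>, \<kappa>)\<in>P. kostka N \<kappa> a)"
    unfolding P_def by (simp add: sum.Sigma)
  also have "\<dots> = (\<Sum>(\<nu>, \<kappa>)\<in>Q. kostka N \<kappa> a)"
    by (rule sum.reindex_bij_witness[of _ "\<lambda>(\<nu>, \<kappa>). (toggle \<kappa> \<mu> \<nu>, \<kappa>)" "\<lambda>(\<nu>, \<kappa>). (toggle \<kappa> \<mu> \<nu>, \<kappa>)"])
       (auto simp: P_def Q_def toggle dest: toggle(4))
  also have "\<dots> = (\<Sum>(\<nu>, \<kappa>)\<in>Q. kostka N \<kappa> (a(N := a (Suc N), Suc N := a N)))"
    by (intro sum.cong refl) (auto intro: kostka_cong)
  also have "\<dots> = kostka (Suc (Suc N)) \<mu> (a(N := a (Suc N), Suc N := a N))"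
    unfolding Q_def by (simp add: sum.Sigma)
  finally show ?thesis .
qed

text \<open>
  The chain below level \<open>k\<close> and above level \<open>Suc k\<close> stays as it is, so this reduces to a reflection at the
  top of a shorter chain.
\<close>

lemma kostka_swap:
  "Suc k < N \<Longrightarrow> kostka N \<mu> (a(k := a (Suc k), Suc k := a k)) = kostka N \<mu> a"
proof (induction N arbitrary: \<mu>)
  case (Suc N)
  show ?case
  proof (cases "Suc k = N")
    case True
    then show ?thesis using kostka_swap_top[of k \<mu> a] by (simp del: kostka.simps fun_upd_apply)
  next
    case False
    then show ?thesis using Suc by simp
  qed
qed simp

section \<open>Adding a box and removing a horizontal strip\<close>

definition interlaces :: "(nat \<Rightarrow> nat) \<Rightarrow> (nat \<Rightarrow> nat) \<Rightarrow> bool" where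
  "interlaces f g \<longleftrightarrow> (\<forall>i\<ge>1. f i \<le> g i \<and> g (Suc i) \<le> f i)"

text \<open>
  \<open>A\<close> consists of the rows in which a box can be added to \<open>g\<close>, and \<open>B\<close> of those in which a box can be removed
  from \<open>f\<close>, such that the result interlaces. If \<open>f\<close> and \<open>g\<close> already interlace, then the condition for removing a box in
  row \<open>i\<close> and that for adding one in row \<open>i + 1\<close> are both \<open>g\<^bsub>i+1\<^esub> < f\<^sub>i\<close>, and row \<open>1\<close> is always
  possible for adding. If they do not, both moves have to repair a violation \<open>f\<^sub>i = g\<^sub>i + 1\<close> in the
  same row \<open>i\<close>.
\<close>

lemma interlaces_boxes:
  assumes f: "\<And>i. 1 \<le> i \<Longrightarrow> f (Suc i) \<le> f i" and g: "\<And>i. 1 \<le> i \<Longrightarrow> g (Suc i) \<le> g i"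
  defines "A \<equiv> {i. 1 \<le> i \<and> interlaces f (g(i := Suc (g i)))}"
    and "B \<equiv> {i. 1 \<le> i \<and> f i > 0 \<and> interlaces (f(i := f i - 1)) g}"
  shows "interlaces f g \<Longrightarrow> A = insert 1 (Suc ` B)" and "\<not> interlaces f g \<Longrightarrow> A = B"
proof -
  assume "interlaces f g"
  then have fg: "f i \<le> g i" "g (Suc i) \<le> f i" if "1 \<le> i" for i
    using that by (auto simp: interlaces_def)
  have A: "Suc j \<in> A \<longleftrightarrow> j = 0 \<or> g (Suc j) < f j" for j
  proof
    assume "Suc j \<in> A"
    then have "1 \<le> j \<Longrightarrow> (g(Suc j := Suc (g (Suc j)))) (Suc j) \<le> f j"
      unfolding A_def interlaces_def by blast
    then show "j = 0 \<or> g (Suc j) < f j" by (cases "j = 0") auto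
  next
    assume j: "j = 0 \<or> g (Suc j) < f j"
    have "f i \<le> (g(Suc j := Suc (g (Suc j)))) i \<and> (g(Suc j := Suc (g (Suc j)))) (Suc i) \<le> f i"
      if "1 \<le> i" for i using fg[OF that] j that by auto
    then show "Suc j \<in> A" by (auto simp: A_def interlaces_def)
  qed
  have B: "j \<in> B \<longleftrightarrow> g (Suc j) < f j" if "1 \<le> j" for j
  proof
    assume "j \<in> B"
    then have "0 < f j" "g (Suc j) \<le> (f(j := f j - 1)) j"
      using that unfolding B_def interlaces_def by blast+
    then show "g (Suc j) < f j" by simp
  next
    assume j: "g (Suc j) < f j"
    have "(f(j := f j - 1)) i \<le> g i \<and> g (Suc i) \<le> (f(j := f j - 1)) i"
      if "1 \<le> i" for i using fg[OF that] j by auto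
    then show "j \<in> B" using j that by (auto simp: B_def interlaces_def)
  qed
  show "A = insert 1 (Suc ` B)"
  proof (rule Set.set_eqI)
    fix i
    have "0 \<notin> A" "0 \<notin> B" by (auto simp: A_def B_def)
    then show "i \<in> A \<longleftrightarrow> i \<in> insert 1 (Suc ` B)"
    proof (cases i)
      case (Suc j)
      then show ?thesis using A[of j] B[of j] \<open>0 \<notin> B\<close> by (cases "j = 0") auto
    qed auto
  qed
next
  assume fg: "\<not> interlaces f g"
  have "f i = Suc (g i)" if "i \<in> A" for i
  proof (rule ccontr)
    assume ne: "f i \<noteq> Suc (g i)"
    have a: "f j \<le> (g(i := Suc (g i))) j" "(g(i := Suc (g i))) (Suc j) \<le> f j" if "1 \<le> j" for j
      using that \<open>i \<in> A\<close> by (auto simp: A_def interlaces_def)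
    have "f j \<le> g j \<and> g (Suc j) \<le> f j" if "1 \<le> j" for j
      using a[OF that] ne by (auto split: if_splits)
    with fg show False by (simp add: interlaces_def)
  qed
  moreover have "f i = Suc (g i)" if "i \<in> B" for i
  proof (rule ccontr)
    assume ne: "f i \<noteq> Suc (g i)"
    have a: "(f(i := f i - 1)) j \<le> g j" "g (Suc j) \<le> (f(i := f i - 1)) j" if "1 \<le> j" for j
      using that \<open>i \<in> B\<close> by (auto simp: B_def interlaces_def)
    have "f j \<le> g j \<and> g (Suc j) \<le> f j" if "1 \<le> j" for j
      using a[OF that] ne by (auto split: if_splits)
    with fg show False by (simp add: interlaces_def)
  qed
  moreover have "i \<in> A \<longleftrightarrow> i \<in> B" if e: "f i = Suc (g i)" "1 \<le> i" for i
  proof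
    assume "i \<in> A"
    then have a: "f j \<le> (g(i := Suc (g i))) j" "(g(i := Suc (g i))) (Suc j) \<le> f j" if "1 \<le> j" for j
      using that by (auto simp: A_def interlaces_def)
    have "interlaces (f(i := f i - 1)) g" unfolding interlaces_def
    proof (intro allI impI)
      fix j :: nat assume "1 \<le> j"
      then show "(f(i := f i - 1)) j \<le> g j \<and> g (Suc j) \<le> (f(i := f i - 1)) j"
        using a[of j] g[of j] e by (auto split: if_splits)
    qed
    then show "i \<in> B" using e by (simp add: B_def)
  next
    assume "i \<in> B"
    then have a: "(f(i := f i - 1)) j \<le> g j" "g (Suc j) \<le> (f(i := f i - 1)) j" if "1 \<le> j" for j
      using that by (auto simp: B_def interlaces_def)
    have "interlaces f (g(i := Suc (g i)))" unfolding interlaces_def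
    proof (intro allI impI)
      fix j :: nat assume "1 \<le> j"
      then show "f j \<le> (g(i := Suc (g i))) j \<and> (g(i := Suc (g i))) (Suc j) \<le> f j"
        using a[of j] f[of j] e by (auto split: if_splits)
    qed
    then show "i \<in> A" using e by (simp add: A_def)
  qed
  moreover have "1 \<le> i" if "i \<in> A \<or> i \<in> B" for i using that by (auto simp: A_def B_def)
  ultimately show "A = B" by blast
qed

text \<open>
  Let \<open>D\<close> remove a box and \<open>U\<^sub>k\<close> add a horizontal strip of size \<open>k\<close>, each in all possible ways. This is
  the coefficient form of \<open>D U\<^sub>k = U\<^sub>k D + U\<^bsub>k-1\<^esub>\<close>, summed over \<open>k\<close>. The single relations follow, since the
  sizes of \<open>\<mu>\<close> and \<open>\<nu>\<close> fix \<open>k\<close>.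
\<close>

lemma card_hstrip_boxes:
  "card {\<rho>. adds_box \<mu> \<rho> \<and> hstrip \<nu> \<rho>} =
     card {\<kappa>. adds_box \<kappa> \<nu> \<and> hstrip \<kappa> \<mu>} + (if hstrip \<nu> \<mu> then 1 else 0)"
proof -
  let ?A = "{i. 1 \<le> i \<and> interlaces (part \<nu>) ((part \<mu>)(i := Suc (part \<mu> i)))}"
  let ?B = "{i. 1 \<le> i \<and> part \<nu> i > 0 \<and> interlaces ((part \<nu>)(i := part \<nu> i - 1)) (part \<mu>)}"
  have hs: "hstrip \<alpha> \<beta> \<longleftrightarrow> interlaces (part \<alpha>) (part \<beta>)" for \<alpha> \<beta>
    by (simp add: hstrip_def interlaces_def)
  have dec: "interlaces f g \<Longrightarrow> 1 \<le> i \<Longrightarrow> f (Suc i) \<le> f i \<and> g (Suc i) \<le> g i" for f g i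
    by (auto simp: interlaces_def intro: le_trans)
  have ex: "\<exists>\<rho>. part \<rho> = h" if h: "\<And>i. 1 \<le> i \<Longrightarrow> h (Suc i) \<le> h i" "h (Suc N) = 0" "h 0 = 0" for h and N :: nat
  proof -
    obtain \<rho> where "\<forall>i\<ge>1. part \<rho> i = h i" using partition_exists[of h N, OF h(1,2)] by blast
    then have "part \<rho> i = h i" for i using h by (cases "i = 0") auto
    then show ?thesis by auto
  qed
  have z: "part \<alpha> i = 0" if "i > plength \<alpha>" for \<alpha> i using that part_eq_0_iff[of i \<alpha>] by simp
  define up where "up f i = f(i := Suc (f i))" for f :: "nat \<Rightarrow> nat" and i
  define dn where "dn f i = f(i := f i - 1)" for f :: "nat \<Rightarrow> nat" and i
  have inj: "inj part" by (rule injI) (auto intro: partition_eqI)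
  have "part ` {\<rho>. adds_box \<mu> \<rho> \<and> hstrip \<nu> \<rho>} = up (part \<mu>) ` ?A" (is "?L = ?R")
  proof
    show "?L \<subseteq> ?R" by (auto simp: adds_box_def hs up_def)
    show "?R \<subseteq> ?L"
    proof clarify
      fix i :: nat assume i: "1 \<le> i" "interlaces (part \<nu>) ((part \<mu>)(i := Suc (part \<mu> i)))"
      obtain \<rho> where "part \<rho> = (part \<mu>)(i := Suc (part \<mu> i))"
        using ex[of "(part \<mu>)(i := Suc (part \<mu> i))" "plength \<mu> + i"] dec[OF i(2)] i(1) z
        by auto
      then show "up (part \<mu>) i \<in> ?L"
        using i by (auto simp: adds_box_def hs up_def intro!: image_eqI[of _ _ \<rho>])
    qed
  qed
  then have "card {\<rho>. adds_box \<mu> \<rho> \<and> hstrip \<nu> \<rho>} = card (up (part \<mu>) ` ?A)"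
    by (metis card_image inj inj_on_subset subset_UNIV)
  also have "\<dots> = card ?A"
    by (rule card_image, rule inj_onI) (auto simp: up_def fun_eq_iff split: if_splits)
  finally have A: "card {\<rho>. adds_box \<mu> \<rho> \<and> hstrip \<nu> \<rho>} = card ?A" .
  have "part ` {\<kappa>. adds_box \<kappa> \<nu> \<and> hstrip \<kappa> \<mu>} = dn (part \<nu>) ` ?B" (is "?L = ?R")
  proof
    show "?L \<subseteq> ?R"
    proof clarify
      fix \<kappa> assume "adds_box \<kappa> \<nu>" and h: "hstrip \<kappa> \<mu>"
      then obtain i where i: "i \<ge> 1" "part \<nu> = (part \<kappa>)(i := Suc (part \<kappa> i))"
        by (auto simp: adds_box_def)
      then have "part \<kappa> = dn (part \<nu>) i" by (auto simp: dn_def)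
      moreover from this have "i \<in> ?B" using h i by (simp add: hs dn_def)
      ultimately show "part \<kappa> \<in> ?R" by blast
    qed
    show "?R \<subseteq> ?L"
    proof clarify
      fix i :: nat assume i: "1 \<le> i" "0 < part \<nu> i" "interlaces ((part \<nu>)(i := part \<nu> i - 1)) (part \<mu>)"
      obtain \<kappa> where "part \<kappa> = (part \<nu>)(i := part \<nu> i - 1)"
        using ex[of "(part \<nu>)(i := part \<nu> i - 1)" "plength \<nu> + i"] dec[OF i(3)] i(1) z
        by auto
      then show "dn (part \<nu>) i \<in> ?L"
        using i by (auto simp: adds_box_def hs dn_def intro!: image_eqI[of _ _ \<kappa>] exI[of _ i])
    qed
  qed
  then have "card {\<kappa>. adds_box \<kappa> \<nu> \<and> hstrip \<kappa> \<mu>} = card (dn (part \<nu>) ` ?B)"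
    by (metis card_image inj inj_on_subset subset_UNIV)
  also have "\<dots> = card ?B"
  proof (rule card_image, rule inj_onI)
    fix i j assume ij: "i \<in> ?B" "j \<in> ?B" "dn (part \<nu>) i = dn (part \<nu>) j"
    from fun_cong[OF ij(3), of i] ij(1,2) show "i = j" by (auto simp: dn_def split: if_splits)
  qed
  finally have B: "card {\<kappa>. adds_box \<kappa> \<nu> \<and> hstrip \<kappa> \<mu>} = card ?B" .
  have finB: "finite ?B" 
  proof (rule finite_subset[of _ "{..plength \<nu>}"])
    show "?B \<subseteq> {..plength \<nu>}" using z[of \<nu>] by (auto simp: not_less[symmetric])
  qed simp
  have AB: "hstrip \<nu> \<mu> \<Longrightarrow> ?A = insert 1 (Suc ` ?B)" "\<not> hstrip \<nu> \<mu> \<Longrightarrow> ?A = ?B"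
    unfolding hs by (rule interlaces_boxes; simp add: part_Suc_le)+
  show ?thesis
  proof (cases "hstrip \<nu> \<mu>")
    case True
    have "card ?A = Suc (card (Suc ` ?B))" unfolding AB(1)[OF True]
      by (rule card_insert_disjoint) (use finB in \<open>auto simp: image_iff\<close>)
    also have "card (Suc ` ?B) = card ?B" by (rule card_image) simp
    finally have "card ?A = Suc (card ?B)" .
    then show ?thesis unfolding A B using True by (simp only: if_True)
  next
    case False
    then show ?thesis unfolding A B AB(2)[OF False] using False by (simp only: if_False add_0_right)
  qed
qed

text \<open>
  Moving \<open>D\<close> through \<open>U\<^bsub>a (N-1)\<^esub> \<dots> U\<^bsub>a 0\<^esub>\<close> by the commutation relation leaves one term for every factor,
  with its index lowered by one, and \<open>D\<close> kills the empty partition.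
\<close>

lemma kostka_Pieri:
  "(\<Sum>\<rho> | adds_box \<mu> \<rho>. kostka N \<rho> a) = (\<Sum>i | i < N \<and> a i > 0. kostka N \<mu> (a(i := a i - 1)))"
proof (induction N arbitrary: \<mu>)
  case 0
  have "kostka 0 \<rho> a = 0" if "adds_box \<mu> \<rho>" for \<rho> using adds_box_psize[OF that] by simp
  then show ?case by simp
next
  case (Suc N)
  (* The size condition shared by the strip from \<open>\<nu>\<close> to \<open>\<mu>\<close> plus a box
     and, after the exchange, the strip from \<open>\<nu>\<close> minus a box to \<open>\<mu>\<close>. *)
  define sz where "sz \<nu> \<longleftrightarrow> psize \<nu> + a N = Suc (psize \<mu>)" for \<nu>
  have finsz: "finite {\<nu>. sz \<nu> \<and> P \<nu>}" for P
    by (rule finite_subset[OF _ finite_psize_le[of "Suc (psize \<mu>)"]]) (auto simp: sz_def)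
  have "(\<Sum>\<rho> | adds_box \<mu> \<rho>. kostka (Suc N) \<rho> a)
      = (\<Sum>\<rho> | adds_box \<mu> \<rho>. \<Sum>\<nu> | sz \<nu> \<and> hstrip \<nu> \<rho>. kostka N \<nu> a)"
    by (intro sum.cong refl) (auto simp: sz_def adds_box_psize intro!: sum.cong)
  also have "\<dots> = (\<Sum>\<nu> | sz \<nu>. \<Sum>\<rho> | adds_box \<mu> \<rho> \<and> hstrip \<nu> \<rho>. kostka N \<nu> a)"
    using sum.swap_restrict[of "{\<rho>. adds_box \<mu> \<rho>}" "{\<nu>. sz \<nu>}" "\<lambda>\<rho> \<nu>. kostka N \<nu> a" "\<lambda>\<rho> \<nu>. hstrip \<nu> \<rho>"]
      finite_adds_box[of \<mu> "\<lambda>_. True"] finsz[of "\<lambda>_. True"] by simp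
  also have "\<dots> = (\<Sum>\<nu> | sz \<nu>. card {\<rho>. adds_box \<mu> \<rho> \<and> hstrip \<nu> \<rho>} * kostka N \<nu> a)" by simp
  also have "\<dots> = (\<Sum>\<nu> | sz \<nu>. card {\<kappa>. adds_box \<kappa> \<nu> \<and> hstrip \<kappa> \<mu>} * kostka N \<nu> a)
      + (\<Sum>\<nu> | sz \<nu>. (if hstrip \<nu> \<mu> then 1 else 0) * kostka N \<nu> a)"
    by (simp add: card_hstrip_boxes sum.distrib[symmetric] algebra_simps)
  also have "(\<Sum>\<nu> | sz \<nu>. (if hstrip \<nu> \<mu> then 1 else 0) * kostka N \<nu> a)
      = (\<Sum>\<nu> | sz \<nu> \<and> hstrip \<nu> \<mu>. kostka N \<nu> a)"
    using finsz[of "\<lambda>_. True"] by (intro sum.mono_neutral_cong_right) auto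
  also have "\<dots> = (if a N > 0 then kostka (Suc N) \<mu> (a(N := a N - 1)) else 0)"
  proof (cases "a N > 0")
    case True
    then show ?thesis
      by (auto simp: sz_def intro!: sum.cong kostka_cong)
  next
    case False
    then have "{\<nu>. sz \<nu> \<and> hstrip \<nu> \<mu>} = {}" by (auto simp: sz_def dest: hstrip_psize)
    then show ?thesis using False by (simp only: sum.empty if_False)
  qed
  also have "(\<Sum>\<nu> | sz \<nu>. card {\<kappa>. adds_box \<kappa> \<nu> \<and> hstrip \<kappa> \<mu>} * kostka N \<nu> a)
      = (\<Sum>\<nu> | sz \<nu>. \<Sum>\<kappa> | hstrip \<kappa> \<mu> \<and> adds_box \<kappa> \<nu>. kostka N \<nu> a)"
    by (simp add: conj_commute)
  also have "\<dots> = (\<Sum>\<kappa> | hstrip \<kappa> \<mu>. \<Sum>\<nu> | sz \<nu> \<and> adds_box \<kappa> \<nu>. kostka N \<nu> a)"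
    using sum.swap_restrict[of "{\<nu>. sz \<nu>}" "{\<kappa>. hstrip \<kappa> \<mu>}" "\<lambda>\<nu> \<kappa>. kostka N \<nu> a" "\<lambda>\<nu> \<kappa>. adds_box \<kappa> \<nu>"]
      finite_hstrip[of \<mu> "\<lambda>_. True"] finsz[of "\<lambda>_. True"] by simp
  also have "\<dots> = (\<Sum>\<kappa> | hstrip \<kappa> \<mu> \<and> psize \<kappa> + a N = psize \<mu>. \<Sum>\<nu> | adds_box \<kappa> \<nu>. kostka N \<nu> a)"
    using finite_hstrip[of \<mu> "\<lambda>_. True"] finsz
    by (intro sum.mono_neutral_cong_right)
       (auto simp: sz_def adds_box_psize intro!: sum.cong sum.neutral)
  also have "\<dots> = (\<Sum>\<kappa> | hstrip \<kappa> \<mu> \<and> psize \<kappa> + a N = psize \<mu>.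
      \<Sum>i | i < N \<and> a i > 0. kostka N \<kappa> (a(i := a i - 1)))"
    by (simp only: Suc.IH)
  also have "\<dots> = (\<Sum>i | i < N \<and> a i > 0.
      \<Sum>\<kappa> | hstrip \<kappa> \<mu> \<and> psize \<kappa> + a N = psize \<mu>. kostka N \<kappa> (a(i := a i - 1)))"
    by (rule sum.swap)
  also have "\<dots> = (\<Sum>i | i < N \<and> a i > 0. kostka (Suc N) \<mu> (a(i := a i - 1)))"
  proof (rule sum.cong[OF refl])
    fix i assume "i \<in> {i. i < N \<and> a i > 0}"
    then have "(a(i := a i - 1)) N = a N" by simp
    then show "(\<Sum>\<kappa> | hstrip \<kappa> \<mu> \<and> psize \<kappa> + a N = psize \<mu>. kostka N \<kappa> (a(i := a i - 1)))
        = kostka (Suc N) \<mu> (a(i := a i - 1))" by (simp only: kostka.simps)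
  qed
  finally have "(\<Sum>\<rho> | adds_box \<mu> \<rho>. kostka (Suc N) \<rho> a)
     = (\<Sum>i | i < N \<and> a i > 0. kostka (Suc N) \<mu> (a(i := a i - 1)))
       + (if a N > 0 then kostka (Suc N) \<mu> (a(N := a N - 1)) else 0)" .
  also have "\<dots> = (\<Sum>i | i < Suc N \<and> a i > 0. kostka (Suc N) \<mu> (a(i := a i - 1)))"
  proof (cases "a N > 0")
    case True
    then have "{i. i < Suc N \<and> a i > 0} = insert N {i. i < N \<and> a i > 0}" by auto
    then show ?thesis using True by (simp del: kostka.simps fun_upd_apply)
  next
    case False
    then have "{i. i < Suc N \<and> a i > 0} = {i. i < N \<and> a i > 0}" by (auto simp: less_Suc_eq)
    then show ?thesis using False by (simp del: kostka.simps fun_upd_apply)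
  qed
  finally show ?case .
qed

section \<open>Semistandard tableaux as chains of horizontal strips\<close>

definition content_tableaux :: "partition \<Rightarrow> (nat \<Rightarrow> nat) \<Rightarrow> (nat \<times> nat \<Rightarrow> nat) set" where
  "content_tableaux \<mu> a =
     {T \<in> semistandard_tableaux \<mu>. \<forall>k. card {c \<in> diagram \<mu>. T c = k} = a k}"

lemma semistandard_tableaux_iff:
  "T \<in> semistandard_tableaux \<mu> \<longleftrightarrow> T \<in> extensional (diagram \<mu>) \<and>
     (\<forall>i j. 1 \<le> i \<and> 1 \<le> j \<and> Suc j \<le> part \<mu> i \<longrightarrow> T (i, j) \<le> T (i, Suc j)) \<and>
     (\<forall>i j. 1 \<le> i \<and> 1 \<le> j \<and> j \<le> part \<mu> (Suc i) \<longrightarrow> T (i, j) < T (Suc i, j))"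
proof -
  have "(i, Suc j) \<in> diagram \<mu> \<and> (i, j) \<in> diagram \<mu> \<longleftrightarrow> 1 \<le> i \<and> 1 \<le> j \<and> Suc j \<le> part \<mu> i" for i j
    by (auto simp: diagram_def)
  moreover have "(Suc i, j) \<in> diagram \<mu> \<and> (i, j) \<in> diagram \<mu> \<longleftrightarrow> 1 \<le> i \<and> 1 \<le> j \<and> j \<le> part \<mu> (Suc i)" for i j
    using part_Suc_le[of i \<mu>] by (auto simp: diagram_def)
  ultimately show ?thesis unfolding semistandard_tableaux_def PiE_def by auto
qed

lemma semistandard_ge_row:
  assumes "T \<in> semistandard_tableaux \<mu>" "1 \<le> i" "1 \<le> j" "j \<le> part \<mu> i"
  shows "i \<le> Suc (T (i, j))"
  using assms(2,4)
proof (induction i rule: dec_induct)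
  case (step i)
  have "T (i, j) < T (Suc i, j)"
    using assms(1,3) step unfolding semistandard_tableaux_iff by simp
  moreover have "j \<le> part \<mu> i" using step part_Suc_le[of i \<mu>] by simp
  ultimately show ?case using step by simp
qed simp

lemma card_nonzero: "finite S \<Longrightarrow> c \<in> S \<Longrightarrow> card S \<noteq> 0"
  by auto

text \<open>
  Grouping the cells by their entries; the weight \<open>g\<close> is used with \<open>g k = 1\<close> for the size of the shape and with
  \<open>g k = k\<close> for triangularity.
\<close>

lemma content_tableaux_sum:
  assumes "T \<in> content_tableaux \<mu> a"
  shows "finite {k. a k \<noteq> 0}" and "(\<Sum>k | a k \<noteq> 0. g k * a k) = (\<Sum>c\<in>diagram \<mu>. g (T c) :: nat)"
proof -
  have a: "a k = card {c \<in> diagram \<mu>. T c = k}" for k using assms by (simp add: content_tableaux_def)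
  have *: "{k. a k \<noteq> 0} = T ` diagram \<mu>" by (auto simp: a)
  then show "finite {k. a k \<noteq> 0}" by simp
  have "(\<Sum>c\<in>diagram \<mu>. g (T c)) = (\<Sum>k\<in>T ` diagram \<mu>. \<Sum>c\<in>{c \<in> diagram \<mu>. T c = k}. g (T c))"
    by (rule sum.image_gen) simp
  also have "\<dots> = (\<Sum>k\<in>T ` diagram \<mu>. g k * a k)" by (intro sum.cong refl) (simp add: a)
  finally show "(\<Sum>k | a k \<noteq> 0. g k * a k) = (\<Sum>c\<in>diagram \<mu>. g (T c))" using * by simp
qed

text \<open>
  The shape of the cells with entries below \<open>N\<close>. In every row they form an initial segment, so counting
  them gives the row length.
\<close>

definition sub_shape :: "partition \<Rightarrow> (nat \<times> nat \<Rightarrow> nat) \<Rightarrow> nat \<Rightarrow> partition" where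
  "sub_shape \<mu> T N = partition_of_fun (\<lambda>i. card {j \<in> {1..part \<mu> i}. T (i, j) < N})"

lemma initial_segment:
  assumes "\<And>j. 1 \<le> j \<Longrightarrow> Suc j \<le> n \<Longrightarrow> P (Suc j) \<Longrightarrow> P j"
  shows "j \<in> {1..n} \<Longrightarrow> P j \<longleftrightarrow> j \<le> card {j \<in> {1..n}. P j}"
  using assms
proof (induction n arbitrary: j)
  case (Suc n)
  have IH: "P j \<longleftrightarrow> j \<le> card {j \<in> {1..n}. P j}" if "j \<in> {1..n}" for j
    by (rule Suc.IH) (use that Suc.prems(2) in auto)
  show ?case
  proof (cases "P (Suc n)")
    case True
    have all: "P i" if "i \<in> {1..Suc n}" for i
    proof -
      have "i \<le> Suc n" "1 \<le> i" using that by auto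
      then show "P i"
      proof (induction i rule: inc_induct)
        case (step i) then show ?case using Suc.prems(2)[of i] by simp
      qed (use True in simp)
    qed
    then have "{j \<in> {1..Suc n}. P j} = {1..Suc n}" by blast
    then show ?thesis using Suc.prems(1) all by simp
  next
    case False
    then have "{j \<in> {1..Suc n}. P j} = {j \<in> {1..n}. P j}" by (auto simp: le_Suc_eq)
    moreover have "card {j \<in> {1..n}. P j} \<le> card {1..n}" by (rule card_mono) auto
    ultimately show ?thesis using False Suc.prems(1) IH[of j] by (cases "j = Suc n") auto
  qed
qed simp

lemma sub_shape:
  assumes T: "T \<in> semistandard_tableaux \<mu>" and N: "\<And>c. c \<in> diagram \<mu> \<Longrightarrow> T c \<le> N"
  shows "hstrip (sub_shape \<mu> T N) \<mu>"
    and "diagram (sub_shape \<mu> T N) = {c \<in> diagram \<mu>. T c < N}"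
proof -
  define f where "f i = card {j \<in> {1..part \<mu> i}. T (i, j) < N}" for i
  have f_le: "f i \<le> part \<mu> i" for i
    unfolding f_def by (rule order.trans[OF card_mono[of "{1..part \<mu> i}"]]) auto
  have f_iff: "T (i, j) < N \<longleftrightarrow> j \<le> f i" if "1 \<le> i" "1 \<le> j" "j \<le> part \<mu> i" for i j
    unfolding f_def
  proof (rule initial_segment)
    fix j assume "1 \<le> j" "Suc j \<le> part \<mu> i" "T (i, Suc j) < N"
    moreover from this have "T (i, j) \<le> T (i, Suc j)"
      using T \<open>1 \<le> i\<close> unfolding semistandard_tableaux_iff by blast
    ultimately show "T (i, j) < N" by simp
  qed (use that in auto)
  have f_ge: "part \<mu> (Suc i) \<le> f i" if i: "1 \<le> i" for i
  proof (cases "part \<mu> (Suc i) = 0")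
    case False
    let ?j = "part \<mu> (Suc i)"
    have "T (i, ?j) < T (Suc i, ?j)" using T i False unfolding semistandard_tableaux_iff by simp
    also have "\<dots> \<le> N" by (rule N) (use i False in \<open>auto simp: diagram_def\<close>)
    finally show ?thesis using f_iff[of i ?j] i False part_Suc_le[OF i, of \<mu>] by simp
  qed simp
  have p: "part (sub_shape \<mu> T N) i = f i" if "1 \<le> i" for i
    unfolding sub_shape_def f_def[symmetric]
  proof (rule part_partition_of_fun[where N = "plength \<mu>"])
    show "f (Suc i) \<le> f i" if "1 \<le> i" for i using f_ge[OF that] f_le[of "Suc i"] by simp
    show "f (Suc (plength \<mu>)) = 0" using f_le[of "Suc (plength \<mu>)"] part_eq_0_iff[of "Suc (plength \<mu>)" \<mu>] by simp
  qed (fact that)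
  show "hstrip (sub_shape \<mu> T N) \<mu>" using p f_le f_ge by (auto simp: hstrip_def)
  show "diagram (sub_shape \<mu> T N) = {c \<in> diagram \<mu>. T c < N}"
    using p f_le f_iff by (auto simp: diagram_def) (meson f_le le_trans)+
qed

lemma diagram_inj: "diagram \<mu> = diagram \<nu> \<Longrightarrow> \<mu> = \<nu>"
proof (rule partition_eqI)
  fix i :: nat assume "diagram \<mu> = diagram \<nu>" "1 \<le> i"
  then have "1 \<le> j \<Longrightarrow> j \<le> part \<mu> i \<longleftrightarrow> j \<le> part \<nu> i" for j
    by (auto simp: diagram_def set_eq_iff)
  from this[of "part \<mu> i"] this[of "part \<nu> i"] show "part \<mu> i = part \<nu> i"
    by (cases "part \<mu> i"; cases "part \<nu> i") auto
qed

lemma hstrip_diagram_subset: "hstrip \<nu> \<mu> \<Longrightarrow> diagram \<nu> \<subseteq> diagram \<mu>"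
  by (auto simp: diagram_def hstrip_def intro: le_trans)

lemma finite_content_tableaux [simp]: "finite (content_tableaux \<mu> a)"
proof (cases "content_tableaux \<mu> a = {}")
  case False
  then obtain T0 where T0: "T0 \<in> content_tableaux \<mu> a" by blast
  have "content_tableaux \<mu> a \<subseteq> diagram \<mu> \<rightarrow>\<^sub>E {k. a k \<noteq> 0}"
  proof
    fix T assume T: "T \<in> content_tableaux \<mu> a"
    then have "T \<in> extensional (diagram \<mu>)"
      by (simp add: content_tableaux_def semistandard_tableaux_iff)
    moreover have "a (T c) \<noteq> 0" if "c \<in> diagram \<mu>" for c
    proof -
      have "a (T c) = card {c' \<in> diagram \<mu>. T c' = T c}" using T by (simp add: content_tableaux_def)
      moreover have "c \<in> {c' \<in> diagram \<mu>. T c' = T c}" using that by simp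
      ultimately show ?thesis using card_nonzero[of "{c' \<in> diagram \<mu>. T c' = T c}" c] by simp
    qed
    ultimately show "T \<in> diagram \<mu> \<rightarrow>\<^sub>E {k. a k \<noteq> 0}" by (auto simp: PiE_def)
  qed
  then show ?thesis
    by (rule finite_subset) (intro finite_PiE finite_diagram content_tableaux_sum(1)[OF T0])
qed simp

text \<open>
  The cells with the largest entry \<open>N\<close> lie in different columns because columns increase strictly. So
  deleting them leaves a tableau of a shape \<open>\<nu>\<close> for which \<open>\<mu>\<close> minus \<open>\<nu>\<close> is a horizontal strip, and filling the
  strip with \<open>N\<close> is the inverse.
\<close>

lemma card_content_tableaux_Suc:
  assumes a: "\<And>k. k > N \<Longrightarrow> a k = 0"
  shows "card (content_tableaux \<mu> a) =
    (\<Sum>\<nu> | hstrip \<nu> \<mu> \<and> psize \<nu> + a N = psize \<mu>. card (content_tableaux \<nu> (a(N := 0))))"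
proof -
  let ?S = "{\<nu>. hstrip \<nu> \<mu> \<and> psize \<nu> + a N = psize \<mu>}"
  let ?down = "\<lambda>T. (sub_shape \<mu> T N, restrict T (diagram (sub_shape \<mu> T N)))"
  let ?up = "\<lambda>(\<nu>, T). \<lambda>c\<in>diagram \<mu>. if c \<in> diagram \<nu> then T c else N"
  have "bij_betw ?down (content_tableaux \<mu> a) (Sigma ?S (\<lambda>\<nu>. content_tableaux \<nu> (a(N := 0))))"
  proof (rule bij_betw_byWitness[where f' = ?up])
    have le: "T c \<le> N" if "T \<in> content_tableaux \<mu> a" "c \<in> diagram \<mu>" for T c
    proof (rule ccontr)
      assume "\<not> T c \<le> N"
      then have "card {c' \<in> diagram \<mu>. T c' = T c} = 0"
        using a[of "T c"] that(1) by (simp add: content_tableaux_def)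
      moreover have "c \<in> {c' \<in> diagram \<mu>. T c' = T c}" using that(2) by simp
      ultimately show False using card_nonzero[of "{c' \<in> diagram \<mu>. T c' = T c}" c] by simp
    qed
    have ss: "T \<in> semistandard_tableaux \<mu>" if "T \<in> content_tableaux \<mu> a" for T
      using that by (simp add: content_tableaux_def)
    note sub = sub_shape[OF ss le]
    show "\<forall>T\<in>content_tableaux \<mu> a. ?up (?down T) = T"
    proof
      fix T assume T: "T \<in> content_tableaux \<mu> a"
      have "T \<in> extensional (diagram \<mu>)" using ss[OF T] by (simp add: semistandard_tableaux_iff)
      moreover have "T c = N" if "c \<in> diagram \<mu>" "c \<notin> diagram (sub_shape \<mu> T N)" for c
        using le[OF T that(1)] that sub(2)[OF T T] by auto
      ultimately show "?up (?down T) = T"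
        by (auto simp: fun_eq_iff extensional_def)
    qed
    show "?down ` content_tableaux \<mu> a \<subseteq> Sigma ?S (\<lambda>\<nu>. content_tableaux \<nu> (a(N := 0)))"
    proof clarify
      fix T assume T: "T \<in> content_tableaux \<mu> a"
      let ?\<nu> = "sub_shape \<mu> T N"
      note d = sub(2)[OF T T]
      have cont: "card {c \<in> diagram \<mu>. T c = k} = a k" for k using T by (simp add: content_tableaux_def)
      have "psize \<mu> = card ({c \<in> diagram \<mu>. T c < N} \<union> {c \<in> diagram \<mu>. T c = N})"
        unfolding card_diagram[symmetric] using le[OF T] by (intro arg_cong[of _ _ card]) fastforce
      also have "\<dots> = psize ?\<nu> + a N"
        by (subst card_Un_disjoint) (auto simp: cont card_diagram[symmetric] d)
      finally have sz: "psize ?\<nu> + a N = psize \<mu>" by simp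
      have "hstrip ?\<nu> \<mu>" by (rule sub(1)[OF T T])
      moreover have "restrict T (diagram ?\<nu>) \<in> content_tableaux ?\<nu> (a(N := 0))"
        unfolding content_tableaux_def
      proof (intro CollectI conjI allI)
        have p: "part ?\<nu> i \<le> part \<mu> i" if "1 \<le> i" for i
          using \<open>hstrip ?\<nu> \<mu>\<close> that by (simp add: hstrip_def)
        have p1: "j \<le> part ?\<nu> (Suc i) \<Longrightarrow> 1 \<le> i \<Longrightarrow> j \<le> part ?\<nu> i" for i j
          using part_Suc_le[of i ?\<nu>] by simp
        show "restrict T (diagram ?\<nu>) \<in> semistandard_tableaux ?\<nu>"
          using ss[OF T] p[THEN [2] le_trans] p1 unfolding semistandard_tableaux_iff
          by (auto simp: diagram_def)
        fix k
        have "{c \<in> diagram ?\<nu>. restrict T (diagram ?\<nu>) c = k} = (if k < N then {c \<in> diagram \<mu>. T c = k} else {})"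
          using d by auto
        then show "card {c \<in> diagram ?\<nu>. restrict T (diagram ?\<nu>) c = k} = (a(N := 0)) k"
          using cont a[of k] by auto
      qed
      ultimately show "(?\<nu> \<in> ?S) \<and> restrict T (diagram ?\<nu>) \<in> content_tableaux ?\<nu> (a(N := 0))"
        using sz by blast
    qed
    have up: "?up (\<nu>, T) \<in> content_tableaux \<mu> a \<and> sub_shape \<mu> (?up (\<nu>, T)) N = \<nu>"
      if \<nu>: "hstrip \<nu> \<mu>" "psize \<nu> + a N = psize \<mu>" and T: "T \<in> content_tableaux \<nu> (a(N := 0))" for \<nu> T
    proof -
      have sub': "diagram \<nu> \<subseteq> diagram \<mu>" by (rule hstrip_diagram_subset[OF \<nu>(1)])
      have lt: "T c < N" if c: "c \<in> diagram \<nu>" for c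
      proof (rule ccontr)
        assume "\<not> T c < N"
        then have "card {c' \<in> diagram \<nu>. T c' = T c} = 0"
          using a[of "T c"] T by (cases "T c = N") (auto simp: content_tableaux_def)
        moreover have "c \<in> {c' \<in> diagram \<nu>. T c' = T c}" using c by simp
        ultimately show False using card_nonzero[of "{c' \<in> diagram \<nu>. T c' = T c}" c] by simp
      qed
      have ssT: "T \<in> semistandard_tableaux \<nu>" using T by (simp add: content_tableaux_def)
      let ?T = "?up (\<nu>, T)"
      have ssup: "?T \<in> semistandard_tableaux \<mu>" unfolding semistandard_tableaux_iff
      proof (intro conjI allI impI)
        show "?T \<in> extensional (diagram \<mu>)" by simp
      next
        fix i j assume ij: "1 \<le> i \<and> 1 \<le> j \<and> Suc j \<le> part \<mu> i"
        then have in\<mu>: "(i, j) \<in> diagram \<mu>" "(i, Suc j) \<in> diagram \<mu>" by (auto simp: diagram_def)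
        show "?T (i, j) \<le> ?T (i, Suc j)"
        proof (cases "(i, Suc j) \<in> diagram \<nu>")
          case True
          then have "(i, j) \<in> diagram \<nu>" "T (i, j) \<le> T (i, Suc j)"
            using ssT ij unfolding semistandard_tableaux_iff by (auto simp: diagram_def)
          then show ?thesis using True in\<mu> by simp
        next
          case False
          then show ?thesis using in\<mu> lt[of "(i, j)"] by auto
        qed
      next
        fix i j assume ij: "1 \<le> i \<and> 1 \<le> j \<and> j \<le> part \<mu> (Suc i)"
        then have in\<mu>: "(i, j) \<in> diagram \<mu>" "(Suc i, j) \<in> diagram \<mu>"
          using part_Suc_le[of i \<mu>] by (auto simp: diagram_def)
        have "part \<mu> (Suc i) \<le> part \<nu> i" using \<nu>(1) ij by (simp add: hstrip_def)
        then have in\<nu>: "(i, j) \<in> diagram \<nu>" using ij by (auto simp: diagram_def)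
        show "?T (i, j) < ?T (Suc i, j)"
        proof (cases "(Suc i, j) \<in> diagram \<nu>")
          case True
          then have "T (i, j) < T (Suc i, j)"
            using ssT ij unfolding semistandard_tableaux_iff by (auto simp: diagram_def)
          then show ?thesis using True in\<mu> in\<nu> by simp
        next
          case False
          then show ?thesis using in\<mu> in\<nu> lt[of "(i, j)"] by auto
        qed
      qed
      have cont: "card {c \<in> diagram \<mu>. ?T c = k} = a k" for k
      proof -
        consider "k < N" | "k = N" | "k > N" by linarith
        then show ?thesis
        proof cases
          case 1
          then have "{c \<in> diagram \<mu>. ?T c = k} = {c \<in> diagram \<nu>. T c = k}" using sub' by auto
          then show ?thesis using T 1 by (simp add: content_tableaux_def)
        next
          case 2
          then have "{c \<in> diagram \<mu>. ?T c = k} = diagram \<mu> - diagram \<nu>" using lt by fastforce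
          then show ?thesis using \<nu>(2) 2 sub'
            by (simp add: card_Diff_subset card_diagram)
        next
          case 3
          then have "{c \<in> diagram \<mu>. ?T c = k} = {}" using lt by (auto dest: less_trans)
          then show ?thesis using a[OF 3] by (simp only: card.empty)
        qed
      qed
      have mem: "?T \<in> content_tableaux \<mu> a" using ssup cont by (simp add: content_tableaux_def)
      have "diagram (sub_shape \<mu> ?T N) = {c \<in> diagram \<mu>. ?T c < N}" by (rule sub(2)[OF mem mem])
      also have "\<dots> = diagram \<nu>" using sub' lt by auto
      finally show ?thesis using mem diagram_inj by blast
    qed
    show "\<forall>p\<in>Sigma ?S (\<lambda>\<nu>. content_tableaux \<nu> (a(N := 0))). ?down (?up p) = p"
    proof
      fix p assume "p \<in> Sigma ?S (\<lambda>\<nu>. content_tableaux \<nu> (a(N := 0)))"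
      then obtain \<nu> T where p: "p = (\<nu>, T)"
        and h: "hstrip \<nu> \<mu>" "psize \<nu> + a N = psize \<mu>" "T \<in> content_tableaux \<nu> (a(N := 0))"
        by blast
      have "T \<in> extensional (diagram \<nu>)" using h(3)
        by (simp add: content_tableaux_def semistandard_tableaux_iff)
      then have "restrict (?up (\<nu>, T)) (diagram \<nu>) = T"
        using hstrip_diagram_subset[OF h(1)]
        by (intro ext) (auto simp: extensional_arb[of T] restrict_def)
      then show "?down (?up p) = p" using up[OF h] p by simp
    qed
    show "?up ` Sigma ?S (\<lambda>\<nu>. content_tableaux \<nu> (a(N := 0))) \<subseteq> content_tableaux \<mu> a"
      using up by blast
  qed
  then have "card (content_tableaux \<mu> a) = card (Sigma ?S (\<lambda>\<nu>. content_tableaux \<nu> (a(N := 0))))"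
    by (rule bij_betw_same_card)
  also have "\<dots> = (\<Sum>\<nu>\<in>?S. card (content_tableaux \<nu> (a(N := 0))))"
    by (rule card_SigmaI) auto
  finally show ?thesis .
qed

lemma content_tableaux_psize:
  assumes "T \<in> content_tableaux \<mu> a"
  shows "(\<Sum>k | a k \<noteq> 0. a k) = psize \<mu>"
  using content_tableaux_sum(2)[OF assms, of "\<lambda>_. 1"] by (simp add: card_diagram)

lemma card_content_tableaux:
  "(\<And>k. k \<ge> N \<Longrightarrow> a k = 0) \<Longrightarrow> card (content_tableaux \<mu> a) = kostka N \<mu> a"
proof (induction N arbitrary: \<mu> a)
  case 0
  then have a: "a = (\<lambda>_. 0)" by auto
  show ?case
  proof (cases "psize \<mu> = 0")
    case True
    then have "diagram \<mu> = {}" using card_diagram[of \<mu>] by simp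
    then have "content_tableaux \<mu> a = {\<lambda>_. undefined}"
      by (auto simp: content_tableaux_def semistandard_tableaux_def a)
    then show ?thesis using True by simp
  next
    case False
    then have "content_tableaux \<mu> a = {}" using content_tableaux_psize[of _ \<mu> a] by (auto simp: a)
    then show ?thesis using False by simp
  qed
next
  case (Suc N)
  have "card (content_tableaux \<nu> (a(N := 0))) = kostka N \<nu> a" for \<nu>
  proof -
    have "card (content_tableaux \<nu> (a(N := 0))) = kostka N \<nu> (a(N := 0))"
      by (rule Suc.IH) (use Suc.prems in auto)
    also have "\<dots> = kostka N \<nu> a" by (rule kostka_cong) auto
    finally show ?thesis .
  qed
  then show ?case using Suc.prems by (subst card_content_tableaux_Suc[where N = N]) auto
qed

section \<open>Schur functions are symmetric\<close>

lemma series_nth_sum: "series_nth (sum f A) m = (\<Sum>a\<in>A. series_nth (f a) m)"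
  by (induction A rule: infinite_finite_induct) (simp_all add: plus_series.rep_eq zero_series.rep_eq)

lemma lookup_map_key: "inj f \<Longrightarrow> lookup (map_key f p) i = lookup p (f i)"
  by (simp add: map_key.rep_eq)

lemma series_nth_schur: "series_nth (schur \<mu>) m = of_nat (card (content_tableaux \<mu> (lookup m)))"
  by (simp add: schur.rep_eq content_tableaux_def)

lemma series_nth_schur_kostka:
  "keys m \<subseteq> {..<N} \<Longrightarrow> series_nth (schur \<mu>) m = of_nat (kostka N \<mu> (lookup m))"
  unfolding series_nth_schur
  by (subst card_content_tableaux[where N = N]) (auto simp: in_keys_iff subset_iff)

lemma ex_keys_bound: "\<exists>N::nat. keys (m :: monomial) \<subseteq> {..<N}"
  using finite_nat_bounded[of "keys m"] by simp

lemma schur_homogeneous: "series_nth (schur \<mu>) m \<noteq> 0 \<Longrightarrow> mdeg m = psize \<mu>"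
proof -
  assume "series_nth (schur \<mu>) m \<noteq> 0"
  then have "content_tableaux \<mu> (lookup m) \<noteq> {}" by (auto simp: series_nth_schur)
  then obtain T where "T \<in> content_tableaux \<mu> (lookup m)" by blast
  from content_tableaux_psize[OF this] show ?thesis
    by (simp add: mdeg_def keys.rep_eq)
qed

definition swapped :: "nat \<Rightarrow> monomial \<Rightarrow> monomial" where
  "swapped k m = map_key (transpose k (Suc k)) m"

lemma lookup_swapped: "lookup (swapped k m) = (lookup m)(k := lookup m (Suc k), Suc k := lookup m k)"
  by (auto simp: swapped_def lookup_map_key fun_eq_iff transpose_def)

lemma keys_swapped:
  assumes "keys m \<subseteq> {..<N}" "N \<le> M" "Suc k < M"
  shows "keys (swapped k m) \<subseteq> {..<M}"
proof
  fix i assume "i \<in> keys (swapped k m)"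
  then have "i = k \<or> i = Suc k \<or> i \<in> keys m"
    by (auto simp: in_keys_iff lookup_swapped split: if_splits)
  then show "i \<in> {..<M}" using assms by auto
qed

lemma schur_swapped: "series_nth (schur \<mu>) (swapped k m) = series_nth (schur \<mu>) m"
proof -
  obtain N where N: "keys m \<subseteq> {..<N}" using ex_keys_bound by blast
  define M where "M = N + k + 2"
  have "keys m \<subseteq> {..<M}" using N by (auto simp: M_def)
  moreover have "keys (swapped k m) \<subseteq> {..<M}" by (rule keys_swapped[OF N]) (auto simp: M_def)
  ultimately show ?thesis
    using kostka_swap[of k M \<mu> "lookup m"]
    by (simp add: series_nth_schur_kostka[where N = M] lookup_swapped M_def del: fun_upd_apply kostka.simps)
qed

text \<open>
  Exchanging two neighbouring exponents that are in increasing order lowers this number, which makes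
  sorting by neighbouring exchanges terminate.
\<close>

definition weight :: "monomial \<Rightarrow> nat" where
  "weight m = (\<Sum>i\<in>keys m. i * lookup m i)"

lemma weight_eq: "keys m \<subseteq> {..<N} \<Longrightarrow> weight m = (\<Sum>i<N. i * lookup m i)"
  unfolding weight_def by (rule sum.mono_neutral_left) (auto simp: in_keys_iff)

lemma weight_swapped:
  assumes "lookup m k < lookup m (Suc k)"
  shows "weight (swapped k m) < weight m"
proof -
  obtain N where N: "keys m \<subseteq> {..<N}" using ex_keys_bound by blast
  define M where "M = N + k + 2"
  have M1: "keys m \<subseteq> {..<M}" using N by (auto simp: M_def)
  have M2: "keys (swapped k m) \<subseteq> {..<M}" by (rule keys_swapped[OF N]) (auto simp: M_def)
  have split: "(\<Sum>i<M. i * g i) = k * g k + (Suc k * g (Suc k) + (\<Sum>i\<in>{..<M} - {k} - {Suc k}. i * g i))" for g :: "nat \<Rightarrow> nat"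
  proof -
    have "(\<Sum>i<M. i * g i) = k * g k + (\<Sum>i\<in>{..<M} - {k}. i * g i)"
      by (rule sum.remove) (auto simp: M_def)
    also have "(\<Sum>i\<in>{..<M} - {k}. i * g i) = Suc k * g (Suc k) + (\<Sum>i\<in>{..<M} - {k} - {Suc k}. i * g i)"
      by (rule sum.remove) (auto simp: M_def)
    finally show ?thesis .
  qed
  have rest: "(\<Sum>i\<in>{..<M} - {k} - {Suc k}. i * lookup (swapped k m) i) = (\<Sum>i\<in>{..<M} - {k} - {Suc k}. i * lookup m i)"
    by (rule sum.cong) (auto simp: lookup_swapped)
  show ?thesis
    unfolding weight_eq[OF M1] weight_eq[OF M2] split rest
    using assms by (simp add: lookup_swapped)
qed

definition decreasing :: "monomial \<Rightarrow> bool" where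
  "decreasing m \<longleftrightarrow> (\<forall>i. lookup m (Suc i) \<le> lookup m i)"

lemma sorting_induct [case_names decreasing swap]:
  assumes "\<And>m. decreasing m \<Longrightarrow> P m" and "\<And>m k. P (swapped k m) \<Longrightarrow> P m"
  shows "P m"
proof (induction m rule: measure_induct_rule[of weight])
  case (less m)
  show ?case
  proof (cases "decreasing m")
    case False
    then obtain k where "lookup m k < lookup m (Suc k)" by (auto simp: decreasing_def not_le)
    then show ?thesis using less weight_swapped assms(2) by blast
  qed (use assms(1) in blast)
qed

text \<open>
  A decreasing sequence is determined by the numbers \<open>|{j. t \<le> m\<^sub>j}|\<close>, since each of these sets is an
  initial segment, and a bijection of the indices preserves the numbers.
\<close>

lemma decreasing_unique:
  assumes "decreasing m" "decreasing (map_key \<tau> m)" and \<tau>: "bij \<tau>"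
  shows "map_key \<tau> m = m"
proof (rule poly_mapping_eqI, rule ccontr)
  have dec: "lookup n j \<le> lookup n i" if "decreasing n" "i \<le> j" for n i j
    using that(2) by (rule lift_Suc_antimono_le[of "lookup n", rotated]) (use that(1) in \<open>simp add: decreasing_def\<close>)
  (* If \<open>n\<^sub>i < m\<^sub>i = t\<close>, then at least \<open>i + 1\<close> exponents of \<open>m\<close> but at most \<open>i\<close> of \<open>n\<close> reach \<open>t\<close>. *)
  have key: False if m: "decreasing m" "decreasing n" and b: "bij_betw \<rho> {j. lookup m i \<le> lookup n j} {j. lookup m i \<le> lookup m j}"
    and lt: "lookup n i < lookup m i" for m n :: monomial and i \<rho>
  proof -
    have sub: "{j. lookup m i \<le> lookup n j} \<subseteq> {..<i}"
    proof
      fix j assume "j \<in> {j. lookup m i \<le> lookup n j}"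
      then show "j \<in> {..<i}" using dec[OF m(2), of i j] lt by (cases "i \<le> j") auto
    qed
    have "finite {j. lookup m i \<le> lookup m j}"
      using finite_subset[OF sub] bij_betw_finite[OF b] by simp
    moreover have "{..i} \<subseteq> {j. lookup m i \<le> lookup m j}" using dec[OF m(1), of _ i] by auto
    ultimately have "card {..i} \<le> card {j. lookup m i \<le> lookup m j}" by (rule card_mono)
    then have "Suc i \<le> card {j. lookup m i \<le> lookup m j}" by simp
    also have "\<dots> = card {j. lookup m i \<le> lookup n j}" by (rule bij_betw_same_card[OF b, symmetric])
    also have "\<dots> \<le> i" using card_mono[OF _ sub] by simp
    finally show False by simp
  qed
  fix i assume ne: "lookup (map_key \<tau> m) i \<noteq> lookup m i"
  have inj: "inj \<tau>" using \<tau> by (simp add: bij_is_inj)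
  have surj: "\<exists>k. \<tau> k = j" for j using bij_is_surj[OF \<tau>] unfolding surj_def by metis
  have b1: "bij_betw \<tau> {j. t \<le> lookup (map_key \<tau> m) j} {j. t \<le> lookup m j}" for t
    unfolding bij_betw_def
  proof
    show "inj_on \<tau> {j. t \<le> lookup (map_key \<tau> m) j}" using inj by (rule inj_on_subset) simp
    show "\<tau> ` {j. t \<le> lookup (map_key \<tau> m) j} = {j. t \<le> lookup m j}" (is "?L = ?R")
    proof
      show "?L \<subseteq> ?R" by (auto simp: lookup_map_key[OF inj])
      show "?R \<subseteq> ?L"
      proof
        fix j assume j: "j \<in> ?R"
        obtain k where "\<tau> k = j" using surj by blast
        with j show "j \<in> ?L" by (auto simp: lookup_map_key[OF inj])
      qed
    qed
  qed
  show False
  proof (cases "lookup (map_key \<tau> m) i < lookup m i")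
    case True
    then show False by (rule key[OF assms(1,2) b1])
  next
    case False
    then have "lookup m i < lookup (map_key \<tau> m) i" using ne by simp
    then show False by (rule key[OF assms(2,1) bij_betw_inv_into[OF b1]])
  qed
qed

text \<open>
  Permuting the exponents by an arbitrary bijection of the infinitely many indices is not a finite product of
  neighbouring exchanges. But a monomial and its image under a bijection can both be sorted, and the results
  coincide.
\<close>

lemma symmetric_seriesI:
  assumes "\<And>k m. series_nth f (swapped k m) = series_nth f m"
  shows "symmetric_series f"
proof -
  have sorted: "\<exists>\<sigma>. bij \<sigma> \<and> decreasing (map_key \<sigma> m) \<and> series_nth f (map_key \<sigma> m) = series_nth f m" for m
  proof (induction m rule: sorting_induct)
    case (decreasing m)
    then show ?case using map_key_id[of m] by (intro exI[of _ "\<lambda>x. x"]) (auto simp: bij_betw_def)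
  next
    case (swap m k)
    then obtain \<sigma> where \<sigma>: "bij \<sigma>" "decreasing (map_key \<sigma> (swapped k m))"
      "series_nth f (map_key \<sigma> (swapped k m)) = series_nth f (swapped k m)" by blast
    have "map_key \<sigma> (swapped k m) = map_key (transpose k (Suc k) \<circ> \<sigma>) m"
      unfolding swapped_def by (rule map_key_compose) (simp_all add: \<sigma>(1) bij_is_inj)
    moreover have "bij (transpose k (Suc k) \<circ> \<sigma>)" using \<sigma>(1) by (simp add: bij_comp)
    moreover have "series_nth f (swapped k m) = series_nth f m" by (rule assms)
    ultimately show ?case using \<sigma>(2,3) by metis
  qed
  show ?thesis unfolding symmetric_series_def
  proof (intro allI impI)
    fix \<pi> :: "nat \<Rightarrow> nat" and m assume \<pi>: "bij \<pi>"
    obtain \<sigma> where \<sigma>: "bij \<sigma>" "decreasing (map_key \<sigma> m)" "series_nth f (map_key \<sigma> m) = series_nth f m"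
      using sorted by blast
    obtain \<tau> where \<tau>: "bij \<tau>" "decreasing (map_key \<tau> (map_key \<pi> m))"
      "series_nth f (map_key \<tau> (map_key \<pi> m)) = series_nth f (map_key \<pi> m)" using sorted by blast
    have inv: "bij (inv_into UNIV \<sigma>)" by (rule bij_imp_bij_inv[OF \<sigma>(1)])
    have inj: "inj \<pi>" "inj \<sigma>" "inj \<tau>" "inj (inv_into UNIV \<sigma>)"
      using \<pi> \<sigma>(1) \<tau>(1) inv by (simp_all add: bij_is_inj)
    define \<rho> where "\<rho> = inv_into UNIV \<sigma> \<circ> (\<pi> \<circ> \<tau>)"
    have "map_key \<rho> (map_key \<sigma> m) = map_key \<tau> (map_key \<pi> m)"
    proof -
      have "map_key \<rho> (map_key \<sigma> m) = map_key (\<sigma> \<circ> \<rho>) m"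
        unfolding \<rho>_def by (rule map_key_compose) (simp_all add: inj inj_compose)
      also have "\<sigma> \<circ> \<rho> = \<pi> \<circ> \<tau>" unfolding \<rho>_def using \<sigma>(1)
        by (simp add: fun_eq_iff bij_is_surj surj_f_inv_f)
      also have "map_key (\<pi> \<circ> \<tau>) m = map_key \<tau> (map_key \<pi> m)"
        by (rule map_key_compose[symmetric]) (use inj in auto)
      finally show ?thesis .
    qed
    moreover have "bij \<rho>" unfolding \<rho>_def by (intro bij_comp inv \<pi> \<tau>(1))
    ultimately have "map_key \<tau> (map_key \<pi> m) = map_key \<sigma> m"
      using decreasing_unique[of "map_key \<sigma> m" \<rho>] \<sigma> \<tau> by simp
    then show "series_nth f (map_key \<pi> m) = series_nth f m" using \<sigma> \<tau> by simp
  qed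
qed

lemma symmetric_schur: "symmetric_series (schur \<mu>)"
  by (rule symmetric_seriesI) (rule schur_swapped)

lemma symmetric_series_swapped: "symmetric_series f \<Longrightarrow> series_nth f (swapped k m) = series_nth f m"
  by (simp add: symmetric_series_def swapped_def)

section \<open>Schur functions form a basis\<close>

definition partition_monomial :: "partition \<Rightarrow> monomial" where
  "partition_monomial \<mu> = Abs_poly_mapping (\<lambda>i. part \<mu> (Suc i))"

lemma lookup_partition_monomial: "lookup (partition_monomial \<mu>) i = part \<mu> (Suc i)"
proof -
  have "finite {i. part \<mu> (Suc i) \<noteq> 0}"
    by (rule finite_subset[of _ "{..plength \<mu>}"]) (auto simp: part_eq_0_iff)
  then show ?thesis by (simp add: partition_monomial_def)
qed

lemma decreasing_imp_partition_monomial: "decreasing m \<Longrightarrow> \<exists>\<mu>. m = partition_monomial \<mu>"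
proof -
  assume d: "decreasing m"
  obtain N where N: "keys m \<subseteq> {..<N}" using ex_keys_bound by blast
  have "\<exists>\<mu>. \<forall>i\<ge>1. part \<mu> i = lookup m (i - 1)"
  proof (rule partition_exists)
    show "lookup m (Suc i - 1) \<le> lookup m (i - 1)" if "1 \<le> i" for i
      using d that by (cases i) (auto simp: decreasing_def)
    show "lookup m (Suc N - 1) = 0" using N by (auto simp: in_keys_iff subset_iff)
  qed
  then obtain \<mu> where "\<forall>i\<ge>1. part \<mu> i = lookup m (i - 1)" by blast
  then have "m = partition_monomial \<mu>" by (intro poly_mapping_eqI) (simp add: lookup_partition_monomial)
  then show ?thesis by blast
qed

lemma partition_monomial_inj: "partition_monomial \<mu> = partition_monomial \<nu> \<Longrightarrow> \<mu> = \<nu>"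
proof (rule partition_eqI)
  fix i :: nat assume "partition_monomial \<mu> = partition_monomial \<nu>" "1 \<le> i"
  then have "lookup (partition_monomial \<mu>) (i - 1) = lookup (partition_monomial \<nu>) (i - 1)" by simp
  then show "part \<mu> i = part \<nu> i" using \<open>1 \<le> i\<close> by (simp add: lookup_partition_monomial)
qed

lemma symmetric_series_eqI:
  assumes "symmetric_series f" "symmetric_series g"
    and "\<And>\<mu>. series_nth f (partition_monomial \<mu>) = series_nth g (partition_monomial \<mu>)"
  shows "f = g"
proof (rule series_eqI)
  fix m show "series_nth f m = series_nth g m"
  proof (induction m rule: sorting_induct)
    case (decreasing m)
    then show ?case using assms(3) decreasing_imp_partition_monomial by blast
  next
    case (swap m k)
    then show ?case by (simp add: symmetric_series_swapped assms(1,2))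
  qed
qed

definition row_tableau :: "partition \<Rightarrow> nat \<times> nat \<Rightarrow> nat" where
  "row_tableau \<mu> = (\<lambda>c\<in>diagram \<mu>. fst c - 1)"

text \<open>
  The statistic \<open>\<Sum> (i - 1) \<mu>\<^sub>i\<close>, the least possible sum of the entries of a semistandard tableau of
  shape \<open>\<mu>\<close>, because the entries of row \<open>i\<close> are at least \<open>i - 1\<close>. Entries start at \<open>0\<close>, rows at \<open>1\<close>.
\<close>

definition row_weight :: "partition \<Rightarrow> nat" where
  "row_weight \<mu> = (\<Sum>c\<in>diagram \<mu>. fst c - 1)"

lemma row_tableau: "row_tableau \<mu> \<in> content_tableaux \<mu> (lookup (partition_monomial \<mu>))"
  unfolding content_tableaux_def
proof (intro CollectI conjI allI)
  show "row_tableau \<mu> \<in> semistandard_tableaux \<mu>"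
    by (auto simp: semistandard_tableaux_def row_tableau_def diagram_def)
  fix k
  have "{c \<in> diagram \<mu>. row_tableau \<mu> c = k} = {Suc k} \<times> {1..part \<mu> (Suc k)}"
    by (auto simp: row_tableau_def diagram_def)
  then show "card {c \<in> diagram \<mu>. row_tableau \<mu> c = k} = lookup (partition_monomial \<mu>) k"
    by (simp add: lookup_partition_monomial card_cartesian_product)
qed

text \<open>
  A tableau of shape \<open>\<mu>\<close> and content \<open>\<nu>\<close> has entry sum \<open>row_weight \<nu>\<close>, as the row tableau of \<open>\<nu>\<close> has the
  same content. This is at least \<open>row_weight \<mu>\<close>, with equality only for the row tableau of \<open>\<mu>\<close>, whose
  content is \<open>\<mu>\<close>.
\<close>

lemma schur_coeff_triangular:
  assumes "series_nth (schur \<mu>) (partition_monomial \<nu>) \<noteq> 0"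
  shows "\<mu> = \<nu> \<or> row_weight \<mu> < row_weight \<nu>"
proof -
  from assms have "content_tableaux \<mu> (lookup (partition_monomial \<nu>)) \<noteq> {}" by (auto simp: series_nth_schur)
  then obtain T where T: "T \<in> content_tableaux \<mu> (lookup (partition_monomial \<nu>))" by blast
  then have ss: "T \<in> semistandard_tableaux \<mu>" by (simp add: content_tableaux_def)
  have ge: "fst c - 1 \<le> T c" if "c \<in> diagram \<mu>" for c
    using semistandard_ge_row[OF ss, of "fst c" "snd c"] that by (auto simp: diagram_def)
  have "row_weight \<nu> = (\<Sum>c\<in>diagram \<nu>. row_tableau \<nu> c)"
    by (simp add: row_weight_def row_tableau_def)
  also have "\<dots> = (\<Sum>c\<in>diagram \<mu>. T c)"
    using content_tableaux_sum(2)[OF row_tableau[of \<nu>], of "\<lambda>k. k"] content_tableaux_sum(2)[OF T, of "\<lambda>k. k"] by simp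
  finally have w: "row_weight \<nu> = (\<Sum>c\<in>diagram \<mu>. T c)" .
  show ?thesis
  proof (cases "\<forall>c\<in>diagram \<mu>. T c = fst c - 1")
    case True
    then have "row_tableau \<mu> = T" using ss
      by (auto simp: row_tableau_def semistandard_tableaux_iff extensional_def fun_eq_iff)
    then have "lookup (partition_monomial \<mu>) k = lookup (partition_monomial \<nu>) k" for k
      using row_tableau[of \<mu>] T by (simp add: content_tableaux_def)
    then show ?thesis using partition_monomial_inj poly_mapping_eqI by blast
  next
    case False
    then obtain c0 where c0: "c0 \<in> diagram \<mu>" "T c0 \<noteq> fst c0 - 1" by blast
    then have "fst c0 - 1 < T c0" using ge[of c0] by simp
    then have "row_weight \<mu> < row_weight \<nu>"
      unfolding w row_weight_def[of \<mu>]
      by (intro sum_strict_mono_ex1 finite_diagram ballI ge bexI[of _ c0] c0(1))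
    then show ?thesis ..
  qed
qed

lemma schur_coeff_self: "series_nth (schur \<mu>) (partition_monomial \<mu>) \<noteq> 0"
  using row_tableau[of \<mu>] by (auto simp: series_nth_schur)

text \<open>
  Used twice: for the expansion in Schur functions, and for the interpolation of shifted symmetric
  functions at small partitions.
\<close>

lemma triangular_solvable:
  fixes K :: "'a \<Rightarrow> 'a \<Rightarrow> 'b :: field" and rk :: "'a \<Rightarrow> nat"
  assumes fin: "finite A" and diag: "\<And>a. a \<in> A \<Longrightarrow> K a a \<noteq> 0"
    and tri: "\<And>a b. a \<in> A \<Longrightarrow> b \<in> A \<Longrightarrow> K a b \<noteq> 0 \<Longrightarrow> a = b \<or> rk a < rk b"
  shows "\<exists>c. \<forall>b\<in>A. (\<Sum>a\<in>A. c a * K a b) = v b"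
proof -
  have "\<exists>c. \<forall>b\<in>A. rk b < n \<longrightarrow> (\<Sum>a\<in>A. c a * K a b) = v b" for n
  proof (induction n)
    case (Suc n)
    then obtain c where c: "\<And>b. b \<in> A \<Longrightarrow> rk b < n \<Longrightarrow> (\<Sum>a\<in>A. c a * K a b) = v b" by blast
    define d where "d a = (if rk a = n then (v a - (\<Sum>b\<in>A - {a}. c b * K b a)) / K a a else c a)" for a
    have "(\<Sum>a\<in>A. d a * K a b) = v b" if b: "b \<in> A" "rk b < Suc n" for b
    proof (cases "rk b = n")
      case False
      have "(\<Sum>a\<in>A. d a * K a b) = (\<Sum>a\<in>A. c a * K a b)"
      proof (rule sum.cong[OF refl])
        fix a assume "a \<in> A"
        then show "d a * K a b = c a * K a b"
          using tri[of a b] b False by (cases "K a b = 0") (auto simp: d_def)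
      qed
      then show ?thesis using c b False by simp
    next
      case True
      have "(\<Sum>a\<in>A. d a * K a b) = d b * K b b + (\<Sum>a\<in>A - {b}. d a * K a b)"
        by (rule sum.remove) (use fin b in auto)
      also have "(\<Sum>a\<in>A - {b}. d a * K a b) = (\<Sum>a\<in>A - {b}. c a * K a b)"
      proof (rule sum.cong[OF refl])
        fix a assume "a \<in> A - {b}"
        then show "d a * K a b = c a * K a b"
          using tri[of a b] b True by (cases "K a b = 0") (auto simp: d_def)
      qed
      also have "d b * K b b = v b - (\<Sum>a\<in>A - {b}. c a * K a b)"
        using diag[OF b(1)] True by (simp add: d_def)
      finally show ?thesis by simp
    qed
    then show ?case by blast
  qed simp
  from this[of "Suc (Max (rk ` A))"] obtain c where
    c: "\<forall>b\<in>A. rk b < Suc (Max (rk ` A)) \<longrightarrow> (\<Sum>a\<in>A. c a * K a b) = v b" by blast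
  have "rk b < Suc (Max (rk ` A))" if "b \<in> A" for b using fin that by (simp add: less_Suc_eq_le)
  then show ?thesis using c by blast
qed

lemma triangular_unique:
  fixes K :: "'a \<Rightarrow> 'a \<Rightarrow> 'b :: field" and rk :: "'a \<Rightarrow> nat"
  assumes fin: "finite A" and diag: "\<And>a. a \<in> A \<Longrightarrow> K a a \<noteq> 0"
    and tri: "\<And>a b. a \<in> A \<Longrightarrow> b \<in> A \<Longrightarrow> K a b \<noteq> 0 \<Longrightarrow> a = b \<or> rk a < rk b"
    and zero: "\<And>b. b \<in> A \<Longrightarrow> (\<Sum>a\<in>A. c a * K a b) = 0"
  shows "b \<in> A \<Longrightarrow> c b = 0"
proof (induction b rule: measure_induct_rule[of rk])
  case (less b)
  have "0 = (\<Sum>a\<in>A. c a * K a b)" using zero[OF less.prems] by simp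
  also have "\<dots> = c b * K b b + (\<Sum>a\<in>A - {b}. c a * K a b)"
    by (rule sum.remove) (use fin less.prems in auto)
  also have "(\<Sum>a\<in>A - {b}. c a * K a b) = 0"
  proof (intro sum.neutral ballI)
    fix a assume a: "a \<in> A - {b}"
    show "c a * K a b = 0"
    proof (cases "K a b = 0")
      case False
      then have "rk a < rk b" using tri[of a b] a less.prems by blast
      then show ?thesis using less.IH a by simp
    qed simp
  qed
  finally show ?case using diag[OF less.prems] by simp
qed

lemma schur_coords_eq_0:
  assumes "(\<Sum>\<mu>\<in>partitions_of n. scale (c \<mu>) (schur \<mu>)) = 0" and "\<mu> \<in> partitions_of n"
  shows "c \<mu> = 0"
proof (rule triangular_unique[where K = "\<lambda>\<mu> \<nu>. series_nth (schur \<mu>) (partition_monomial \<nu>)" and rk = row_weight, OF _ _ _ _ assms(2)])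
  fix \<nu>
  have "(\<Sum>\<mu>\<in>partitions_of n. c \<mu> * series_nth (schur \<mu>) (partition_monomial \<nu>))
      = series_nth (\<Sum>\<mu>\<in>partitions_of n. scale (c \<mu>) (schur \<mu>)) (partition_monomial \<nu>)"
    by (simp add: series_nth_sum scale.rep_eq)
  then show "(\<Sum>\<mu>\<in>partitions_of n. c \<mu> * series_nth (schur \<mu>) (partition_monomial \<nu>)) = 0"
    by (simp add: assms(1) zero_series.rep_eq)
qed (auto simp: schur_coeff_self dest: schur_coeff_triangular)

lemma inj_on_schur: "inj_on schur (partitions_of n)"
proof (rule inj_onI)
  fix \<mu> \<nu> assume *: "\<mu> \<in> partitions_of n" "\<nu> \<in> partitions_of n" "schur \<mu> = schur \<nu>"
  show "\<mu> = \<nu>"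
    using schur_coeff_triangular[of \<mu> \<nu>] schur_coeff_triangular[of \<nu> \<mu>] schur_coeff_self[of \<mu>] schur_coeff_self[of \<nu>] *(3)
    by auto
qed

lemma independent_schur: "series.independent (schur ` partitions_of n)"
proof -
  have "u (schur \<mu>) = 0" if "(\<Sum>v\<in>schur ` partitions_of n. scale (u v) v) = 0" "\<mu> \<in> partitions_of n" for u \<mu>
    using schur_coords_eq_0[of "\<lambda>\<mu>. u (schur \<mu>)" n \<mu>] that
    by (simp add: sum.reindex[OF inj_on_schur] o_def)
  then show ?thesis by (subst series.dependent_finite) auto
qed

text \<open>
  The representation function of the set of Schur functions is indexed by the series themselves, so the
  coefficients have to be transported along the injection \<open>schur\<close>.
\<close>

lemma schur_coord_sum:
  assumes \<mu>: "\<mu> \<in> partitions_of n"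
  shows "schur_coord n (\<Sum>\<nu>\<in>partitions_of n. scale (c \<nu>) (schur \<nu>)) \<mu> = c \<mu>"
proof -
  define f where "f b = (if b \<in> schur ` partitions_of n then c (inv_into (partitions_of n) schur b) else 0)" for b
  have f: "f (schur \<nu>) = c \<nu>" if "\<nu> \<in> partitions_of n" for \<nu>
    using that inv_into_f_f[OF inj_on_schur that] by (auto simp: f_def)
  have "series.representation (schur ` partitions_of n) (\<Sum>\<nu>\<in>partitions_of n. scale (c \<nu>) (schur \<nu>)) = f"
  proof (rule series.representation_eqI[OF independent_schur])
    show "(\<Sum>\<nu>\<in>partitions_of n. scale (c \<nu>) (schur \<nu>)) \<in> series.span (schur ` partitions_of n)"
      by (intro series.span_sum series.span_scale series.span_base) auto
    show "b \<in> schur ` partitions_of n" if "f b \<noteq> 0" for b using that by (auto simp: f_def split: if_splits)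
    show "finite {b. f b \<noteq> 0}"
      by (rule finite_subset[of _ "schur ` partitions_of n"]) (auto simp: f_def split: if_splits)
    have "(\<Sum>b | f b \<noteq> 0. scale (f b) b) = (\<Sum>b\<in>schur ` partitions_of n. scale (f b) b)"
      by (rule sum.mono_neutral_left) (auto simp: f_def split: if_splits)
    also have "\<dots> = (\<Sum>\<nu>\<in>partitions_of n. scale (c \<nu>) (schur \<nu>))"
      by (simp add: sum.reindex[OF inj_on_schur] f)
    finally show "(\<Sum>b | f b \<noteq> 0. scale (f b) b) = (\<Sum>\<nu>\<in>partitions_of n. scale (c \<nu>) (schur \<nu>))" .
  qed
  then show ?thesis by (simp add: schur_coord_def f[OF \<mu>])
qed

lemma symmetric_series_sum_scale:
  "(\<And>a. a \<in> A \<Longrightarrow> symmetric_series (f a)) \<Longrightarrow> symmetric_series (\<Sum>a\<in>A. scale (c a) (f a))"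
  by (simp add: symmetric_series_def series_nth_sum scale.rep_eq)

text \<open>
  A symmetric series is determined by its coefficients at the monomials \<open>x\<^sup>\<nu>\<close> for partitions \<open>\<nu>\<close>, and the
  triangular system for these coefficients has a solution.
\<close>

lemma schur_expansion:
  assumes "symmetric_series f" and "\<And>m. series_nth f m \<noteq> 0 \<Longrightarrow> mdeg m = n"
  shows "\<exists>c. f = (\<Sum>\<mu>\<in>partitions_of n. scale (c \<mu>) (schur \<mu>))"
proof -
  obtain c where c: "\<And>\<nu>. \<nu> \<in> partitions_of n \<Longrightarrow>
      (\<Sum>\<mu>\<in>partitions_of n. c \<mu> * series_nth (schur \<mu>) (partition_monomial \<nu>)) = series_nth f (partition_monomial \<nu>)"
    using triangular_solvable[of "partitions_of n" "\<lambda>\<mu> \<nu>. series_nth (schur \<mu>) (partition_monomial \<nu>)" row_weight "\<lambda>\<nu>. series_nth f (partition_monomial \<nu>)",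
        OF finite_partitions_of schur_coeff_self schur_coeff_triangular] by blast
  have "f = (\<Sum>\<mu>\<in>partitions_of n. scale (c \<mu>) (schur \<mu>))"
  proof (rule symmetric_series_eqI[OF assms(1) symmetric_series_sum_scale])
    fix \<nu>
    have deg: "mdeg (partition_monomial \<nu>) = psize \<nu>" using schur_homogeneous[OF schur_coeff_self] .
    show "series_nth f (partition_monomial \<nu>) = series_nth (\<Sum>\<mu>\<in>partitions_of n. scale (c \<mu>) (schur \<mu>)) (partition_monomial \<nu>)"
    proof (cases "psize \<nu> = n")
      case True
      then show ?thesis using c[of \<nu>] by (simp add: partitions_of_def series_nth_sum scale.rep_eq)
    next
      case False
      then have "series_nth f (partition_monomial \<nu>) = 0" using assms(2)[of "partition_monomial \<nu>"] deg by auto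
      moreover have "series_nth (schur \<mu>) (partition_monomial \<nu>) = 0" if "\<mu> \<in> partitions_of n" for \<mu>
        using schur_homogeneous[of \<mu> "partition_monomial \<nu>"] deg that False by (auto simp: partitions_of_def)
      ultimately show ?thesis by (simp add: series_nth_sum scale.rep_eq)
    qed
  qed (rule symmetric_schur)
  then show ?thesis by blast
qed

section \<open>Multiplication by \<open>p\<^sub>1\<close>\<close>

lemma series_nth_p1_mult:
  "series_nth (p1 * f) m = (\<Sum>i\<in>keys m. series_nth f (m - Poly_Mapping.single i 1))"
proof -
  let ?s = "\<lambda>i::nat. Poly_Mapping.single i (1::nat)"
  have inj: "inj ?s"
  proof (rule injI)
    fix i j assume "?s i = ?s j"
    then have "lookup (?s i) i = lookup (?s j) i" by simp
    then show "i = j" by (simp add: lookup_single when_def split: if_splits)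
  qed
  have split: "?s i + (m - ?s i) = m" if "i \<in> keys m" for i
    using that by (intro poly_mapping_eqI) (auto simp: lookup_add lookup_minus lookup_single when_def in_keys_iff)
  have "series_nth (p1 * f) m = (\<Sum>(a, b)\<in>splits m. series_nth p1 a * series_nth f b)"
    by (simp add: times_series.rep_eq)
  also have "\<dots> = (\<Sum>(a, b)\<in>(\<lambda>i. (?s i, m - ?s i)) ` keys m. series_nth p1 a * series_nth f b)"
  proof (rule sum.mono_neutral_right[OF finite_splits])
    show "(\<lambda>i. (?s i, m - ?s i)) ` keys m \<subseteq> splits m" using split by (auto simp: splits_def)
    show "\<forall>p\<in>splits m - (\<lambda>i. (?s i, m - ?s i)) ` keys m. (case p of (a, b) \<Rightarrow> series_nth p1 a * series_nth f b) = 0"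
    proof clarify
      fix a b assume ab: "(a, b) \<in> splits m" "(a, b) \<notin> (\<lambda>i. (?s i, m - ?s i)) ` keys m"
      have "\<nexists>i. a = ?s i"
      proof
        assume "\<exists>i. a = ?s i"
        then obtain i where i: "a = ?s i" by blast
        have m: "m = ?s i + b" using ab(1) i by (simp add: splits_def)
        then have "i \<in> keys m" by (simp add: in_keys_iff lookup_add)
        moreover have "b = m - ?s i" using m by simp
        ultimately show False using ab(2) i by blast
      qed
      then show "series_nth p1 a * series_nth f b = 0" by (simp add: p1.rep_eq)
    qed
  qed
  also have "\<dots> = (\<Sum>i\<in>keys m. series_nth p1 (?s i) * series_nth f (m - ?s i))"
    by (subst sum.reindex) (use inj in \<open>auto simp: inj_def intro!: inj_onI\<close>)
  also have "\<dots> = (\<Sum>i\<in>keys m. series_nth f (m - ?s i))"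
    by (intro sum.cong refl) (auto simp: p1.rep_eq)
  finally show ?thesis .
qed

lemma Pieri: "p1 * schur \<mu> = (\<Sum>\<rho> | adds_box \<mu> \<rho>. schur \<rho>)"
proof (rule series_eqI)
  fix m :: monomial
  obtain N where N: "keys m \<subseteq> {..<N}" using ex_keys_bound by blast
  have look: "lookup (m - Poly_Mapping.single i 1) = (lookup m)(i := lookup m i - 1)" for i
    by (auto simp: lookup_minus lookup_single when_def fun_eq_iff)
  have keys: "keys (m - Poly_Mapping.single i 1) \<subseteq> {..<N}" for i
    using N by (auto simp: in_keys_iff lookup_minus subset_iff)
  have "series_nth (p1 * schur \<mu>) m = (\<Sum>i\<in>keys m. of_nat (kostka N \<mu> ((lookup m)(i := lookup m i - 1))))"
    unfolding series_nth_p1_mult series_nth_schur_kostka[OF keys] look ..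
  also have "keys m = {i. i < N \<and> lookup m i > 0}" using N by (auto simp: in_keys_iff)
  also have "(\<Sum>i\<in>\<dots>. of_nat (kostka N \<mu> ((lookup m)(i := lookup m i - 1))) :: complex)
      = of_nat (\<Sum>i | i < N \<and> lookup m i > 0. kostka N \<mu> ((lookup m)(i := lookup m i - 1)))"
    by (simp only: of_nat_sum)
  also have "\<dots> = of_nat (\<Sum>\<rho> | adds_box \<mu> \<rho>. kostka N \<rho> (lookup m))" by (simp only: kostka_Pieri)
  also have "\<dots> = series_nth (\<Sum>\<rho> | adds_box \<mu> \<rho>. schur \<rho>) m"
    by (simp add: series_nth_sum series_nth_schur_kostka[OF N])
  finally show "series_nth (p1 * schur \<mu>) m = series_nth (\<Sum>\<rho> | adds_box \<mu> \<rho>. schur \<rho>) m" .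
qed

section \<open>Evaluation of polynomials\<close>

definition mval :: "(nat \<Rightarrow> complex) \<Rightarrow> monomial \<Rightarrow> complex" where
  "mval x m = (\<Prod>i\<in>keys m. x i ^ lookup m i)"

lemma mval_superset: "finite A \<Longrightarrow> keys m \<subseteq> A \<Longrightarrow> mval x m = (\<Prod>i\<in>A. x i ^ lookup m i)"
  unfolding mval_def by (rule prod.mono_neutral_left) (auto simp: in_keys_iff)

lemma mval_0 [simp]: "mval x 0 = 1"
  by (simp add: mval_def)

lemma mval_add: "mval x (m + n) = mval x m * mval x n"
proof -
  have "keys (m + n) \<subseteq> keys m \<union> keys n" by (rule Poly_Mapping.keys_add)
  then show ?thesis
    by (simp add: mval_superset[where A = "keys m \<union> keys n"] lookup_add power_add prod.distrib)
qed

lemma mdeg_superset: "finite A \<Longrightarrow> keys m \<subseteq> A \<Longrightarrow> mdeg m = (\<Sum>i\<in>A. lookup m i)"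
  unfolding mdeg_def by (rule sum.mono_neutral_left) (auto simp: in_keys_iff)

lemma mdeg_add: "mdeg (m + n) = mdeg m + mdeg n"
proof -
  have "keys (m + n) \<subseteq> keys m \<union> keys n" by (rule Poly_Mapping.keys_add)
  then show ?thesis
    by (simp add: mdeg_superset[where A = "keys m \<union> keys n"] lookup_add sum.distrib)
qed

lemma mpoly_eval_superset:
  "finite S \<Longrightarrow> keys p \<subseteq> S \<Longrightarrow> mpoly_eval x p = (\<Sum>m\<in>S. lookup p m * mval x m)"
  unfolding mpoly_eval_def mval_def by (rule sum.mono_neutral_left) (auto simp: in_keys_iff)

lemma mpoly_eval_0 [simp]: "mpoly_eval x 0 = 0"
  by (simp add: mpoly_eval_def)

lemma mpoly_eval_single [simp]: "mpoly_eval x (Poly_Mapping.single m c) = c * mval x m"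
  by (subst mpoly_eval_superset[of "{m}"]) (auto simp: in_keys_iff lookup_single when_def split: if_splits)

lemma mpoly_eval_add [simp]: "mpoly_eval x (p + q) = mpoly_eval x p + mpoly_eval x q"
proof -
  have "keys (p + q) \<subseteq> keys p \<union> keys q" by (rule Poly_Mapping.keys_add)
  then show ?thesis
    by (simp add: mpoly_eval_superset[where S = "keys p \<union> keys q"] lookup_add distrib_right sum.distrib)
qed

lemma mpoly_eval_sum [simp]: "mpoly_eval x (sum f A) = (\<Sum>a\<in>A. mpoly_eval x (f a))"
  by (induction A rule: infinite_finite_induct) auto

lemma mpoly_sum_single: "(\<Sum>m\<in>keys p. Poly_Mapping.single m (lookup p m)) = p"
  by (rule poly_mapping_eqI)
     (auto simp: lookup_sum lookup_single when_def in_keys_iff sum.delta' if_distrib cong: if_cong)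

lemma mpoly_eval_mult [simp]: "mpoly_eval x (p * q) = mpoly_eval x p * mpoly_eval x q"
proof -
  have "p * q = (\<Sum>m\<in>keys p. Poly_Mapping.single m (lookup p m)) * (\<Sum>n\<in>keys q. Poly_Mapping.single n (lookup q n))"
    by (simp add: mpoly_sum_single)
  also have "mpoly_eval x \<dots> = (\<Sum>m\<in>keys p. \<Sum>n\<in>keys q. (lookup p m * mval x m) * (lookup q n * mval x n))"
    by (simp add: sum_product mult_single mval_add algebra_simps)
  also have "\<dots> = mpoly_eval x p * mpoly_eval x q"
    by (simp add: mpoly_eval_superset[OF _ order.refl] sum_product)
  finally show ?thesis .
qed

lemma mpoly_eval_1 [simp]: "mpoly_eval x 1 = 1"
  using mpoly_eval_single[of x 0 1] by (simp add: single_one)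

lemma mpoly_eval_power [simp]: "mpoly_eval x (p ^ n) = mpoly_eval x p ^ n"
  by (induction n) auto

lemma mpoly_eval_prod [simp]: "mpoly_eval x (prod f A) = (\<Prod>a\<in>A. mpoly_eval x (f a))"
  by (induction A rule: infinite_finite_induct) auto

lemma mpoly_eval_uminus [simp]: "mpoly_eval x (- p) = - mpoly_eval x p"
  using mpoly_eval_add[of x p "- p"] by (simp add: eq_neg_iff_add_eq_0 add.commute)

lemma mpoly_eval_diff [simp]: "mpoly_eval x (p - q) = mpoly_eval x p - mpoly_eval x q"
  using mpoly_eval_add[of x p "- q"] by simp

lemma mpoly_eval_of_nat [simp]: "mpoly_eval x (of_nat n) = of_nat n"
  by (induction n) auto

lemma mval_single [simp]: "mval x (Poly_Mapping.single i (Suc 0)) = x i"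
  by (simp add: mval_def)

lemma mpoly_eval_var [simp]: "mpoly_eval x (mpoly_var i) = x i"
  by (simp add: mpoly_var_def)

lemma mpoly_eval_subst [simp]: "mpoly_eval x (mpoly_subst y p) = mpoly_eval (\<lambda>i. mpoly_eval x (y i)) p"
  by (simp add: mpoly_subst_def) (simp add: mpoly_eval_def)

lemma mpoly_eval_cong:
  "(\<And>i. i \<in> variables p \<Longrightarrow> x i = y i) \<Longrightarrow> mpoly_eval x p = mpoly_eval y p"
proof -
  assume *: "\<And>i. i \<in> variables p \<Longrightarrow> x i = y i"
  have "x i = y i" if "m \<in> keys p" "i \<in> keys m" for m i
    by (rule *) (use that in \<open>auto simp: variables_def\<close>)
  then show ?thesis unfolding mpoly_eval_def by (intro sum.cong prod.cong arg_cong2[of _ _ _ _ "(*)"]) auto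
qed

section \<open>Polynomials are determined by strictly decreasing arguments\<close>

definition omit :: "nat \<Rightarrow> monomial \<Rightarrow> monomial" where
  "omit k m = m - Poly_Mapping.single k (lookup m k)"

lemma lookup_omit: "lookup (omit k m) i = (if i = k then 0 else lookup m i)"
  by (simp add: omit_def lookup_minus lookup_single when_def)

lemma omit_inj: "omit k m = omit k n \<Longrightarrow> lookup m k = lookup n k \<Longrightarrow> m = n"
proof (rule poly_mapping_eqI)
  fix i assume *: "omit k m = omit k n" "lookup m k = lookup n k"
  have "lookup (omit k m) i = lookup (omit k n) i" using * by simp
  then show "lookup m i = lookup n i" using *(2) by (cases "i = k") (auto simp: lookup_omit)
qed

lemma mval_omit: "mval x m = x k ^ lookup m k * mval x (omit k m)"
proof -
  have sub: "keys (omit k m) \<subseteq> insert k (keys m)" by (auto simp: in_keys_iff lookup_omit split: if_splits)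
  have "mval x (omit k m) = (\<Prod>i\<in>insert k (keys m) - {k}. x i ^ lookup m i)"
  proof -
    have "mval x (omit k m) = (\<Prod>i\<in>insert k (keys m). x i ^ lookup (omit k m) i)"
      by (rule mval_superset[OF _ sub]) simp
    also have "\<dots> = x k ^ lookup (omit k m) k * (\<Prod>i\<in>insert k (keys m) - {k}. x i ^ lookup (omit k m) i)"
      by (rule prod.remove) auto
    also have "(\<Prod>i\<in>insert k (keys m) - {k}. x i ^ lookup (omit k m) i) = (\<Prod>i\<in>insert k (keys m) - {k}. x i ^ lookup m i)"
      by (rule prod.cong) (auto simp: lookup_omit)
    finally show ?thesis by (simp add: lookup_omit)
  qed
  moreover have "mval x m = (\<Prod>i\<in>insert k (keys m). x i ^ lookup m i)"
    by (rule mval_superset) auto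
  moreover have "\<dots> = x k ^ lookup m k * (\<Prod>i\<in>insert k (keys m) - {k}. x i ^ lookup m i)"
    by (rule prod.remove) auto
  ultimately show ?thesis by simp
qed

text \<open>
  The coefficient of \<open>x\<^sub>k\<^sup>e\<close> in \<open>p\<close>, as a polynomial in the other variables.
\<close>

definition coefficient_in :: "nat \<Rightarrow> mpoly \<Rightarrow> nat \<Rightarrow> mpoly" where
  "coefficient_in k p e = (\<Sum>m | m \<in> keys p \<and> lookup m k = e. Poly_Mapping.single (omit k m) (lookup p m))"

lemma lookup_coefficient_in:
  assumes "m \<in> keys p"
  shows "lookup (coefficient_in k p (lookup m k)) (omit k m) = lookup p m"
proof -
  have "lookup (coefficient_in k p (lookup m k)) (omit k m)
      = (\<Sum>n | n \<in> keys p \<and> lookup n k = lookup m k. if n = m then lookup p m else 0)"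
    unfolding coefficient_in_def lookup_sum
    by (rule sum.cong[OF refl]) (auto simp: lookup_single when_def dest: omit_inj)
  then show ?thesis using assms by simp
qed

lemma mpoly_eval_coefficients:
  assumes "\<And>m. m \<in> keys p \<Longrightarrow> lookup m k \<le> D"
  shows "mpoly_eval x p = (\<Sum>e\<le>D. mpoly_eval x (coefficient_in k p e) * x k ^ e)"
proof -
  have "mpoly_eval x p = (\<Sum>m\<in>keys p. lookup p m * mval x m)"
    by (rule mpoly_eval_superset) auto
  also have "\<dots> = (\<Sum>e\<le>D. \<Sum>m | m \<in> keys p \<and> lookup m k = e. lookup p m * mval x m)"
    by (rule sum.group[symmetric]) (use assms in auto)
  also have "\<dots> = (\<Sum>e\<le>D. mpoly_eval x (coefficient_in k p e) * x k ^ e)"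
  proof (rule sum.cong[OF refl])
    fix e
    show "(\<Sum>m | m \<in> keys p \<and> lookup m k = e. lookup p m * mval x m) = mpoly_eval x (coefficient_in k p e) * x k ^ e"
      unfolding coefficient_in_def mpoly_eval_sum sum_distrib_right
    proof (rule sum.cong[OF refl])
      fix m assume "m \<in> {m \<in> keys p. lookup m k = e}"
      then show "lookup p m * mval x m = mpoly_eval x (Poly_Mapping.single (omit k m) (lookup p m)) * x k ^ e"
        using mval_omit[of x m k] by simp
    qed
  qed
  finally show ?thesis .
qed

lemma keys_sum_subset: "keys (sum f A) \<subseteq> (\<Union>a\<in>A. keys (f a :: 'a \<Rightarrow>\<^sub>0 'b::comm_monoid_add))"
proof (induction A rule: infinite_finite_induct)
  case (insert a A)
  then show ?case using Poly_Mapping.keys_add[of "f a" "sum f A"] by auto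
qed auto

lemma variables_coefficient_in: "variables (coefficient_in k p e) \<subseteq> variables p - {k}"
proof -
  have "keys (coefficient_in k p e) \<subseteq> omit k ` keys p"
    unfolding coefficient_in_def
    by (rule order.trans[OF keys_sum_subset]) (auto split: if_splits)
  moreover have "keys (omit k m) \<subseteq> keys m - {k}" for m by (auto simp: in_keys_iff lookup_omit split: if_splits)
  ultimately show ?thesis unfolding variables_def by blast
qed

text \<open>
  When \<open>x\<^bsub>k+1\<^esub> > \<dots> > x\<^sub>N\<close> are fixed, infinitely many values of \<open>x\<^sub>k\<close> remain, so each
  coefficient with respect to \<open>x\<^sub>k\<close> vanishes at all strictly decreasing \<open>(x\<^bsub>k+1\<^esub>, \<dots>, x\<^sub>N)\<close>. Strictly
  decreasing arguments suffice for two purposes: they are distinct, so a division by the Vandermonde determinant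
  is possible there, and as weakly decreasing arguments they are partitions.
\<close>

lemma mpoly_eq_0_if_vanishes_on_decreasing:
  assumes "variables p \<subseteq> {k..N}"
    and "\<And>a :: nat \<Rightarrow> nat. (\<And>i. k \<le> i \<Longrightarrow> i < N \<Longrightarrow> a (Suc i) < a i) \<Longrightarrow> mpoly_eval (\<lambda>i. of_nat (a i)) p = 0"
  shows "p = 0"
  using assms
proof (induction "Suc N - k" arbitrary: k p)
  case 0
  then have "variables p = {}" by auto
  then have "keys p \<subseteq> {0}" by (auto simp: variables_def)
  then have p: "mpoly_eval x p = lookup p 0" for x by (subst mpoly_eval_superset[of "{0}"]) auto
  have "mpoly_eval (\<lambda>i. of_nat (N - i)) p = 0" by (rule 0(3)) (use 0(1) in auto)
  then show ?case using p \<open>keys p \<subseteq> {0}\<close> by (intro poly_mapping_eqI) (auto simp: in_keys_iff)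
next
  case (Suc n)
  define D where "D = (\<Sum>m\<in>keys p. lookup m k)"
  have D: "lookup m k \<le> D" if "m \<in> keys p" for m
    unfolding D_def by (rule member_le_sum) (use that in auto)
  have "coefficient_in k p e = 0" if e: "e \<le> D" for e
  proof (rule Suc.hyps(1)[of "Suc k"])
    show "n = Suc N - Suc k" using Suc.hyps(2) by simp
    show "variables (coefficient_in k p e) \<subseteq> {Suc k..N}"
    proof
      fix i assume "i \<in> variables (coefficient_in k p e)"
      then have "i \<noteq> k" "i \<in> {k..N}" using variables_coefficient_in[of k p e] Suc.prems(1) by auto
      then show "i \<in> {Suc k..N}" by simp
    qed
    fix a :: "nat \<Rightarrow> nat" assume a: "\<And>i. Suc k \<le> i \<Longrightarrow> i < N \<Longrightarrow> a (Suc i) < a i"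
    define x where "x i = (of_nat (a i) :: complex)" for i
    define P where "P = (\<Sum>e\<le>D. monom (mpoly_eval x (coefficient_in k p e)) e)"
    have "poly P (of_nat t) = 0" if t: "a (Suc k) < t" for t
    proof -
      define a' where "a' = a(k := t)"
      have "mpoly_eval (\<lambda>i. of_nat (a' i)) p = 0"
        by (rule Suc.prems(2)) (use a t in \<open>auto simp: a'_def\<close>)
      moreover have "mpoly_eval (\<lambda>i. of_nat (a' i)) (coefficient_in k p e) = mpoly_eval x (coefficient_in k p e)" for e
        by (rule mpoly_eval_cong) (use variables_coefficient_in[of k p e] in \<open>auto simp: x_def a'_def\<close>)
      ultimately show ?thesis
        by (simp add: mpoly_eval_coefficients[OF D] P_def poly_sum poly_monom a'_def)
    qed
    then have "of_nat ` {a (Suc k)<..} \<subseteq> {z. poly P z = 0}" by auto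
    moreover have "infinite (of_nat ` {a (Suc k)<..} :: complex set)"
      by (subst finite_image_iff) (simp_all add: inj_on_def infinite_Ioi)
    ultimately have "infinite {z. poly P z = 0}" by (rule infinite_super)
    then have "P = 0" using poly_roots_finite[of P] by blast
    then have "coeff P e = 0" by simp
    then show "mpoly_eval (\<lambda>i. of_nat (a i)) (coefficient_in k p e) = 0"
      using e by (simp add: P_def coeff_sum x_def[abs_def])
  qed
  then have "lookup p m = 0" if "m \<in> keys p" for m
    using lookup_coefficient_in[OF that, of k] D[OF that] by simp
  then have "lookup p m = lookup 0 m" for m by (cases "m \<in> keys p") (auto simp: in_keys_iff)
  then show ?case by (rule poly_mapping_eqI)
qed

corollary mpoly_eqI:
  assumes "\<And>x. mpoly_eval x p = mpoly_eval x q"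
  shows "p = q"
proof -
  have "finite (variables (p - q))" by (simp add: variables_def)
  then obtain N where "variables (p - q) \<subseteq> {0..N}"
    by (meson atLeastAtMost_iff finite_nat_set_iff_bounded_le subsetI zero_le)
  then have "p - q = 0" by (rule mpoly_eq_0_if_vanishes_on_decreasing) (simp add: assms)
  then show ?thesis by simp
qed

section \<open>Polynomial functions with degree bounds\<close>

text \<open>
  The degree bound is an integer, so that a negative bound expresses that the function is zero. This makes
  bounds like \<open>m - k\<close> valid for all entries of a triangular matrix.
\<close>

definition polyfun :: "nat set \<Rightarrow> int \<Rightarrow> ((nat \<Rightarrow> complex) \<Rightarrow> complex) \<Rightarrow> bool" where
  "polyfun A d F \<longleftrightarrow> (\<exists>p. variables p \<subseteq> A \<and> (\<forall>m\<in>keys p. int (mdeg m) \<le> d) \<and> (\<forall>x. mpoly_eval x p = F x))"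

lemma polyfun_mono: "polyfun A d F \<Longrightarrow> A \<subseteq> B \<Longrightarrow> d \<le> e \<Longrightarrow> polyfun B e F"
  unfolding polyfun_def by (meson order.trans subset_trans)

lemma polyfun_const: "0 \<le> d \<Longrightarrow> polyfun A d (\<lambda>_. c)"
  unfolding polyfun_def
  by (intro exI[of _ "Poly_Mapping.single 0 c"]) (auto simp: variables_def mdeg_def split: if_splits)

lemma polyfun_0: "polyfun A d (\<lambda>_. 0)"
  unfolding polyfun_def by (intro exI[of _ 0]) (auto simp: variables_def)

lemma polyfun_var: "i \<in> A \<Longrightarrow> 1 \<le> d \<Longrightarrow> polyfun A d (\<lambda>x. x i)"
  unfolding polyfun_def
  by (intro exI[of _ "mpoly_var i"]) (auto simp: variables_def mdeg_def mpoly_var_def)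

lemma polyfun_add: "polyfun A d F \<Longrightarrow> polyfun A d G \<Longrightarrow> polyfun A d (\<lambda>x. F x + G x)"
  unfolding polyfun_def
proof (elim exE conjE)
  fix p q assume *: "variables p \<subseteq> A" "\<forall>m\<in>keys p. int (mdeg m) \<le> d" "\<forall>x. mpoly_eval x p = F x"
    "variables q \<subseteq> A" "\<forall>m\<in>keys q. int (mdeg m) \<le> d" "\<forall>x. mpoly_eval x q = G x"
  then show "\<exists>p. variables p \<subseteq> A \<and> (\<forall>m\<in>keys p. int (mdeg m) \<le> d) \<and> (\<forall>x. mpoly_eval x p = F x + G x)"
  proof (intro exI[of _ "p + q"] conjI ballI allI)
    have k: "keys (p + q) \<subseteq> keys p \<union> keys q" by (rule Poly_Mapping.keys_add)
    then have "variables (p + q) \<subseteq> variables p \<union> variables q" unfolding variables_def by blast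
    then show "variables (p + q) \<subseteq> A" using * by blast
    show "int (mdeg m) \<le> d" if "m \<in> keys (p + q)" for m using that k * by blast
  qed (use * in simp)
qed

lemma polyfun_mult: "polyfun A d F \<Longrightarrow> polyfun A e G \<Longrightarrow> polyfun A (d + e) (\<lambda>x. F x * G x)"
  unfolding polyfun_def
proof (elim exE conjE)
  fix p q assume *: "variables p \<subseteq> A" "\<forall>m\<in>keys p. int (mdeg m) \<le> d" "\<forall>x. mpoly_eval x p = F x"
    "variables q \<subseteq> A" "\<forall>m\<in>keys q. int (mdeg m) \<le> e" "\<forall>x. mpoly_eval x q = G x"
  have k: "\<exists>a\<in>keys p. \<exists>b\<in>keys q. m = a + b" if "m \<in> keys (p * q)" for m
    using keys_mult[of p q] that by blast
  have "variables (p * q) \<subseteq> A"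
  proof
    fix i assume "i \<in> variables (p * q)"
    then obtain m where "m \<in> keys (p * q)" "i \<in> keys m" by (auto simp: variables_def)
    then obtain a b where ab: "a \<in> keys p" "b \<in> keys q" "m = a + b" using k by blast
    then have "i \<in> keys a \<union> keys b" using \<open>i \<in> keys m\<close> Poly_Mapping.keys_add[of a b] by blast
    then show "i \<in> A" using * ab by (auto simp: variables_def)
  qed
  moreover have "int (mdeg m) \<le> d + e" if "m \<in> keys (p * q)" for m
    using k[OF that] * by (fastforce simp: mdeg_add)
  ultimately show "\<exists>p. variables p \<subseteq> A \<and> (\<forall>m\<in>keys p. int (mdeg m) \<le> d + e) \<and> (\<forall>x. mpoly_eval x p = F x * G x)"
    using * by (intro exI[of _ "p * q"]) auto
qed

lemma polyfun_cmult: "polyfun A d F \<Longrightarrow> polyfun A d (\<lambda>x. c * F x)"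
  using polyfun_mult[OF polyfun_const[of 0 A c]] by simp

lemma polyfun_diff: "polyfun A d F \<Longrightarrow> polyfun A d G \<Longrightarrow> polyfun A d (\<lambda>x. F x - G x)"
  using polyfun_add[of A d F "\<lambda>x. - 1 * G x"] polyfun_cmult[of A d G "- 1"] by simp

lemma polyfun_sum: "(\<And>a. a \<in> S \<Longrightarrow> polyfun A d (F a)) \<Longrightarrow> polyfun A d (\<lambda>x. \<Sum>a\<in>S. F a x)"
  by (induction S rule: infinite_finite_induct) (auto intro: polyfun_add polyfun_0)

lemma polyfun_prod:
  "(\<And>a. a \<in> S \<Longrightarrow> polyfun A (d a) (F a)) \<Longrightarrow> polyfun A (\<Sum>a\<in>S. d a) (\<lambda>x. \<Prod>a\<in>S. F a x)"
  by (induction S rule: infinite_finite_induct) (auto intro: polyfun_mult polyfun_const)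

lemma polyfun_power: "polyfun A d F \<Longrightarrow> polyfun A (int n * d) (\<lambda>x. F x ^ n)"
  using polyfun_prod[of "{..<n}" A "\<lambda>_. d" "\<lambda>_. F"] by simp

lemma polyfun_compose:
  assumes F: "polyfun A d F" and G: "\<And>i. i \<in> A \<Longrightarrow> polyfun B 1 (G i)"
  shows "polyfun B d (\<lambda>x. F (\<lambda>i. G i x))"
proof -
  obtain p where p: "variables p \<subseteq> A" "\<forall>m\<in>keys p. int (mdeg m) \<le> d" "\<And>x. mpoly_eval x p = F x"
    using F unfolding polyfun_def by blast
  have "polyfun B d (\<lambda>x. \<Sum>m\<in>keys p. lookup p m * (\<Prod>i\<in>keys m. G i x ^ lookup m i))"
  proof (intro polyfun_sum polyfun_cmult)
    fix m assume m: "m \<in> keys p"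
    have "polyfun B (\<Sum>i\<in>keys m. int (lookup m i) * 1) (\<lambda>x. \<Prod>i\<in>keys m. G i x ^ lookup m i)"
      by (intro polyfun_prod polyfun_power G) (use p(1) m in \<open>auto simp: variables_def\<close>)
    then show "polyfun B d (\<lambda>x. \<Prod>i\<in>keys m. G i x ^ lookup m i)"
      by (rule polyfun_mono) (use p(2) m in \<open>auto simp: mdeg_def\<close>)
  qed
  then show ?thesis by (simp add: p(3)[symmetric] mpoly_eval_def)
qed

lemma polyfun_eq_0:
  assumes F: "polyfun {1..N} d F"
    and "\<And>a :: nat \<Rightarrow> nat. (\<And>i. 1 \<le> i \<Longrightarrow> i < N \<Longrightarrow> a (Suc i) < a i) \<Longrightarrow> F (\<lambda>i. of_nat (a i)) = 0"
  shows "F x = 0"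
proof -
  obtain p where p: "variables p \<subseteq> {1..N}" "\<And>x. mpoly_eval x p = F x"
    using F unfolding polyfun_def by blast
  have "p = 0" by (rule mpoly_eq_0_if_vanishes_on_decreasing[OF p(1)]) (simp add: p(2) assms(2))
  then show ?thesis using p(2)[of x] by simp
qed

lemma polyfun_cong: "polyfun A d F \<Longrightarrow> (\<And>i. i \<in> A \<Longrightarrow> x i = y i) \<Longrightarrow> F x = F y"
  unfolding polyfun_def using mpoly_eval_cong[of _ x y] by (metis subset_iff)

section \<open>Symmetric polynomials as symmetric functions\<close>

lemma map_key_inv:
  assumes "bij \<pi>"
  shows "map_key \<pi> (map_key (inv_into UNIV \<pi>) m) = m" "map_key (inv_into UNIV \<pi>) (map_key \<pi> m) = m"
  using assms
  by (auto intro!: poly_mapping_eqI simp: lookup_map_key bij_is_inj bij_imp_bij_inv bij_is_surj surj_f_inv_f)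

lemma mval_map_key: "bij \<pi> \<Longrightarrow> mval (x \<circ> \<pi>) (map_key \<pi> m) = mval x m"
  unfolding mval_def
  by (rule prod.reindex_bij_witness[of _ "inv_into UNIV \<pi>" \<pi>])
     (auto simp: keys_map_key lookup_map_key bij_is_inj bij_is_surj surj_f_inv_f)

lemma mpoly_eval_permute:
  assumes \<pi>: "bij \<pi>"
  shows "mpoly_eval (x \<circ> \<pi>) p = mpoly_eval x (map_key (map_key \<pi>) p)"
proof -
  have inj: "inj (map_key \<pi> :: monomial \<Rightarrow> monomial)"
    by (rule inj_on_inverseI[of _ "map_key (inv_into UNIV \<pi>)"]) (rule map_key_inv(2)[OF \<pi>])
  have "mpoly_eval x (map_key (map_key \<pi>) p) = (\<Sum>m\<in>keys (map_key (map_key \<pi>) p). lookup p (map_key \<pi> m) * mval x m)"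
    by (simp add: mpoly_eval_superset[OF _ order.refl] lookup_map_key[OF inj])
  also have "\<dots> = (\<Sum>m\<in>keys p. lookup p m * mval (x \<circ> \<pi>) m)"
    by (rule sum.reindex_bij_witness[of _ "map_key (inv_into UNIV \<pi>)" "map_key \<pi>"])
       (auto simp: keys_map_key[OF inj] map_key_inv[OF \<pi>] mval_map_key[OF \<pi>])
  finally show ?thesis by (simp add: mpoly_eval_superset[OF _ order.refl])
qed

lemma symmetric_poly_iff:
  "symmetric_poly N q \<longleftrightarrow> variables q \<subseteq> {1..N} \<and>
     (\<forall>\<pi> x. \<pi> permutes {1..N} \<longrightarrow> mpoly_eval (x \<circ> \<pi>) q = mpoly_eval x q)"
proof -
  have "(\<forall>m. lookup q (map_key \<pi> m) = lookup q m) \<longleftrightarrow> (\<forall>x. mpoly_eval (x \<circ> \<pi>) q = mpoly_eval x q)"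
    if "\<pi> permutes {1..N}" for \<pi>
  proof -
    have \<pi>: "bij \<pi>" using that by (rule permutes_bij)
    have inj: "inj (map_key \<pi> :: monomial \<Rightarrow> monomial)"
      by (rule inj_on_inverseI[of _ "map_key (inv_into UNIV \<pi>)"]) (rule map_key_inv(2)[OF \<pi>])
    have "(\<forall>m. lookup q (map_key \<pi> m) = lookup q m) \<longleftrightarrow> map_key (map_key \<pi>) q = q"
      by (auto simp: poly_mapping_eq_iff fun_eq_iff lookup_map_key[OF inj])
    also have "\<dots> \<longleftrightarrow> (\<forall>x. mpoly_eval (x \<circ> \<pi>) q = mpoly_eval x q)"
      unfolding mpoly_eval_permute[OF \<pi>] using mpoly_eqI by auto
    finally show ?thesis .
  qed
  then show ?thesis unfolding symmetric_poly_def by blast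
qed

section \<open>Factorial Schur polynomials\<close>

definition falling :: "nat \<Rightarrow> complex poly" where
  "falling m = (\<Prod>t<m. [:- of_nat t, 1:])"

text \<open>
  The strictly increasing sequence of the parts of \<open>\<mu>\<close>, padded to \<open>N\<close> parts, plus a staircase. Rows and
  columns of the determinants below are ordered increasingly, which makes the Newton matrix of the empty
  partition unitriangular without a sign.
\<close>

definition beta :: "nat \<Rightarrow> partition \<Rightarrow> nat \<Rightarrow> nat" where
  "beta N \<mu> j = part \<mu> (N - j) + j"

definition falling_det :: "nat \<Rightarrow> partition \<Rightarrow> (nat \<Rightarrow> complex) \<Rightarrow> complex" where
  "falling_det N \<mu> y = det (mat N N (\<lambda>(i, j). poly (falling (beta N \<mu> j)) (y i)))"

text \<open>
  Repeated division with remainder by \<open>z - y\<^sub>0, z - y\<^sub>1, \<dots>\<close>. The remainder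
  \<open>poly (newton f y k) (y k)\<close> is the divided difference \<open>f[y\<^sub>0, \<dots>, y\<^sub>k]\<close>, a polynomial in the
  nodes.
\<close>

primrec newton :: "complex poly \<Rightarrow> (nat \<Rightarrow> complex) \<Rightarrow> nat \<Rightarrow> complex poly" where
  "newton f y 0 = f"
| "newton f y (Suc k) = synthetic_div (newton f y k) (y k)"

text \<open>
  The determinant of divided differences, a polynomial version of the quotient of \<open>falling_det\<close> by the
  Vandermonde determinant; \<open>factorial_schur_quotient\<close> states the relation.
\<close>

definition factorial_schur :: "nat \<Rightarrow> partition \<Rightarrow> (nat \<Rightarrow> complex) \<Rightarrow> complex" where
  "factorial_schur N \<mu> y = det (mat N N (\<lambda>(k, j). poly (newton (falling (beta N \<mu> j)) y k) (y k)))"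

definition vandermonde :: "nat \<Rightarrow> (nat \<Rightarrow> complex) \<Rightarrow> complex" where
  "vandermonde N y = (\<Prod>i<N. \<Prod>t<i. y i - y t)"

lemma poly_falling: "poly (falling m) z = (\<Prod>t<m. z - of_nat t)"
  by (simp add: falling_def poly_prod)

lemma poly_synthetic_div: "poly p (z :: complex) = poly p c + (z - c) * poly (synthetic_div p c) z"
proof -
  have "poly ([:- c, 1:] * synthetic_div p c + [:poly p c:]) z = poly p z"
    by (simp only: synthetic_div_correct')
  then show ?thesis by (simp add: algebra_simps)
qed

lemma newton_expansion:
  "poly f z = (\<Sum>k<n. (\<Prod>t<k. z - y t) * poly (newton f y k) (y k)) + (\<Prod>t<n. z - y t) * poly (newton f y n) z"
proof (induction n)
  case (Suc n)
  show ?case using Suc poly_synthetic_div[of "newton f y n" z "y n"] by (simp add: algebra_simps)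
qed simp

lemma newton_interpolation:
  assumes "i < N"
  shows "poly f (y i) = (\<Sum>k<N. (\<Prod>t<k. y i - y t) * poly (newton f y k) (y k))"
proof -
  have "(\<Prod>t<N. y i - y t) = 0" using assms by (intro prod_zero) auto
  then show ?thesis using newton_expansion[of f "y i" y N] by simp
qed

text \<open>
  Newton's interpolation formula expresses the matrix \<open>[f\<^sub>j(y\<^sub>i)]\<close> as the product of the lower triangular
  matrix \<open>[\<Prod>t<k. y\<^sub>i - y\<^sub>t]\<close> and the matrix of divided differences.
\<close>

lemma falling_det_factorization: "falling_det N \<mu> y = vandermonde N y * factorial_schur N \<mu> y"
proof -
  define L where "L = mat N N (\<lambda>(i, k). \<Prod>t<k. y i - y t)"
  define U where "U = mat N N (\<lambda>(k, j). poly (newton (falling (beta N \<mu> j)) y k) (y k))"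
  have L: "L \<in> carrier_mat N N" and U: "U \<in> carrier_mat N N" by (simp_all add: L_def U_def)
  have "mat N N (\<lambda>(i, j). poly (falling (beta N \<mu> j)) (y i)) = L * U"
    by (rule eq_matI)
       (auto simp: L_def U_def scalar_prod_def newton_interpolation[symmetric] atLeast0LessThan)
  then have "falling_det N \<mu> y = det L * det U"
    unfolding falling_det_def using det_mult[OF L U] by simp
  also have "det L = prod_list (diag_mat L)"
    by (rule det_lower_triangular[OF _ L]) (auto simp: L_def intro!: prod_zero)
  also have "\<dots> = vandermonde N y"
    by (simp add: prod_list_diag_prod vandermonde_def L_def atLeast0LessThan)
  finally show ?thesis by (simp add: factorial_schur_def U_def)
qed

lemma coeff_synthetic_div:
  "coeff (synthetic_div p c) t = coeff p (Suc t) + c * coeff (synthetic_div p c) (Suc t)"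
proof -
  have "coeff (p + smult c (synthetic_div p c)) (Suc t) = coeff (pCons (poly p c) (synthetic_div p c)) (Suc t)"
    by (simp only: synthetic_div_correct)
  then show ?thesis by simp
qed

lemma degree_newton: "degree (newton f y k) = degree f - k"
  by (induction k) (simp_all add: degree_synthetic_div)

lemma falling_monic: "lead_coeff (falling m) = 1" and degree_falling: "degree (falling m) = m"
proof -
  show "lead_coeff (falling m) = 1" unfolding falling_def by (simp add: lead_coeff_prod)
  have "falling m \<noteq> 0 \<and> degree (falling m) = m"
    by (induction m)
       (auto simp: falling_def degree_mult_eq simp del: mult_pCons_right mult_pCons_left)
  then show "degree (falling m) = m" ..
qed

lemma newton_falling_top: "k \<le> m \<Longrightarrow> coeff (newton (falling m) y k) (m - k) = 1"
proof (induction k)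
  case 0
  then show ?case using falling_monic[of m] by (simp add: degree_falling)
next
  case (Suc k)
  have "coeff (newton (falling m) y (Suc k)) (Suc (m - Suc k)) = 0"
    by (rule coeff_eq_0) (simp add: degree_newton degree_falling del: newton.simps)
  then show ?case
    using Suc coeff_synthetic_div[of "newton (falling m) y k" "y k" "m - Suc k"] by (simp add: Suc_diff_Suc)
qed

lemma newton_falling_eq_0: "m < k \<Longrightarrow> newton (falling m) y k = 0"
proof (induction k)
  case (Suc k)
  show ?case
  proof (cases "m < k")
    case False
    then have "degree (newton (falling m) y k) = 0" using Suc.prems by (simp add: degree_newton degree_falling)
    then show ?thesis by (simp add: synthetic_div_eq_0_iff)
  next
    case True
    then show ?thesis using Suc by simp
  qed
qed simp

lemma beta_empty: "beta N empty_partition j = j"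
  by (simp add: beta_def)

text \<open>
  The divided difference of order \<open>k\<close> of a monic polynomial of degree \<open>j\<close> is \<open>1\<close> for \<open>k = j\<close> and \<open>0\<close> for \<open>k > j\<close>.
\<close>

lemma factorial_schur_empty: "factorial_schur N empty_partition y = 1"
proof -
  define U where "U = mat N N (\<lambda>(k, j). poly (newton (falling (beta N empty_partition j)) y k) (y k))"
  have U: "U \<in> carrier_mat N N" by (simp add: U_def)
  have ut: "upper_triangular U" by (rule upper_triangularI) (auto simp: U_def beta_empty newton_falling_eq_0)
  have one: "poly (newton (falling j) y j) (y j) = 1" for j
  proof -
    have "degree (newton (falling j) y j) = 0" by (simp add: degree_newton degree_falling)
    then obtain c where "newton (falling j) y j = [:c:]" by (rule degree_eq_zeroE)
    then show ?thesis using newton_falling_top[of j j y] by simp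
  qed
  have "det U = prod_list (diag_mat U)" by (rule det_upper_triangular[OF ut U])
  also have "\<dots> = 1" unfolding prod_list_diag_prod by (rule prod.neutral) (auto simp: U_def beta_empty one)
  finally show ?thesis by (simp add: factorial_schur_def U_def)
qed

lemma falling_det_empty: "falling_det N empty_partition y = vandermonde N y"
  by (simp add: falling_det_factorization factorial_schur_empty)

lemma vandermonde_nonzero: "inj_on y {..<N} \<Longrightarrow> vandermonde N y \<noteq> 0"
  unfolding vandermonde_def by (auto dest: inj_onD)

lemma factorial_schur_quotient:
  "inj_on y {..<N} \<Longrightarrow> factorial_schur N \<mu> y = falling_det N \<mu> y / falling_det N empty_partition y"
  using vandermonde_nonzero by (simp add: falling_det_factorization factorial_schur_empty)

lemma falling_det_permute:
  assumes p: "p permutes {0..<N}"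
  shows "falling_det N \<mu> (y \<circ> p) = signof p * falling_det N \<mu> y"
proof -
  let ?A = "mat N N (\<lambda>(i, j). poly (falling (beta N \<mu> j)) (y i))"
  have "mat N N (\<lambda>(i, j). poly (falling (beta N \<mu> j)) ((y \<circ> p) i)) = mat N N (\<lambda>(i, j). ?A $$ (p i, j))"
    using permutes_in_image[OF p] by (intro eq_matI) auto
  then show ?thesis unfolding falling_det_def by (simp add: det_permute_rows[OF _ p])
qed

lemma factorial_schur_permute:
  assumes p: "p permutes {0..<N}" and inj: "inj_on y {..<N}"
  shows "factorial_schur N \<mu> (y \<circ> p) = factorial_schur N \<mu> y"
proof -
  have "inj_on (y \<circ> p) {..<N}"
    using inj permutes_inj_on[OF p] permutes_image[OF p] by (simp add: comp_inj_on atLeast0LessThan)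
  moreover have "signof p \<noteq> (0 :: complex)" by (simp add: sign_def)
  ultimately show ?thesis using inj
    by (simp add: factorial_schur_quotient falling_det_permute[OF p])
qed

text \<open>
  Each division lowers the total degree in \<open>z\<close> and the nodes by one, from \<open>m\<close> for \<open>falling m\<close> to
  \<open>m - k\<close> after \<open>k\<close> divisions, and \<open>z\<^sup>t\<close> accounts for \<open>t\<close> of it. The inner induction descends
  from the top coefficient, as synthetic division does.
\<close>

lemma polyfun_newton_coeff:
  assumes "k \<le> N"
  shows "polyfun {..<N} (int m - int k - int t) (\<lambda>y. coeff (newton (falling m) y k) t)"
  using assms
proof (induction k arbitrary: t)
  case 0
  show ?case
  proof (cases "t \<le> m")
    case False
    then have "coeff (falling m) t = 0" by (intro coeff_eq_0) (simp add: degree_falling)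
    then show ?thesis by (simp add: polyfun_0)
  qed (auto intro: polyfun_const)
next
  case (Suc k)
  show ?case
  proof (induction "m - t" arbitrary: t rule: less_induct)
    case less
    show ?case
    proof (cases "m < t + Suc k")
      case True
      have "coeff (newton (falling m) y (Suc k)) t = 0" for y
      proof (cases "m < Suc k")
        case True then show ?thesis by (simp only: newton_falling_eq_0 coeff_0)
      next
        case False
        then show ?thesis using True by (intro coeff_eq_0) (simp add: degree_newton degree_falling del: newton.simps)
      qed
      then show ?thesis by (simp only: polyfun_0)
    next
      case False
      have "polyfun {..<N} (1 + (int m - int (Suc k) - int (Suc t))) (\<lambda>y. y k * coeff (newton (falling m) y (Suc k)) (Suc t))"
        by (rule polyfun_mult[OF polyfun_var less]) (use Suc.prems False in auto)
      moreover have "polyfun {..<N} (int m - int k - int (Suc t)) (\<lambda>y. coeff (newton (falling m) y k) (Suc t))"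
        by (rule Suc.IH) (use Suc.prems in simp)
      ultimately have "polyfun {..<N} (int m - int (Suc k) - int t)
          (\<lambda>y. coeff (newton (falling m) y k) (Suc t) + y k * coeff (newton (falling m) y (Suc k)) (Suc t))"
        by (intro polyfun_add) (simp_all add: algebra_simps)
      moreover have "coeff (newton (falling m) y k) (Suc t) + y k * coeff (newton (falling m) y (Suc k)) (Suc t)
          = coeff (newton (falling m) y (Suc k)) t" for y
        using coeff_synthetic_div[of "newton (falling m) y k" "y k" t] by simp
      ultimately show ?thesis by (simp only:)
    qed
  qed
qed

lemma sum_beta: "plength \<mu> \<le> N \<Longrightarrow> (\<Sum>j<N. beta N \<mu> j) = psize \<mu> + (\<Sum>j<N. j)"
proof -
  assume N: "plength \<mu> \<le> N"
  have "(\<Sum>j<N. part \<mu> (N - j)) = (\<Sum>i=1..N. part \<mu> i)"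
    by (rule sum.reindex_bij_witness[of _ "\<lambda>i. N - i" "\<lambda>j. N - j"]) auto
  then show ?thesis using psize_eq_sum[OF N] by (simp add: beta_def sum.distrib)
qed

text \<open>
  The entry in row \<open>k\<close> and column \<open>j\<close> has degree at most \<open>m\<^sub>j - k\<close>, so each product in the expansion of the
  determinant has degree at most \<open>\<Sum> m\<^sub>j - \<Sum> k = |\<mu>|\<close>.
\<close>

lemma polyfun_factorial_schur:
  assumes N: "plength \<mu> \<le> N"
  shows "polyfun {..<N} (int (psize \<mu>)) (factorial_schur N \<mu>)"
proof -
  let ?U = "\<lambda>y k j. poly (newton (falling (beta N \<mu> j)) y k) (y k)"
  have U: "polyfun {..<N} (int (beta N \<mu> j) - int k) (\<lambda>y. ?U y k j)" if "k < N" for k j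
  proof -
    let ?m = "beta N \<mu> j"
    have "poly (newton (falling ?m) y k) (y k) = (\<Sum>t\<le>?m. coeff (newton (falling ?m) y k) t * y k ^ t)" for y
      by (rule poly_as_sum_of_monoms'[symmetric, THEN arg_cong[where f = "\<lambda>p. poly p (y k)"], THEN trans])
         (auto simp: degree_newton degree_falling poly_sum poly_monom)
    moreover have "polyfun {..<N} (int ?m - int k) (\<lambda>y. \<Sum>t\<le>?m. coeff (newton (falling ?m) y k) t * y k ^ t)"
    proof (rule polyfun_sum)
      fix t
      have "polyfun {..<N} ((int ?m - int k - int t) + int t * 1) (\<lambda>y. coeff (newton (falling ?m) y k) t * y k ^ t)"
        by (intro polyfun_mult polyfun_power polyfun_var polyfun_newton_coeff) (use that in auto)
      then show "polyfun {..<N} (int ?m - int k) (\<lambda>y. coeff (newton (falling ?m) y k) t * y k ^ t)" by simp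
    qed
    ultimately show ?thesis by (simp only:)
  qed
  have eq: "factorial_schur N \<mu> y = (\<Sum>p | p permutes {0..<N}. signof p * (\<Prod>k<N. ?U y k (p k)))" for y
    unfolding factorial_schur_def
    by (subst det_def'[where n = N])
       (auto intro!: sum.cong prod.cong simp: permutes_in_image atLeast0LessThan[symmetric])
  have "polyfun {..<N} (int (psize \<mu>)) (\<lambda>y. \<Sum>p | p permutes {0..<N}. signof p * (\<Prod>k<N. ?U y k (p k)))"
  proof (intro polyfun_sum polyfun_cmult)
    fix p assume "p \<in> {p. p permutes {0..<N}}"
    then have p: "p permutes {..<N}" by (simp add: atLeast0LessThan)
    have "polyfun {..<N} (\<Sum>k<N. int (beta N \<mu> (p k)) - int k) (\<lambda>y. \<Prod>k<N. ?U y k (p k))"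
      by (intro polyfun_prod U) simp
    moreover have "(\<Sum>k<N. int (beta N \<mu> (p k)) - int k) = int (psize \<mu>)"
    proof -
      have "(\<Sum>k<N. beta N \<mu> (p k)) = (\<Sum>j<N. beta N \<mu> j)"
        using sum.permute[OF p, of "beta N \<mu>"] by (simp add: o_def)
      then have "(\<Sum>k<N. int (beta N \<mu> (p k))) = int (psize \<mu> + (\<Sum>j<N. j))"
        unfolding sum_beta[OF N, symmetric] by (simp flip: of_nat_sum)
      then show ?thesis by (simp add: sum_subtractf)
    qed
    ultimately show "polyfun {..<N} (int (psize \<mu>)) (\<lambda>y. \<Prod>k<N. ?U y k (p k))" by simp
  qed
  then show ?thesis by (simp only: eq[abs_def])
qed

section \<open>A recursion for the determinant\<close>

lemma falling_shift: "z * poly (falling m) (z - 1) = (z - of_nat m) * poly (falling m) z"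
proof -
  have "z * (\<Prod>t<m. z - 1 - of_nat t) = (\<Prod>t<m. z - of_nat t) * (z - of_nat m)"
  proof (induction m)
    case (Suc m)
    have "z * (\<Prod>t<Suc m. z - 1 - of_nat t) = z * (\<Prod>t<m. z - 1 - of_nat t) * (z - 1 - of_nat m)"
      by simp
    also have "\<dots> = (\<Prod>t<m. z - of_nat t) * (z - of_nat m) * (z - 1 - of_nat m)"
      by (simp only: Suc.IH)
    finally show ?case by (simp add: diff_diff_eq)
  qed simp
  then show ?thesis by (simp add: poly_falling mult.commute)
qed

lemma falling_det_sum:
  "falling_det N \<mu> y = (\<Sum>p | p permutes {..<N}. signof p * (\<Prod>i<N. poly (falling (beta N \<mu> (p i))) (y i)))"
  unfolding falling_det_def
  by (subst det_def'[where n = N])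
     (auto intro!: sum.cong prod.cong simp: permutes_in_image atLeast0LessThan)

text \<open>
  From \<open>z (z - 1)\<^sub>m = (z - m) (z)\<^sub>m\<close>: in the expansion over permutations, lowering \<open>y\<^sub>k\<close> and
  multiplying by the old \<open>y\<^sub>k\<close> multiplies the term of \<open>p\<close> by \<open>y\<^sub>k - m\<^bsub>p(k)\<^esub>\<close>, and the sum over \<open>k\<close> of these
  factors is independent of \<open>p\<close>.
\<close>

lemma falling_det_recursion:
  "(\<Sum>k<N. y k * falling_det N \<mu> (y(k := y k - 1))) =
     ((\<Sum>i<N. y i) - of_nat (\<Sum>j<N. beta N \<mu> j)) * falling_det N \<mu> y"
proof -
  let ?f = "\<lambda>p i z. poly (falling (beta N \<mu> (p i))) z"
  have "(\<Sum>k<N. y k * falling_det N \<mu> (y(k := y k - 1))) =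
     (\<Sum>p | p permutes {..<N}. \<Sum>k<N. signof p * (y k * (\<Prod>i<N. ?f p i ((y(k := y k - 1)) i))))"
    unfolding falling_det_sum sum_distrib_left by (subst sum.swap) (simp add: algebra_simps)
  also have "\<dots> = (\<Sum>p | p permutes {..<N}. \<Sum>k<N. signof p * ((y k - of_nat (beta N \<mu> (p k))) * (\<Prod>i<N. ?f p i (y i))))"
  proof (intro sum.cong refl)
    fix p k assume k: "k \<in> {..<N}"
    have "(\<Prod>i<N. ?f p i ((y(k := y k - 1)) i)) = ?f p k (y k - 1) * (\<Prod>i\<in>{..<N} - {k}. ?f p i (y i))"
      by (subst prod.remove[OF _ k]) (auto intro!: prod.cong)
    moreover have "(\<Prod>i<N. ?f p i (y i)) = ?f p k (y k) * (\<Prod>i\<in>{..<N} - {k}. ?f p i (y i))"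
      by (subst prod.remove[OF _ k]) auto
    ultimately have "y k * (\<Prod>i<N. ?f p i ((y(k := y k - 1)) i)) = (y k - of_nat (beta N \<mu> (p k))) * (\<Prod>i<N. ?f p i (y i))"
      using falling_shift[of "y k" "beta N \<mu> (p k)"] by (simp only: mult.assoc[symmetric])
    then show "signof p * (y k * (\<Prod>i<N. ?f p i ((y(k := y k - 1)) i)))
        = signof p * ((y k - of_nat (beta N \<mu> (p k))) * (\<Prod>i<N. ?f p i (y i)))" by (simp only:)
  qed
  also have "\<dots> = (\<Sum>p | p permutes {..<N}. signof p * (((\<Sum>i<N. y i) - of_nat (\<Sum>j<N. beta N \<mu> j)) * (\<Prod>i<N. ?f p i (y i))))"
  proof (intro sum.cong refl)
    fix p assume "p \<in> {p. p permutes {..<N}}"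
    then have "(\<Sum>k<N. beta N \<mu> (p k)) = (\<Sum>j<N. beta N \<mu> j)"
      using sum.permute[of p "{..<N}" "beta N \<mu>"] by (simp add: o_def)
    then have "(\<Sum>k<N. y k - of_nat (beta N \<mu> (p k))) = (\<Sum>i<N. y i) - of_nat (\<Sum>j<N. beta N \<mu> j)"
      by (simp add: sum_subtractf flip: of_nat_sum)
    then show "(\<Sum>k<N. signof p * ((y k - of_nat (beta N \<mu> (p k))) * (\<Prod>i<N. ?f p i (y i))))
        = signof p * (((\<Sum>i<N. y i) - of_nat (\<Sum>j<N. beta N \<mu> j)) * (\<Prod>i<N. ?f p i (y i)))"
      by (simp only: sum_distrib_left[symmetric] sum_distrib_right[symmetric])
  qed
  also have "\<dots> = ((\<Sum>i<N. y i) - of_nat (\<Sum>j<N. beta N \<mu> j)) * falling_det N \<mu> y"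
    unfolding falling_det_sum sum_distrib_left by (simp add: algebra_simps)
  finally show ?thesis .
qed

lemma falling_det_equal_rows:
  assumes "i < N" "j < N" "i \<noteq> j" "y i = y j"
  shows "falling_det N \<mu> y = 0"
  unfolding falling_det_def
proof (rule det_identical_rows[OF _ assms(3,1,2)])
  show "row (mat N N (\<lambda>(i, j). poly (falling (beta N \<mu> j)) (y i))) i = row (mat N N (\<lambda>(i, j). poly (falling (beta N \<mu> j)) (y i))) j"
    using assms by (intro eq_vecI) auto
qed simp

section \<open>Paths in Young's graph\<close>

primrec young_paths :: "nat \<Rightarrow> partition \<Rightarrow> partition \<Rightarrow> nat" where
  "young_paths 0 \<mu> \<rho> = (if \<rho> = \<mu> then 1 else 0)"
| "young_paths (Suc k) \<mu> \<rho> = (\<Sum>\<kappa> | adds_box \<kappa> \<rho>. young_paths k \<mu> \<kappa>)"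

abbreviation betas :: "nat \<Rightarrow> partition \<Rightarrow> nat \<Rightarrow> complex" where
  "betas N \<rho> \<equiv> \<lambda>i. of_nat (beta N \<rho> i)"

lemma poly_falling_of_nat:
  "poly (falling m) (of_nat l) = (if l < m then 0 else of_nat (fact l div fact (l - m)))"
proof (cases "l < m")
  case True
  then show ?thesis by (auto simp: poly_falling intro!: prod_zero)
next
  case False
  then show ?thesis
  proof (induction m)
    case (Suc m)
    then have *: "l - m = Suc (l - Suc m)" by simp
    have "(fact l div fact (l - Suc m) :: nat) = (l - m) * (fact l div fact (l - m))"
    proof -
      have "fact (l - m) dvd (fact l :: nat)" by (rule fact_dvd) simp
      then obtain c :: nat where c: "fact l = fact (l - m) * c" by (rule dvdE)
      have "fact (l - m) = (l - m) * (fact (l - Suc m) :: nat)" unfolding * by simp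
      then show ?thesis unfolding c by (simp add: mult.assoc mult.commute[of "l - m"])
    qed
    then show ?case using Suc by (simp add: poly_falling of_nat_diff)
  qed (simp add: poly_falling)
qed

lemma beta_less:
  assumes "i < j" "j < N"
  shows "beta N \<mu> i < beta N \<mu> j"
proof -
  have "part \<mu> (N - i) \<le> part \<mu> (N - j)" by (rule part_antimono) (use assms in auto)
  then show ?thesis using assms by (simp add: beta_def)
qed

lemma inj_on_betas: "inj_on (betas N \<mu>) {..<N}"
  by (rule inj_onI) (metis beta_less lessThan_iff linorder_neqE_nat nat_less_le of_nat_eq_iff)

lemma partition_eq_if_beta_eq:
  assumes "plength \<mu> \<le> N" "plength \<nu> \<le> N" "\<And>i. i < N \<Longrightarrow> beta N \<mu> i = beta N \<nu> i"
  shows "\<mu> = \<nu>"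
proof (rule partition_eqI)
  fix i :: nat assume "1 \<le> i"
  show "part \<mu> i = part \<nu> i"
  proof (cases "i \<le> N")
    case True
    then show ?thesis using assms(3)[of "N - i"] \<open>1 \<le> i\<close> by (simp add: beta_def)
  next
    case False
    then show ?thesis
      using part_eq_0_iff[OF \<open>1 \<le> i\<close>, of \<mu>] part_eq_0_iff[OF \<open>1 \<le> i\<close>, of \<nu>] assms(1,2) by simp
  qed
qed

text \<open>
  A nonzero term needs \<open>m\<^bsub>p(i)\<^esub> \<le> l\<^sub>i\<close> for all \<open>i\<close>. Summing gives \<open>|\<mu>| \<le> |\<rho>|\<close>, and if the sizes
  are equal, then \<open>m\<^bsub>p(i)\<^esub> = l\<^sub>i\<close> for all \<open>i\<close>. As both sequences increase strictly, so does \<open>p\<close>.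
\<close>

lemma falling_det_term_eq_0:
  assumes len: "plength \<mu> \<le> N" "plength \<rho> \<le> N" and p: "p permutes {..<N}"
    and ne: "(\<Prod>i<N. poly (falling (beta N \<mu> (p i))) (betas N \<rho> i)) \<noteq> 0"
  shows "psize \<mu> \<le> psize \<rho>" and "psize \<rho> = psize \<mu> \<Longrightarrow> \<rho> = \<mu> \<and> p = id"
proof -
  have le: "beta N \<mu> (p i) \<le> beta N \<rho> i" if "i < N" for i
    using ne that by (auto simp: poly_falling_of_nat not_less split: if_splits)
  have sum: "(\<Sum>i<N. beta N \<mu> (p i)) = (\<Sum>j<N. beta N \<mu> j)"
    using sum.permute[OF p, of "beta N \<mu>"] by (simp add: o_def)
  have "(\<Sum>i<N. beta N \<mu> (p i)) \<le> (\<Sum>i<N. beta N \<rho> i)" by (rule sum_mono) (simp add: le)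
  then show "psize \<mu> \<le> psize \<rho>" using sum sum_beta[OF len(1)] sum_beta[OF len(2)] by simp
  assume sz: "psize \<rho> = psize \<mu>"
  have eq: "beta N \<mu> (p i) = beta N \<rho> i" if "i < N" for i
  proof (rule ccontr)
    assume "beta N \<mu> (p i) \<noteq> beta N \<rho> i"
    then have "(\<Sum>i<N. beta N \<mu> (p i)) < (\<Sum>i<N. beta N \<rho> i)"
      using le that by (intro sum_strict_mono_ex1) (auto intro!: bexI[of _ i] simp: nat_less_le)
    then show False using sum sum_beta[OF len(1)] sum_beta[OF len(2)] sz by simp
  qed
  have pin: "p i < N" if "i < N" for i using permutes_in_image[OF p, of i] that by simp
  have mono: "p i < p j" if "i < j" "j < N" for i j
  proof (rule ccontr)
    assume "\<not> p i < p j"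
    then consider "p i = p j" | "p j < p i" by linarith
    then have "beta N \<mu> (p j) \<le> beta N \<mu> (p i)"
      using beta_less[of "p j" "p i" N \<mu>] pin[of i] that by cases auto
    then show False using eq[of i] eq[of j] beta_less[OF that, of \<rho>] that by simp
  qed
  have ge: "i \<le> p i" if "i < N" for i using that
  proof (induction i)
    case (Suc i)
    then show ?case using mono[of i "Suc i"] by simp
  qed simp
  have "(\<Sum>i<N. p i) = (\<Sum>i<N. i)" using sum.permute[OF p, of "\<lambda>i. i"] by (simp add: o_def)
  have pid: "p i = i" if "i < N" for i
  proof (rule ccontr)
    assume "p i \<noteq> i"
    then have "(\<Sum>i<N. i) < (\<Sum>i<N. p i)"
      using ge that by (intro sum_strict_mono_ex1) (auto intro!: bexI[of _ i] simp: nat_less_le)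
    then show False using \<open>(\<Sum>i<N. p i) = (\<Sum>i<N. i)\<close> by simp
  qed
  have "p i = i" for i using pid[of i] permutes_not_in[OF p, of i] by (cases "i < N") auto
  moreover have "\<rho> = \<mu>" by (rule partition_eq_if_beta_eq[OF len(2,1)]) (use eq pid in auto)
  ultimately show "\<rho> = \<mu> \<and> p = id" by auto
qed

lemma falling_det_eq_0:
  assumes len: "plength \<mu> \<le> N" "plength \<rho> \<le> N" and "psize \<rho> < psize \<mu> \<or> psize \<rho> = psize \<mu> \<and> \<rho> \<noteq> \<mu>"
  shows "falling_det N \<mu> (betas N \<rho>) = 0"
  unfolding falling_det_sum
proof (rule sum.neutral, rule ballI)
  fix p assume "p \<in> {p. p permutes {..<N}}"
  then show "signof p * (\<Prod>i<N. poly (falling (beta N \<mu> (p i))) (betas N \<rho> i)) = 0"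
    using falling_det_term_eq_0[OF len, of p] assms(3) by fastforce
qed

lemma falling_det_self:
  assumes len: "plength \<mu> \<le> N"
  shows "falling_det N \<mu> (betas N \<mu>) = (\<Prod>i<N. fact (beta N \<mu> i))"
proof -
  have "falling_det N \<mu> (betas N \<mu>)
     = (\<Sum>p\<in>{id}. signof p * (\<Prod>i<N. poly (falling (beta N \<mu> (p i))) (betas N \<mu> i)))"
    unfolding falling_det_sum
  proof (rule sum.mono_neutral_right)
    show "\<forall>p\<in>{p. p permutes {..<N}} - {id}. signof p * (\<Prod>i<N. poly (falling (beta N \<mu> (p i))) (betas N \<mu> i)) = 0"
      using falling_det_term_eq_0[OF len len] by fastforce
  qed (auto simp: finite_permutations permutes_id)
  then show ?thesis by (simp add: poly_falling_of_nat)
qed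

definition remove_box :: "partition \<Rightarrow> nat \<Rightarrow> partition" where
  "remove_box \<rho> r = partition_of_fun ((part \<rho>)(r := part \<rho> r - 1))"

lemma part_remove_box:
  assumes r: "1 \<le> r" "part \<rho> (Suc r) < part \<rho> r"
  shows "part (remove_box \<rho> r) = (part \<rho>)(r := part \<rho> r - 1)"
proof
  let ?f = "(part \<rho>)(r := part \<rho> r - 1)"
  fix i
  show "part (remove_box \<rho> r) i = ?f i"
  proof (cases "1 \<le> i")
    case True
    show ?thesis unfolding remove_box_def
    proof (rule part_partition_of_fun[where N = "plength \<rho>", OF _ _ True])
      show "?f (Suc j) \<le> ?f j" if "1 \<le> j" for j
        using part_Suc_le[OF that, of \<rho>] r by auto
      show "?f (Suc (plength \<rho>)) = 0"
        using part_eq_0_iff[of "Suc (plength \<rho>)" \<rho>] r by auto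
    qed
  next
    case False
    then have "i = 0" by simp
    then show ?thesis using r by simp
  qed
qed

lemma adds_box_iff_remove_box:
  "adds_box \<kappa> \<rho> \<longleftrightarrow> (\<exists>r. 1 \<le> r \<and> part \<rho> (Suc r) < part \<rho> r \<and> \<kappa> = remove_box \<rho> r)"
proof
  assume "adds_box \<kappa> \<rho>"
  then obtain r where r: "1 \<le> r" "part \<rho> = (part \<kappa>)(r := Suc (part \<kappa> r))" by (auto simp: adds_box_def)
  have lt: "part \<rho> (Suc r) < part \<rho> r" using r part_Suc_le[OF r(1), of \<kappa>] by simp
  have "\<kappa> = remove_box \<rho> r" by (rule partition_eqI) (use part_remove_box[OF r(1) lt] r in auto)
  then show "\<exists>r. 1 \<le> r \<and> part \<rho> (Suc r) < part \<rho> r \<and> \<kappa> = remove_box \<rho> r" using r(1) lt by blast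
next
  assume "\<exists>r. 1 \<le> r \<and> part \<rho> (Suc r) < part \<rho> r \<and> \<kappa> = remove_box \<rho> r"
  then obtain r where r: "1 \<le> r" "part \<rho> (Suc r) < part \<rho> r" "\<kappa> = remove_box \<rho> r" by blast
  then show "adds_box \<kappa> \<rho>" unfolding adds_box_def
    by (intro exI[of _ r]) (auto simp: part_remove_box fun_eq_iff)
qed

lemma adds_box_part_le: "adds_box \<kappa> \<rho> \<Longrightarrow> part \<kappa> i \<le> part \<rho> i"
  by (auto simp: adds_box_def)

lemma sum_adds_box:
  assumes "plength \<rho> \<le> N"
  shows "(\<Sum>\<kappa> | adds_box \<kappa> \<rho>. h \<kappa>) = (\<Sum>i | i < N \<and> part \<rho> (Suc (N - i)) < part \<rho> (N - i). h (remove_box \<rho> (N - i)))"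
proof -
  let ?R = "{i. i < N \<and> part \<rho> (Suc (N - i)) < part \<rho> (N - i)}"
  have "{\<kappa>. adds_box \<kappa> \<rho>} = (\<lambda>i. remove_box \<rho> (N - i)) ` ?R"
  proof (intro Set.equalityI subsetI)
    fix \<kappa> assume "\<kappa> \<in> {\<kappa>. adds_box \<kappa> \<rho>}"
    then obtain r where r: "1 \<le> r" "part \<rho> (Suc r) < part \<rho> r" "\<kappa> = remove_box \<rho> r"
      by (auto simp: adds_box_iff_remove_box)
    then have "r \<le> N" using part_eq_0_iff[OF r(1), of \<rho>] assms by auto
    then show "\<kappa> \<in> (\<lambda>i. remove_box \<rho> (N - i)) ` ?R"
      using r by (intro image_eqI[of _ _ "N - r"]) auto
  next
    fix \<kappa> assume "\<kappa> \<in> (\<lambda>i. remove_box \<rho> (N - i)) ` ?R"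
    then obtain i where "i < N" "part \<rho> (Suc (N - i)) < part \<rho> (N - i)" "\<kappa> = remove_box \<rho> (N - i)" by blast
    then show "\<kappa> \<in> {\<kappa>. adds_box \<kappa> \<rho>}"
      unfolding adds_box_iff_remove_box by (intro CollectI exI[of _ "N - i"]) auto
  qed
  moreover have "inj_on (\<lambda>i. remove_box \<rho> (N - i)) ?R"
  proof (rule inj_onI)
    fix i j assume ij: "i \<in> ?R" "j \<in> ?R" "remove_box \<rho> (N - i) = remove_box \<rho> (N - j)"
    have "(part \<rho>)(N - i := part \<rho> (N - i) - 1) = (part \<rho>)(N - j := part \<rho> (N - j) - 1)"
      using ij part_remove_box[of "N - i" \<rho>, symmetric] part_remove_box[of "N - j" \<rho>, symmetric] by force
    from fun_cong[OF this, of "N - i"] show "i = j" using ij(1,2) by (auto split: if_splits)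
  qed
  ultimately show ?thesis by (simp add: sum.reindex)
qed

text \<open>
  Both sides satisfy the same recursion in \<open>k\<close>. In \<open>falling_det_recursion\<close> with \<open>y = l\<close>, lowering \<open>l\<^sub>i\<close>
  amounts to removing a box from row \<open>N - i\<close>. If that is impossible, then the term vanishes: either two
  rows of the matrix become equal, or \<open>l\<^sub>0 = 0\<close> is the factor in front.
\<close>

lemma young_paths_falling_det:
  assumes "plength \<rho> \<le> N" "plength \<mu> \<le> N" "psize \<rho> = psize \<mu> + k"
  shows "of_nat (young_paths k \<mu> \<rho>) * (\<Prod>i<N. fact (beta N \<rho> i)) = fact k * falling_det N \<mu> (betas N \<rho>)"
  using assms(1,3)
proof (induction k arbitrary: \<rho>)
  case 0
  then show ?case using falling_det_eq_0[of \<mu> N \<rho>] falling_det_self[of \<mu> N] assms(2) by auto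
next
  case (Suc k)
  let ?y = "betas N \<rho>"
  let ?R = "{i. i < N \<and> part \<rho> (Suc (N - i)) < part \<rho> (N - i)}"
  have step: "of_nat (young_paths k \<mu> (remove_box \<rho> (N - i))) * (\<Prod>i<N. fact (beta N \<rho> i))
      = fact k * (?y i * falling_det N \<mu> (?y(i := ?y i - 1)))" if "i \<in> ?R" for i
  proof -
    let ?\<kappa> = "remove_box \<rho> (N - i)"
    have i: "i < N" "1 \<le> N - i" "part \<rho> (Suc (N - i)) < part \<rho> (N - i)" using that by auto
    note part = part_remove_box[OF i(2,3)]
    have ab: "adds_box ?\<kappa> \<rho>" using i adds_box_iff_remove_box by blast
    have len: "plength ?\<kappa> \<le> N" using plength_mono[of ?\<kappa> \<rho>] adds_box_part_le[OF ab] Suc.prems(1) by simp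
    have sz: "psize ?\<kappa> = psize \<mu> + k" using adds_box_psize[OF ab] Suc.prems(2) by simp
    have beta: "beta N ?\<kappa> j = (if j = i then beta N \<rho> i - 1 else beta N \<rho> j)" if "j < N" for j
      using i that by (auto simp: beta_def part)
    have pos: "beta N \<rho> i > 0" using i by (simp add: beta_def)
    have "(\<Prod>i<N. fact (beta N \<rho> i) :: complex) = fact (beta N \<rho> i) * (\<Prod>j\<in>{..<N} - {i}. fact (beta N \<rho> j))"
      by (rule prod.remove) (use i in auto)
    also have "\<dots> = of_nat (beta N \<rho> i) * (fact (beta N ?\<kappa> i) * (\<Prod>j\<in>{..<N} - {i}. fact (beta N ?\<kappa> j)))"
      using pos i(1) by (cases "beta N \<rho> i") (auto simp: beta intro!: prod.cong)
    also have "fact (beta N ?\<kappa> i) * (\<Prod>j\<in>{..<N} - {i}. fact (beta N ?\<kappa> j)) = (\<Prod>j<N. fact (beta N ?\<kappa> j) :: complex)"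
      by (rule prod.remove[symmetric]) (use i in auto)
    finally have "of_nat (young_paths k \<mu> ?\<kappa>) * (\<Prod>i<N. fact (beta N \<rho> i))
       = of_nat (beta N \<rho> i) * (of_nat (young_paths k \<mu> ?\<kappa>) * (\<Prod>j<N. fact (beta N ?\<kappa> j)) :: complex)" by simp
    also have "\<dots> = of_nat (beta N \<rho> i) * (fact k * falling_det N \<mu> (betas N ?\<kappa>))"
      by (simp only: Suc.IH[OF len sz])
    also have "falling_det N \<mu> (betas N ?\<kappa>) = falling_det N \<mu> (?y(i := ?y i - 1))"
      unfolding falling_det_sum using pos
      by (intro sum.cong prod.cong refl arg_cong2[of _ _ _ _ "(*)"] arg_cong2[of _ _ _ _ poly])
         (auto simp: beta of_nat_diff)
    finally show ?thesis by simp
  qed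
  have vanish: "?y i * falling_det N \<mu> (?y(i := ?y i - 1)) = 0" if i: "i < N" "i \<notin> ?R" for i
  proof (cases i)
    case 0
    then have "part \<rho> N = 0" using i part_eq_0_iff[of N \<rho>] part_eq_0_iff[of "Suc N" \<rho>] Suc.prems(1)
      by (simp add: not_less)
    then show ?thesis using 0 by (simp add: beta_def)
  next
    case (Suc j)
    have "part \<rho> (N - i) = part \<rho> (Suc (N - i))"
      using i part_Suc_le[of "N - i" \<rho>] by simp
    then have "beta N \<rho> i = Suc (beta N \<rho> j)" using Suc i(1) by (simp add: beta_def Suc_diff_Suc)
    then have "falling_det N \<mu> (?y(i := ?y i - 1)) = 0"
      using Suc i(1) by (intro falling_det_equal_rows[of i N j]) auto
    then show ?thesis by simp
  qed
  have "of_nat (young_paths (Suc k) \<mu> \<rho>) * (\<Prod>i<N. fact (beta N \<rho> i))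
     = (\<Sum>i\<in>?R. of_nat (young_paths k \<mu> (remove_box \<rho> (N - i))) * (\<Prod>i<N. fact (beta N \<rho> i)) :: complex)"
    by (simp add: sum_adds_box[OF Suc.prems(1)] sum_distrib_right)
  also have "\<dots> = (\<Sum>i\<in>?R. fact k * (?y i * falling_det N \<mu> (?y(i := ?y i - 1))))"
    by (rule sum.cong[OF refl step])
  also have "\<dots> = (\<Sum>i<N. fact k * (?y i * falling_det N \<mu> (?y(i := ?y i - 1))))"
    using vanish by (intro sum.mono_neutral_left) (auto simp del: fun_upd_apply)
  also have "\<dots> = fact k * (((\<Sum>i<N. ?y i) - of_nat (\<Sum>j<N. beta N \<mu> j)) * falling_det N \<mu> ?y)"
    by (simp only: sum_distrib_left[symmetric] falling_det_recursion)
  also have "(\<Sum>i<N. ?y i) - of_nat (\<Sum>j<N. beta N \<mu> j) = of_nat (Suc k)"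
    unfolding of_nat_sum[symmetric] sum_beta[OF Suc.prems(1)] sum_beta[OF assms(2)] Suc.prems(2) by simp
  finally show ?case by (simp add: algebra_simps)
qed

lemma young_paths_contained: "young_paths k \<mu> \<rho> \<noteq> 0 \<Longrightarrow> part \<mu> i \<le> part \<rho> i"
proof (induction k arbitrary: \<rho>)
  case (Suc k)
  then have "(\<Sum>\<kappa> | adds_box \<kappa> \<rho>. young_paths k \<mu> \<kappa>) \<noteq> 0" by simp
  then obtain \<kappa> where "adds_box \<kappa> \<rho>" "young_paths k \<mu> \<kappa> \<noteq> 0"
    by (rule sum.not_neutral_contains_not_neutral) auto
  then show ?case using Suc.IH[of \<kappa>] adds_box_part_le[of \<kappa> \<rho> i] by simp
qed (auto split: if_splits)

section \<open>Standard tableaux\<close>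

text \<open>
  Standard tableaux are the semistandard tableaux in which each of the entries \<open>1, \<dots>, n\<close> occurs exactly once; rows
  then increase strictly because the entries are distinct.
\<close>

lemma standard_tableaux_eq:
  "standard_tableaux \<mu> = content_tableaux \<mu> (\<lambda>k. if 1 \<le> k \<and> k \<le> psize \<mu> then 1 else 0)"
    (is "_ = content_tableaux \<mu> ?a")
proof (intro Set.equalityI subsetI)
  fix T assume T: "T \<in> standard_tableaux \<mu>"
  then have ss: "T \<in> semistandard_tableaux \<mu>"
    unfolding standard_tableaux_def semistandard_tableaux_def PiE_def
    by (blast intro: less_imp_le)
  have bij: "bij_betw T (diagram \<mu>) {1..psize \<mu>}" using T by (simp add: standard_tableaux_def)
  have "card {c \<in> diagram \<mu>. T c = k} = ?a k" for k
  proof (cases "1 \<le> k \<and> k \<le> psize \<mu>")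
    case True
    then have "k \<in> T ` diagram \<mu>" using bij by (simp add: bij_betw_def)
    then obtain c where c: "c \<in> diagram \<mu>" "T c = k" by blast
    then have "{c \<in> diagram \<mu>. T c = k} = {c}"
      using inj_onD[OF bij_betw_imp_inj_on[OF bij]] by blast
    then show ?thesis using True by simp
  next
    case False
    then have "k \<notin> T ` diagram \<mu>" using bij by (simp add: bij_betw_def)
    then have "{c \<in> diagram \<mu>. T c = k} = {}" by blast
    then show ?thesis using False by (simp only: card.empty if_False)
  qed
  then show "T \<in> content_tableaux \<mu> ?a" using ss by (simp add: content_tableaux_def)
next
  fix T assume T: "T \<in> content_tableaux \<mu> ?a"
  then have ss: "T \<in> semistandard_tableaux \<mu>" and cont: "card {c \<in> diagram \<mu>. T c = k} = ?a k" for k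
    unfolding content_tableaux_def by blast+
  have inj: "inj_on T (diagram \<mu>)"
  proof (rule inj_onI)
    fix c d assume cd: "c \<in> diagram \<mu>" "d \<in> diagram \<mu>" "T c = T d"
    let ?S = "{c' \<in> diagram \<mu>. T c' = T c}"
    have "card ?S \<le> Suc 0" using cont[of "T c"] by simp
    have fin: "finite ?S" by simp
    have "\<forall>a\<in>?S. \<forall>b\<in>?S. a = b"
      using \<open>card ?S \<le> Suc 0\<close> unfolding card_le_Suc0_iff_eq[OF fin] .
    moreover have "c \<in> ?S" "d \<in> ?S" using cd by simp_all
    ultimately show "c = d" by blast
  qed
  have sub: "T ` diagram \<mu> \<subseteq> {1..psize \<mu>}"
  proof clarify
    fix c assume c: "c \<in> diagram \<mu>"
    have "?a (T c) \<noteq> 0" using cont[of "T c"] card_nonzero[of "{c' \<in> diagram \<mu>. T c' = T c}" c] c by simp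
    then show "T c \<in> {1..psize \<mu>}" by (simp split: if_splits)
  qed
  have "T ` diagram \<mu> = {1..psize \<mu>}"
    by (rule card_subset_eq[OF _ sub]) (simp_all add: card_image[OF inj] card_diagram)
  then have bij: "bij_betw T (diagram \<mu>) {1..psize \<mu>}" using inj by (simp add: bij_betw_def)
  have "T (i, j) < T (i, Suc j)" if "(i, Suc j) \<in> diagram \<mu>" "(i, j) \<in> diagram \<mu>" for i j
  proof -
    have "T (i, j) \<le> T (i, Suc j)" using ss that by (simp add: semistandard_tableaux_def)
    moreover have "T (i, j) \<noteq> T (i, Suc j)" using inj_onD[OF inj _ that(2,1)] by fastforce
    ultimately show ?thesis by simp
  qed
  then show "T \<in> standard_tableaux \<mu>"
    using ss bij sub unfolding standard_tableaux_def semistandard_tableaux_def PiE_def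
    by (simp add: image_subset_iff_funcset)
qed

lemma hstrip_one_box: "hstrip \<nu> \<mu> \<and> psize \<nu> + 1 = psize \<mu> \<longleftrightarrow> adds_box \<nu> \<mu>"
proof
  assume *: "adds_box \<nu> \<mu>"
  then obtain r where r: "1 \<le> r" "part \<mu> = (part \<nu>)(r := Suc (part \<nu> r))" by (auto simp: adds_box_def)
  have "part \<mu> (Suc i) \<le> part \<nu> i" if "1 \<le> i" for i
    using part_Suc_le[OF that, of \<nu>] part_Suc_le[OF that, of \<mu>] r by (auto split: if_splits)
  then show "hstrip \<nu> \<mu> \<and> psize \<nu> + 1 = psize \<mu>"
    using adds_box_psize[OF *] adds_box_part_le[OF *] by (auto simp: hstrip_def)
next
  assume *: "hstrip \<nu> \<mu> \<and> psize \<nu> + 1 = psize \<mu>"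
  then have le: "part \<nu> i \<le> part \<mu> i" for i by (cases "i = 0") (auto simp: hstrip_def)
  have "plength \<nu> \<le> plength \<mu>" by (rule plength_mono) (rule le)
  then have sum: "(\<Sum>i=1..plength \<mu>. part \<nu> i) + 1 = (\<Sum>i=1..plength \<mu>. part \<mu> i)"
    using * psize_eq_sum[of \<nu> "plength \<mu>"] psize_eq_sum[of \<mu> "plength \<mu>"] by simp
  have "\<exists>r\<in>{1..plength \<mu>}. part \<nu> r < part \<mu> r"
  proof (rule ccontr)
    assume "\<not> ?thesis"
    then have "part \<mu> i = part \<nu> i" if "i \<in> {1..plength \<mu>}" for i using le[of i] that by force
    then show False using sum by simp
  qed
  then obtain r where r: "r \<in> {1..plength \<mu>}" "part \<nu> r < part \<mu> r" by blast
  have rest: "(\<Sum>i\<in>{1..plength \<mu>} - {r}. part \<nu> i) \<le> (\<Sum>i\<in>{1..plength \<mu>} - {r}. part \<mu> i)"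
    by (rule sum_mono) (rule le)
  have eqs: "part \<nu> r + (\<Sum>i\<in>{1..plength \<mu>} - {r}. part \<nu> i) + 1 = part \<mu> r + (\<Sum>i\<in>{1..plength \<mu>} - {r}. part \<mu> i)"
    using sum sum.remove[of "{1..plength \<mu>}" r "part \<nu>"] sum.remove[of "{1..plength \<mu>}" r "part \<mu>"] r(1) by simp
  have "part \<mu> r = Suc (part \<nu> r)" using eqs rest r(2) by linarith
  moreover have "part \<mu> i = part \<nu> i" if "i \<noteq> r" for i
  proof (cases "i \<in> {1..plength \<mu>}")
    case True
    show ?thesis
    proof (rule ccontr)
      assume "part \<mu> i \<noteq> part \<nu> i"
      then have "(\<Sum>i\<in>{1..plength \<mu>} - {r}. part \<nu> i) < (\<Sum>i\<in>{1..plength \<mu>} - {r}. part \<mu> i)"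
        using le[of i] True that by (intro sum_strict_mono_ex1) (auto intro!: bexI[of _ i] le)
      then show False using eqs r(2) by linarith
    qed
  next
    case False
    then have "part \<mu> i = 0" using part_eq_0_iff[of i \<mu>] by (cases "i = 0") auto
    then show ?thesis using le[of i] by simp
  qed
  ultimately show "adds_box \<nu> \<mu>" using r(1)
    by (auto simp: adds_box_def fun_eq_iff intro!: exI[of _ r])
qed

text \<open>
  A horizontal strip of size one is a box. The entry \<open>0\<close> does not occur in standard tableaux, hence the
  shift by one in the number of levels.
\<close>

lemma kostka_standard:
  assumes "psize \<mu> = n" "a 0 = 0" "\<And>k. 1 \<le> k \<Longrightarrow> k \<le> n \<Longrightarrow> a k = 1"
  shows "kostka (Suc n) \<mu> a = young_paths n empty_partition \<mu>"
  using assms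
proof (induction n arbitrary: \<mu>)
  case 0
  then have \<mu>: "\<mu> = empty_partition" by (simp add: psize_eq_0_iff)
  have "hstrip empty_partition empty_partition" by (simp add: hstrip_def)
  then have "{\<nu>. hstrip \<nu> \<mu> \<and> psize \<nu> + a 0 = psize \<mu>} = {empty_partition}"
    using 0 by (auto simp: \<mu> psize_eq_0_iff)
  then show ?case by (simp add: \<mu>)
next
  case (Suc n)
  have "kostka (Suc (Suc n)) \<mu> a = (\<Sum>\<nu> | hstrip \<nu> \<mu> \<and> psize \<nu> + 1 = psize \<mu>. kostka (Suc n) \<nu> a)"
    using Suc.prems(3)[of "Suc n"] by (simp del: kostka.simps(2) add: kostka.simps(2)[of "Suc n"])
  also have "\<dots> = (\<Sum>\<nu> | adds_box \<nu> \<mu>. kostka (Suc n) \<nu> a)" by (simp only: hstrip_one_box)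
  also have "\<dots> = (\<Sum>\<nu> | adds_box \<nu> \<mu>. young_paths n empty_partition \<nu>)"
    by (rule sum.cong[OF refl], rule Suc.IH) (use Suc.prems adds_box_psize in auto)
  finally show ?case by simp
qed

lemma num_syt_eq_young_paths: "num_syt \<mu> = young_paths (psize \<mu>) empty_partition \<mu>"
proof -
  let ?a = "\<lambda>k. if 1 \<le> k \<and> k \<le> psize \<mu> then 1 else (0::nat)"
  have "num_syt \<mu> = kostka (Suc (psize \<mu>)) \<mu> ?a"
    unfolding num_syt_def standard_tableaux_eq by (rule card_content_tableaux) auto
  also have "\<dots> = young_paths (psize \<mu>) empty_partition \<mu>"
    by (rule kostka_standard) auto
  finally show ?thesis .
qed

text \<open>
  The hook length formula in the form of Frobenius: \<open>f\<^sup>\<mu> = n! \<Prod>t<i. (l\<^sub>i - l\<^sub>t) / \<Prod> l\<^sub>i!\<close>.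
\<close>

lemma num_syt_falling_det:
  assumes "plength \<mu> \<le> N"
  shows "of_nat (num_syt \<mu>) * (\<Prod>i<N. fact (beta N \<mu> i)) = fact (psize \<mu>) * vandermonde N (betas N \<mu>)"
  using young_paths_falling_det[of \<mu> N empty_partition "psize \<mu>"] assms
  by (simp add: num_syt_eq_young_paths falling_det_empty plength_def)

lemma num_syt_nonzero: "num_syt \<mu> \<noteq> 0"
proof
  assume "num_syt \<mu> = 0"
  then have "fact (psize \<mu>) * vandermonde (plength \<mu>) (betas (plength \<mu>) \<mu>) = 0"
    using num_syt_falling_det[of \<mu> "plength \<mu>"] by simp
  then show False using vandermonde_nonzero[OF inj_on_betas[of "plength \<mu>" \<mu>]] by simp
qed

section \<open>Powers of \<open>p\<^sub>1\<close>\<close>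

lemma scale_mult: "scale c f * g = scale c (f * g)" "g * scale c f = scale c (g * f)"
proof -
  show "scale c f * g = scale c (f * g)"
    by (rule series_eqI) (simp add: times_series.rep_eq scale.rep_eq sum_distrib_left case_prod_unfold mult.assoc)
  then show "g * scale c f = scale c (g * f)" by (simp add: mult.commute)
qed

lemma p1_power_schur:
  "p1 ^ k * schur \<mu> = (\<Sum>\<rho>\<in>partitions_of (psize \<mu> + k). scale (of_nat (young_paths k \<mu> \<rho>)) (schur \<rho>))"
proof (induction k)
  case 0
  have "(\<Sum>\<rho>\<in>partitions_of (psize \<mu>). scale (of_nat (young_paths 0 \<mu> \<rho>)) (schur \<rho>))
      = (\<Sum>\<rho>\<in>{\<mu>}. scale (of_nat (young_paths 0 \<mu> \<rho>)) (schur \<rho>))"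
    by (rule sum.mono_neutral_right[OF finite_partitions_of]) (auto simp: partitions_of_def)
  then show ?case by simp
next
  case (Suc k)
  let ?P = "partitions_of (psize \<mu> + k)" and ?Q = "partitions_of (psize \<mu> + Suc k)"
  have "p1 ^ Suc k * schur \<mu> = p1 * (p1 ^ k * schur \<mu>)" by (simp add: mult.assoc)
  also have "\<dots> = (\<Sum>\<kappa>\<in>?P. \<Sum>\<rho> | adds_box \<kappa> \<rho>. scale (of_nat (young_paths k \<mu> \<kappa>)) (schur \<rho>))"
    unfolding Suc by (simp add: sum_distrib_left scale_mult Pieri series.scale_sum_right)
  also have "\<dots> = (\<Sum>\<kappa>\<in>?P. \<Sum>\<rho> | \<rho> \<in> ?Q \<and> adds_box \<kappa> \<rho>. scale (of_nat (young_paths k \<mu> \<kappa>)) (schur \<rho>))"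
    by (intro sum.cong refl) (auto simp: partitions_of_def dest: adds_box_psize)
  also have "\<dots> = (\<Sum>\<rho>\<in>?Q. \<Sum>\<kappa> | \<kappa> \<in> ?P \<and> adds_box \<kappa> \<rho>. scale (of_nat (young_paths k \<mu> \<kappa>)) (schur \<rho>))"
    by (rule sum.swap_restrict) auto
  also have "\<dots> = (\<Sum>\<rho>\<in>?Q. \<Sum>\<kappa> | adds_box \<kappa> \<rho>. scale (of_nat (young_paths k \<mu> \<kappa>)) (schur \<rho>))"
    by (intro sum.cong refl) (auto simp: partitions_of_def dest: adds_box_psize)
  also have "\<dots> = (\<Sum>\<rho>\<in>?Q. scale (of_nat (young_paths (Suc k) \<mu> \<rho>)) (schur \<rho>))"
    by (simp add: series.scale_sum_left)
  finally show ?case .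
qed

section \<open>Eigenvalues of the class product\<close>

lemma of_nat_times_series: "of_nat n * f = scale (of_nat n) (f :: series)"
proof (induction n)
  case (Suc n)
  then show ?case by (simp add: distrib_right series.scale_left_distrib)
qed (simp add: series_eqI scale.rep_eq zero_series.rep_eq)

lemma hom_component_schur: "hom_component m (schur \<mu>) = (if m = psize \<mu> then schur \<mu> else 0)"
  by (rule series_eqI) (use schur_homogeneous in \<open>auto simp: hom_component.rep_eq zero_series.rep_eq\<close>)

lemma hom_component_sum:
  "hom_component m (\<Sum>a\<in>A. scale (c a) (f a)) = (\<Sum>a\<in>A. scale (c a) (hom_component m (f a)))"
  by (rule series_eqI) (simp add: hom_component.rep_eq series_nth_sum scale.rep_eq)

lemma hat_sum: "hat (\<Sum>a\<in>A. scale (c a) (f a)) n = (\<Sum>a\<in>A. scale (c a) (hat (f a) n))"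
  unfolding hat_def hom_component_sum sum_distrib_left sum_distrib_right scale_mult
  by (subst sum.swap) (simp only: series.scale_sum_right)

definition falling_nat :: "nat \<Rightarrow> nat \<Rightarrow> nat" where
  "falling_nat n m = (\<Prod>i<m. n - i)"

lemma falling_nat_fact: "m \<le> n \<Longrightarrow> falling_nat n m * fact (n - m) = fact n"
proof (induction m)
  case (Suc m)
  then have "fact (n - m) = (n - m) * (fact (n - Suc m) :: nat)"
    by (metis Suc_diff_Suc Suc_le_lessD fact_Suc of_nat_id)
  then show ?case using Suc by (simp add: falling_nat_def mult.assoc)
qed (simp add: falling_nat_def)

lemma hat_schur:
  "hat (schur \<mu>) n = (if psize \<mu> \<le> n then (\<Sum>\<rho>\<in>partitions_of n.
      scale (of_nat (falling_nat n (psize \<mu>) * young_paths (n - psize \<mu>) \<mu> \<rho>)) (schur \<rho>)) else 0)"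
proof -
  have "hat (schur \<mu>) n = (\<Sum>m\<le>n. if m = psize \<mu> then of_nat (falling_nat n m) * schur \<mu> * p1 ^ (n - m) else 0)"
    unfolding hat_def falling_nat_def hom_component_schur by (intro sum.cong refl) auto
  also have "\<dots> = (if psize \<mu> \<le> n then scale (of_nat (falling_nat n (psize \<mu>))) (p1 ^ (n - psize \<mu>) * schur \<mu>) else 0)"
    by (simp add: sum.delta of_nat_times_series scale_mult)
  also have "\<dots> = (if psize \<mu> \<le> n then (\<Sum>\<rho>\<in>partitions_of n.
      scale (of_nat (falling_nat n (psize \<mu>) * young_paths (n - psize \<mu>) \<mu> \<rho>)) (schur \<rho>)) else 0)"
    by (simp add: p1_power_schur series.scale_sum_right)
  finally show ?thesis .
qed

lemma schur_nonzero: "schur \<mu> \<noteq> 0"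
  using schur_coeff_self[of \<mu>] by (auto simp: zero_series.rep_eq)

lemma schur_eq_sum: "\<mu> \<in> partitions_of n \<Longrightarrow>
    schur \<mu> = (\<Sum>\<nu>\<in>partitions_of n. scale (if \<nu> = \<mu> then 1 else 0) (schur \<nu>))"
  by (simp add: if_distrib[of "\<lambda>c. scale c _"] cong: if_cong)

lemma class_prod_expansions:
  assumes "f = (\<Sum>\<nu>\<in>partitions_of n. scale (c \<nu>) (schur \<nu>))"
    and "g = (\<Sum>\<nu>\<in>partitions_of n. scale (d \<nu>) (schur \<nu>))"
  shows "class_prod n f g = (\<Sum>\<nu>\<in>partitions_of n. scale (c \<nu> * d \<nu> / of_nat (num_syt \<nu>)) (schur \<nu>))"
  unfolding class_prod_def by (intro sum.cong refl) (simp add: assms schur_coord_sum)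

lemma Phi_eq:
  assumes "hat f (psize \<mu>) = (\<Sum>\<nu>\<in>partitions_of (psize \<mu>). scale (c \<nu>) (schur \<nu>))"
  shows "Phi f \<mu> = c \<mu> / of_nat (num_syt \<mu>)"
proof -
  let ?n = "psize \<mu>"
  have \<mu>: "\<mu> \<in> partitions_of ?n" by (simp add: partitions_of_def)
  have "class_prod ?n (hat f ?n) (schur \<mu>)
      = (\<Sum>\<nu>\<in>partitions_of ?n. scale (c \<nu> * (if \<nu> = \<mu> then 1 else 0) / of_nat (num_syt \<nu>)) (schur \<nu>))"
    by (rule class_prod_expansions[OF assms schur_eq_sum[OF \<mu>]])
  also have "\<dots> = (\<Sum>\<nu>\<in>partitions_of ?n. if \<nu> = \<mu> then scale (c \<mu> / of_nat (num_syt \<mu>)) (schur \<mu>) else 0)"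
    by (intro sum.cong refl) auto
  also have "\<dots> = scale (c \<mu> / of_nat (num_syt \<mu>)) (schur \<mu>)" using \<mu> by simp
  finally have *: "class_prod ?n (hat f ?n) (schur \<mu>) = scale (c \<mu> / of_nat (num_syt \<mu>)) (schur \<mu>)" .
  show ?thesis unfolding Phi_def *
    by (rule the_equality) (simp_all add: schur_nonzero)
qed

lemma Phi_schur:
  "Phi (schur \<mu>) \<rho> = (if psize \<mu> \<le> psize \<rho> then
     of_nat (falling_nat (psize \<rho>) (psize \<mu>) * young_paths (psize \<rho> - psize \<mu>) \<mu> \<rho>) / of_nat (num_syt \<rho>) else 0)"
proof (cases "psize \<mu> \<le> psize \<rho>")
  case True
  then show ?thesis
    using Phi_eq[of "schur \<mu>" \<rho> "\<lambda>\<rho>'. of_nat (falling_nat (psize \<rho>) (psize \<mu>) * young_paths (psize \<rho> - psize \<mu>) \<mu> \<rho>')"]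
    by (simp add: hat_schur)
next
  case False
  then show ?thesis using Phi_eq[of "schur \<mu>" \<rho> "\<lambda>_. 0"] by (simp add: hat_schur)
qed

lemma Phi_schur_eq_0: "part \<rho> i < part \<mu> i \<Longrightarrow> Phi (schur \<mu>) \<rho> = 0"
  using young_paths_contained[of "psize \<rho> - psize \<mu>" \<mu> \<rho> i] by (auto simp: Phi_schur)

text \<open>
  For \<open>|\<mu>| = m \<le> n = |\<rho>|\<close> the eigenvalue is \<open>(n)\<^sub>m\<close> times the number of paths from \<open>\<mu>\<close> to \<open>\<rho>\<close>, divided by
  \<open>f\<^sup>\<rho>\<close>. In the quotient of the two determinant formulas the factor \<open>\<Prod> l\<^sub>i!\<close> and, by
  \<open>(n)\<^sub>m (n - m)! = n!\<close>, the factor \<open>n!\<close> cancel. For \<open>m > n\<close> both sides are zero.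
\<close>

lemma Phi_schur_factorial_schur:
  assumes "plength \<mu> \<le> N" "plength \<rho> \<le> N"
  shows "Phi (schur \<mu>) \<rho> = factorial_schur N \<mu> (betas N \<rho>)"
proof (cases "psize \<mu> \<le> psize \<rho>")
  case True
  let ?n = "psize \<rho>" and ?m = "psize \<mu>" and ?y = "betas N \<rho>" and ?P = "\<Prod>i<N. fact (beta N \<rho> i) :: complex"
  have P: "?P \<noteq> 0" by simp
  have V: "vandermonde N ?y \<noteq> 0" by (rule vandermonde_nonzero[OF inj_on_betas])
  have f: "of_nat (num_syt \<rho>) * ?P = fact ?n * vandermonde N ?y" by (rule num_syt_falling_det[OF assms(2)])
  have "of_nat (falling_nat ?n ?m * young_paths (?n - ?m) \<mu> \<rho>) * ?P
      = of_nat (falling_nat ?n ?m) * (of_nat (young_paths (?n - ?m) \<mu> \<rho>) * ?P)" by simp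
  also have "\<dots> = of_nat (falling_nat ?n ?m) * (fact (?n - ?m) * falling_det N \<mu> ?y)"
    using young_paths_falling_det[OF assms(2,1), of "?n - ?m"] True by simp
  also have "\<dots> = of_nat (falling_nat ?n ?m * fact (?n - ?m)) * falling_det N \<mu> ?y" by simp
  also have "\<dots> = fact ?n * falling_det N \<mu> ?y" by (simp only: falling_nat_fact[OF True] of_nat_fact)
  also have "\<dots> = (fact ?n * vandermonde N ?y) * factorial_schur N \<mu> ?y"
    by (simp add: falling_det_factorization)
  also have "\<dots> = of_nat (num_syt \<rho>) * ?P * factorial_schur N \<mu> ?y" by (simp only: f)
  finally have "of_nat (falling_nat ?n ?m * young_paths (?n - ?m) \<mu> \<rho>) = of_nat (num_syt \<rho>) * factorial_schur N \<mu> ?y"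
    using P by (simp add: mult.assoc mult.left_commute)
  then show ?thesis using True num_syt_nonzero[of \<rho>] by (simp add: Phi_schur del: of_nat_mult)
next
  case False
  then show ?thesis
    using falling_det_eq_0[OF assms] vandermonde_nonzero[OF inj_on_betas[of N \<rho>]]
    by (simp add: Phi_schur falling_det_factorization)
qed

lemma Phi_schur_triangular: "Phi (schur \<mu>) \<rho> \<noteq> 0 \<Longrightarrow> \<mu> = \<rho> \<or> psize \<mu> < psize \<rho>"
  by (auto simp: Phi_schur split: if_splits)

lemma Phi_schur_self: "Phi (schur \<mu>) \<mu> \<noteq> 0"
proof -
  have "falling_nat (psize \<mu>) (psize \<mu>) \<noteq> 0" using falling_nat_fact[of "psize \<mu>" "psize \<mu>"] by auto
  then show ?thesis using num_syt_nonzero[of \<mu>] by (simp add: Phi_schur)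
qed

lemma Phi_1: "Phi (schur empty_partition) = (\<lambda>\<rho>. 1)"
  using Phi_schur_factorial_schur[of empty_partition "plength \<rho>" \<rho> for \<rho>]
  by (auto simp: factorial_schur_empty plength_def)

section \<open>Symmetric functions and their eigenvalues\<close>

lemma schur_empty: "schur empty_partition = 1"
proof (rule series_eqI)
  fix m :: monomial
  have d: "diagram empty_partition = {}" by (auto simp: diagram_def)
  show "series_nth (schur empty_partition) m = series_nth 1 m"
  proof (cases "m = 0")
    case True
    have "content_tableaux empty_partition (lookup m) = {\<lambda>_. undefined}"
      using True by (auto simp: content_tableaux_def semistandard_tableaux_def d)
    then show ?thesis using True by (simp add: series_nth_schur one_series.rep_eq)
  next
    case False
    then obtain k where "lookup m k \<noteq> 0" by (metis lookup_zero poly_mapping_eqI)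
    then have "content_tableaux empty_partition (lookup m) = {}"
      by (auto simp: content_tableaux_def d intro!: exI[of _ k])
    then show ?thesis using False by (simp add: series_nth_schur one_series.rep_eq)
  qed
qed

lemma sum_schur_in_Lambda:
  "(\<Sum>\<mu> | psize \<mu> \<le> d. scale (c \<mu>) (schur \<mu>)) \<in> Lambda"
  unfolding Lambda_def
proof (intro CollectI conjI exI[of _ d] allI impI)
  show "symmetric_series (\<Sum>\<mu> | psize \<mu> \<le> d. scale (c \<mu>) (schur \<mu>))"
    by (rule symmetric_series_sum_scale) (rule symmetric_schur)
  fix m assume "series_nth (\<Sum>\<mu> | psize \<mu> \<le> d. scale (c \<mu>) (schur \<mu>)) m \<noteq> 0"
  then have "(\<Sum>\<mu> | psize \<mu> \<le> d. c \<mu> * series_nth (schur \<mu>) m) \<noteq> 0"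
    by (simp add: series_nth_sum scale.rep_eq)
  then obtain \<mu> where "psize \<mu> \<le> d" "series_nth (schur \<mu>) m \<noteq> 0"
    by (rule sum.not_neutral_contains_not_neutral) auto
  then show "mdeg m \<le> d" using schur_homogeneous by auto
qed

lemma Lambda_expansion:
  assumes "f \<in> Lambda"
  shows "\<exists>d c. f = (\<Sum>\<mu> | psize \<mu> \<le> d. scale (c \<mu>) (schur \<mu>))"
proof -
  obtain d where f: "symmetric_series f" and d: "\<And>m. series_nth f m \<noteq> 0 \<Longrightarrow> mdeg m \<le> d"
    using assms by (auto simp: Lambda_def)
  have mdeg: "mdeg (map_key \<pi> m) = mdeg m" if "bij \<pi>" for \<pi> m
    unfolding mdeg_def
    by (rule sum.reindex_bij_witness[of _ "inv_into UNIV \<pi>" \<pi>])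
       (use that in \<open>auto simp: keys_map_key lookup_map_key bij_is_inj bij_is_surj surj_f_inv_f\<close>)
  have "\<exists>c. hom_component n f = (\<Sum>\<mu>\<in>partitions_of n. scale (c \<mu>) (schur \<mu>))" for n
  proof (rule schur_expansion)
    show "symmetric_series (hom_component n f)"
      using f by (simp add: symmetric_series_def hom_component.rep_eq mdeg)
    show "mdeg m = n" if "series_nth (hom_component n f) m \<noteq> 0" for m
      using that by (simp add: hom_component.rep_eq split: if_splits)
  qed
  then obtain c where c: "\<And>n. hom_component n f = (\<Sum>\<mu>\<in>partitions_of n. scale (c n \<mu>) (schur \<mu>))" by metis
  have "f = (\<Sum>n\<le>d. hom_component n f)"
  proof (rule series_eqI)
    fix m
    have "series_nth (\<Sum>n\<le>d. hom_component n f) m = (\<Sum>n\<le>d. if mdeg m = n then series_nth f m else 0)"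
      by (simp add: series_nth_sum hom_component.rep_eq)
    also have "\<dots> = series_nth f m" using d[of m] by auto
    finally show "series_nth f m = series_nth (\<Sum>n\<le>d. hom_component n f) m" by simp
  qed
  also have "\<dots> = (\<Sum>n\<le>d. \<Sum>\<mu> | \<mu> \<in> {\<mu>. psize \<mu> \<le> d} \<and> psize \<mu> = n. scale (c (psize \<mu>) \<mu>) (schur \<mu>))"
    unfolding c by (intro sum.cong refl) (auto simp: partitions_of_def)
  also have "\<dots> = (\<Sum>\<mu> | psize \<mu> \<le> d. scale (c (psize \<mu>) \<mu>) (schur \<mu>))"
    by (rule sum.group) (auto simp: finite_psize_le)
  finally show ?thesis by (intro exI[of _ d] exI[of _ "\<lambda>\<mu>. c (psize \<mu>) \<mu>"])
qed

lemma hat_expansion: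
  assumes "f = (\<Sum>\<mu>\<in>A. scale (c \<mu>) (schur \<mu>))"
  shows "hat f n = (\<Sum>\<rho>\<in>partitions_of n. scale (of_nat (num_syt \<rho>) * (\<Sum>\<mu>\<in>A. c \<mu> * Phi (schur \<mu>) \<rho>)) (schur \<rho>))"
proof -
  have *: "hat (schur \<mu>) n = (\<Sum>\<rho>\<in>partitions_of n. scale (of_nat (num_syt \<rho>) * Phi (schur \<mu>) \<rho>) (schur \<rho>))" for \<mu>
    unfolding hat_schur
    by (auto simp: partitions_of_def Phi_schur num_syt_nonzero intro!: sum.cong sum.neutral[symmetric])
  show ?thesis
    unfolding assms hat_sum * series.scale_sum_right
    by (subst sum.swap) (simp add: series.scale_sum_left[symmetric] sum_distrib_left algebra_simps)
qed

lemma Phi_expansion: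
  assumes "f = (\<Sum>\<mu>\<in>A. scale (c \<mu>) (schur \<mu>))"
  shows "Phi f \<rho> = (\<Sum>\<mu>\<in>A. c \<mu> * Phi (schur \<mu>) \<rho>)"
  using Phi_eq[OF hat_expansion[OF assms]] num_syt_nonzero[of \<rho>] by simp

text \<open>
  The eigenvalues determine \<open>hat f\<close>; this is the injectivity of the correspondence.
\<close>

lemma hat_eq_sum_Phi:
  assumes "f \<in> Lambda"
  shows "hat f n = (\<Sum>\<rho>\<in>partitions_of n. scale (of_nat (num_syt \<rho>) * Phi f \<rho>) (schur \<rho>))"
proof -
  obtain d c where f: "f = (\<Sum>\<mu> | psize \<mu> \<le> d. scale (c \<mu>) (schur \<mu>))"
    using Lambda_expansion[OF assms] by blast
  show ?thesis unfolding hat_expansion[OF f] Phi_expansion[OF f] ..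
qed

section \<open>A vanishing theorem for symmetric polynomials\<close>

definition symmetric_fun :: "nat \<Rightarrow> ((nat \<Rightarrow> complex) \<Rightarrow> complex) \<Rightarrow> bool" where
  "symmetric_fun N F \<longleftrightarrow> (\<forall>\<pi> x. \<pi> permutes {1..N} \<longrightarrow> F (x \<circ> \<pi>) = F x)"

text \<open>
  The argument at which a symmetric polynomial takes the value that a shifted symmetric function takes at \<open>\<rho>\<close>. The
  shift by \<open>N\<close> makes the coordinates nonnegative, and for a partition with at most \<open>N\<close> parts the last
  coordinate is \<open>0\<close> if and only if there are fewer than \<open>N\<close> parts.
\<close>

definition node :: "nat \<Rightarrow> partition \<Rightarrow> nat \<Rightarrow> complex" where
  "node N \<rho> i = of_nat (part \<rho> i + (N - i))"

lemma polyfun_negative: "polyfun A d F \<Longrightarrow> d < 0 \<Longrightarrow> F x = 0"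
proof -
  assume "polyfun A d F" and d: "d < 0"
  then obtain p where p: "\<forall>m\<in>keys p. int (mdeg m) \<le> d" "\<forall>x. mpoly_eval x p = F x"
    unfolding polyfun_def by blast
  have "keys p = {}" using p(1) d by force
  then show ?thesis using p(2) by (simp add: mpoly_eval_def flip: p(2)[rule_format])
qed

lemma polyfun_shift: "polyfun A d F \<Longrightarrow> polyfun A d (\<lambda>x. F (\<lambda>i. x i + c i))"
  by (rule polyfun_compose[of A d F A "\<lambda>i x. x i + c i"])
     (auto intro!: polyfun_add polyfun_var polyfun_const)

lemma polyfun_permute:
  assumes "polyfun {1..N} d F" and \<pi>: "\<pi> permutes {1..N}"
  shows "polyfun {1..N} d (\<lambda>x. F (x \<circ> \<pi>))"
  unfolding o_def
proof (rule polyfun_compose[OF assms(1), of "{1..N}" "\<lambda>i x. x (\<pi> i)"])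
  show "polyfun {1..N} 1 (\<lambda>x. x (\<pi> i))" if "i \<in> {1..N}" for i
    by (rule polyfun_var) (simp_all only: permutes_in_image[OF \<pi>] that order.refl)
qed

definition all_ones :: "nat \<Rightarrow> monomial" where
  "all_ones N = (\<Sum>i\<in>{1..N}. Poly_Mapping.single i 1)"

lemma lookup_all_ones: "lookup (all_ones N) i = (if i \<in> {1..N} then 1 else 0)"
  unfolding all_ones_def by (simp add: lookup_sum lookup_single when_def)

text \<open>
  If setting \<open>x\<^sub>i = 0\<close> annihilates the polynomial, then every monomial contains \<open>x\<^sub>i\<close>. Hence every monomial
  is divisible by the product of all variables, and the quotient can be taken monomial by monomial.
\<close>

lemma polyfun_divide_variables:
  assumes F: "polyfun {1..N} d F" and zero: "\<And>x i. i \<in> {1..N} \<Longrightarrow> x i = 0 \<Longrightarrow> F x = 0"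
  shows "\<exists>R. polyfun {1..N} (d - int N) R \<and> (\<forall>x. F x = (\<Prod>i=1..N. x i) * R x)"
proof -
  obtain p where p: "variables p \<subseteq> {1..N}" "\<forall>m\<in>keys p. int (mdeg m) \<le> d" "\<And>x. mpoly_eval x p = F x"
    using F unfolding polyfun_def by blast
  have pos: "lookup m i \<ge> 1" if m: "m \<in> keys p" and i: "i \<in> {1..N}" for m i
  proof (rule ccontr)
    assume "\<not> lookup m i \<ge> 1"
    then have mi: "lookup m i = 0" by simp
    define D where "D = (\<Sum>m\<in>keys p. lookup m i)"
    have D: "lookup m i \<le> D" if "m \<in> keys p" for m
      unfolding D_def by (rule member_le_sum) (use that in auto)
    have "coefficient_in i p 0 = 0"
    proof (rule mpoly_eqI)
      fix x
      have "mpoly_eval x (coefficient_in i p 0) = mpoly_eval (x(i := 0)) (coefficient_in i p 0)"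
        by (rule mpoly_eval_cong) (use variables_coefficient_in[of i p 0] in auto)
      also have "\<dots> = (\<Sum>e\<le>D. if e = 0 then mpoly_eval (x(i := 0)) (coefficient_in i p 0) else 0)" by simp
      also have "\<dots> = (\<Sum>e\<le>D. mpoly_eval (x(i := 0)) (coefficient_in i p e) * (x(i := 0)) i ^ e)"
        by (intro sum.cong refl) auto
      also have "\<dots> = F (x(i := 0))" using mpoly_eval_coefficients[where p = p and k = i and D = D and x = "x(i := 0)", OF D] p(3) by simp
      also have "\<dots> = 0" by (rule zero[OF i]) simp
      finally show "mpoly_eval x (coefficient_in i p 0) = mpoly_eval x 0" by simp
    qed
    then show False using lookup_coefficient_in[OF m, of i] m mi by (simp add: in_keys_iff)
  qed
  have split: "all_ones N + (m - all_ones N) = m" if "m \<in> keys p" for m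
    using pos[OF that] by (intro poly_mapping_eqI) (auto simp: lookup_add lookup_minus lookup_all_ones)
  have ones: "keys (all_ones N) = {1..N}" by (auto simp: in_keys_iff lookup_all_ones split: if_splits)
  define q where "q = (\<Sum>m\<in>keys p. Poly_Mapping.single (m - all_ones N) (lookup p m))"
  have "F x = (\<Prod>i=1..N. x i) * mpoly_eval x q" for x
  proof -
    have "F x = (\<Sum>m\<in>keys p. lookup p m * mval x m)"
      unfolding p(3)[symmetric] by (rule mpoly_eval_superset) auto
    also have "\<dots> = (\<Sum>m\<in>keys p. mval x (all_ones N) * (lookup p m * mval x (m - all_ones N)))"
    proof (rule sum.cong[OF refl])
      fix m assume "m \<in> keys p"
      then have "mval x m = mval x (all_ones N) * mval x (m - all_ones N)"
        using mval_add[of x "all_ones N" "m - all_ones N"] split by simp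
      then show "lookup p m * mval x m = mval x (all_ones N) * (lookup p m * mval x (m - all_ones N))" by simp
    qed
    also have "\<dots> = mval x (all_ones N) * mpoly_eval x q" by (simp add: q_def sum_distrib_left)
    also have "mval x (all_ones N) = (\<Prod>i=1..N. x i)"
      unfolding mval_def ones by (rule prod.cong) (auto simp: lookup_all_ones)
    finally show ?thesis .
  qed
  moreover have "polyfun {1..N} (d - int N) (\<lambda>x. mpoly_eval x q)"
    unfolding polyfun_def
  proof (intro exI[of _ q] conjI ballI allI refl)
    have k: "keys q \<subseteq> (\<lambda>m. m - all_ones N) ` keys p"
      unfolding q_def by (rule order.trans[OF keys_sum_subset]) (auto split: if_splits)
    have "keys (m - all_ones N) \<subseteq> keys m" for m by (auto simp: in_keys_iff lookup_minus)
    then show "variables q \<subseteq> {1..N}" using k p(1) unfolding variables_def by blast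
    fix m' assume "m' \<in> keys q"
    then obtain m where m: "m \<in> keys p" "m' = m - all_ones N" using k by blast
    have "mdeg m = mdeg (all_ones N) + mdeg m'" using mdeg_add[of "all_ones N" m'] split[OF m(1)] m(2) by simp
    moreover have "mdeg (all_ones N) = N" unfolding mdeg_def ones by (simp add: lookup_all_ones)
    ultimately show "int (mdeg m') \<le> d - int N" using p(2) m(1) by fastforce
  qed
  ultimately show ?thesis by blast
qed

text \<open>
  Setting \<open>x\<^sub>N = 0\<close> leaves, after a shift by one, a symmetric polynomial in \<open>N - 1\<close> variables that vanishes at the
  partitions of size at most \<open>d\<close> with fewer than \<open>N\<close> parts, so it is zero. By symmetry \<open>F\<close> is divisible by every variable. The
  quotient by \<open>x\<^sub>1 \<dots> x\<^sub>N\<close>, again shifted by one, is symmetric of degree at most \<open>d - N\<close>. It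
  vanishes at all \<open>\<rho>\<close> with \<open>|\<rho>| \<le> d - N\<close>, because \<open>F\<close> vanishes at \<open>\<rho>\<close> with a full column of \<open>N\<close> boxes
  added. Both steps lower the number \<open>N + d\<close>.
\<close>

lemma sym_polyfun_eq_0:
  assumes "polyfun {1..N} d F" "symmetric_fun N F"
    and "\<And>\<rho>. plength \<rho> \<le> N \<Longrightarrow> int (psize \<rho>) \<le> d \<Longrightarrow> F (node N \<rho>) = 0"
  shows "F x = 0"
  using assms
proof (induction "N + nat (d + 1)" arbitrary: N d F x rule: less_induct)
  case less
  note F = less.prems(1) and sym = less.prems(2) and van = less.prems(3)
  consider "d < 0" | "0 \<le> d" "N = 0" | "0 \<le> d" "0 < N" by linarith
  then show ?case
  proof cases
    case 1
    then show ?thesis using polyfun_negative[OF F] by simp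
  next
    case 2
    have "F x = F (node N empty_partition)" by (rule polyfun_cong[OF F]) (use 2 in simp)
    then show ?thesis using van[of empty_partition] 2 by (simp add: plength_def)
  next
    case 3
    (* The argument whose last coordinate is 0 and whose other coordinates are shifted by one. *)
    define extend where "extend z i = (if i = N then 0 else z i + 1)" for z :: "nat \<Rightarrow> complex" and i
    have extend0: "F (extend z) = 0" for z
    proof (rule less.hyps[of "N - 1" d "\<lambda>z. F (extend z)"])
      show "N - 1 + nat (d + 1) < N + nat (d + 1)" using 3 by simp
      show "polyfun {1..N - 1} d (\<lambda>z. F (extend z))"
      proof (rule polyfun_compose[OF F, of "{1..N - 1}" "\<lambda>i z. extend z i"])
        show "polyfun {1..N - 1} 1 (\<lambda>z. extend z i)" if "i \<in> {1..N}" for i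
          using that by (cases "i = N")
            (auto simp: extend_def intro!: polyfun_0 polyfun_add polyfun_var polyfun_const)
      qed
      show "symmetric_fun (N - 1) (\<lambda>z. F (extend z))"
        unfolding symmetric_fun_def
      proof (intro allI impI)
        fix \<pi> z assume \<pi>: "\<pi> permutes {1..N - 1}"
        then have \<pi>N: "\<pi> permutes {1..N}" by (rule permutes_subset) auto
        have "\<pi> N = N" by (rule permutes_not_in[OF \<pi>]) (use 3 in simp)
        then have "\<pi> i = N \<longleftrightarrow> i = N" for i
          using inj_eq[OF permutes_inj[OF \<pi>], of i N] by simp
        then have "extend (z \<circ> \<pi>) = extend z \<circ> \<pi>" by (auto simp: extend_def)
        then show "F (extend (z \<circ> \<pi>)) = F (extend z)" using sym \<pi>N by (simp add: symmetric_fun_def)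
      qed
      fix \<rho> assume \<rho>: "plength \<rho> \<le> N - 1" "int (psize \<rho>) \<le> d"
      have "F (extend (node (N - 1) \<rho>)) = F (node N \<rho>)"
      proof (rule polyfun_cong[OF F])
        fix i assume i: "i \<in> {1..N}"
        show "extend (node (N - 1) \<rho>) i = node N \<rho> i"
        proof (cases "i = N")
          case True
          then have "part \<rho> N = 0" using part_eq_0_iff[of N \<rho>] \<rho>(1) 3 by simp
          then show ?thesis using True by (simp add: extend_def node_def)
        next
          case False
          then have "i < N" using i by simp
          then have "N - i = Suc (N - 1 - i)" by simp
          then show ?thesis using False by (simp add: extend_def node_def)
        qed
      qed
      then show "F (extend (node (N - 1) \<rho>)) = 0" using van[of \<rho>] \<rho> by simp
    qed
    have zeroN: "F x = 0" if "x N = 0" for x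
    proof -
      have "extend (\<lambda>i. x i - 1) = x" using that by (auto simp: extend_def)
      then show ?thesis using extend0[of "\<lambda>i. x i - 1"] by simp
    qed
    have zero: "F x = 0" if i: "i \<in> {1..N}" "x i = 0" for x i
    proof -
      have "transpose i N permutes {1..N}" by (rule permutes_swap_id) (use i 3 in auto)
      then have "F x = F (x \<circ> transpose i N)" using sym by (simp add: symmetric_fun_def)
      also have "\<dots> = 0" by (rule zeroN) (simp add: i)
      finally show ?thesis .
    qed
    have "\<exists>R. polyfun {1..N} (d - int N) R \<and> (\<forall>x. F x = (\<Prod>i=1..N. x i) * R x)"
      by (rule polyfun_divide_variables[OF F]) (rule zero)
    then obtain R where R: "polyfun {1..N} (d - int N) R" "\<And>x. F x = (\<Prod>i=1..N. x i) * R x"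
      by blast
    have symR: "R (x \<circ> \<pi>) = R x" if \<pi>: "\<pi> permutes {1..N}" for \<pi> x
    proof -
      let ?H = "\<lambda>x. R (x \<circ> \<pi>) - R x"
      (* The product of the variables can be cancelled only where it is nonzero.
         Strictly decreasing natural arguments become positive by the shift. *)
      have H: "polyfun {1..N} (d - int N) (\<lambda>x. ?H (\<lambda>i. x i + 1))"
        by (rule polyfun_shift[where F = ?H]) (intro polyfun_diff polyfun_permute R \<pi>)
      have "?H (\<lambda>i. of_nat (a i) + 1) = 0" for a :: "nat \<Rightarrow> nat"
      proof -
        let ?x = "\<lambda>i. of_nat (a i) + 1 :: complex"
        have ne: "?x i \<noteq> 0" for i
          using of_nat_neq_0[where 'a = complex, of "a i"] by (simp add: add.commute)
        have "(\<Prod>i=1..N. ?x i) = (\<Prod>i=1..N. (?x \<circ> \<pi>) i)"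
          using prod.permute[OF \<pi>, of ?x] by (simp add: o_def)
        moreover have "F (?x \<circ> \<pi>) = F ?x" using sym \<pi> unfolding symmetric_fun_def by blast
        ultimately have "(\<Prod>i=1..N. ?x i) * R (?x \<circ> \<pi>) = (\<Prod>i=1..N. ?x i) * R ?x"
          unfolding R(2) by simp
        moreover have "(\<Prod>i=1..N. ?x i) \<noteq> 0" using ne by simp
        ultimately show ?thesis by simp
      qed
      then have "?H (\<lambda>i. (x i - 1) + 1) = 0" by (intro polyfun_eq_0[OF H, of "\<lambda>i. x i - 1"]) auto
      then show ?thesis by simp
    qed
    have "R (\<lambda>i. z i + 1) = 0" for z
    proof (rule less.hyps[of N "d - int N" "\<lambda>z. R (\<lambda>i. z i + 1)"])
      show "N + nat (d - int N + 1) < N + nat (d + 1)" using 3 by simp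
      show "polyfun {1..N} (d - int N) (\<lambda>z. R (\<lambda>i. z i + 1))" by (rule polyfun_shift[OF R(1)])
      show "symmetric_fun N (\<lambda>z. R (\<lambda>i. z i + 1))"
        unfolding symmetric_fun_def using symR by (auto simp: o_def)
      fix \<rho> assume \<rho>: "plength \<rho> \<le> N" "int (psize \<rho>) \<le> d - int N"
      (* \<open>\<rho>\<close> with a full first column of \<open>N\<close> boxes added. *)
      define \<rho>' where "\<rho>' = partition_of_fun (\<lambda>i. if i \<le> N then Suc (part \<rho> i) else 0)"
      have \<rho>': "part \<rho>' i = (if i \<le> N then Suc (part \<rho> i) else 0)" if "1 \<le> i" for i
        unfolding \<rho>'_def by (rule part_partition_of_fun[where N = N]) (use part_Suc_le that in auto)
      have len: "plength \<rho>' \<le> N" using \<rho>'[of "Suc N"] part_eq_0_iff[of "Suc N" \<rho>'] by simp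
      have "psize \<rho>' = (\<Sum>i=1..N. Suc (part \<rho> i))"
        unfolding psize_eq_sum[OF len] by (rule sum.cong) (auto simp: \<rho>')
      also have "\<dots> = psize \<rho> + N" unfolding psize_eq_sum[OF \<rho>(1)] by (simp add: sum_Suc)
      finally have sz: "psize \<rho>' = psize \<rho> + N" .
      have node: "node N \<rho>' i = node N \<rho> i + 1" if "i \<in> {1..N}" for i
        using \<rho>'[of i] that by (simp add: node_def)
      have "node N \<rho>' i \<noteq> 0" if "i \<in> {1..N}" for i
        using \<rho>'[of i] that by (simp only: node_def of_nat_eq_0_iff) simp
      then have "(\<Prod>i=1..N. node N \<rho>' i) \<noteq> 0" by simp
      moreover have "F (node N \<rho>') = 0" by (rule van[OF len]) (use sz \<rho>(2) in simp)
      ultimately have "R (node N \<rho>') = 0" using R(2)[of "node N \<rho>'"] by simp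
      also have "R (node N \<rho>') = R (\<lambda>i. node N \<rho> i + 1)" by (rule polyfun_cong[OF R(1)]) (rule node)
      finally show "R (\<lambda>i. node N \<rho> i + 1) = 0" .
    qed
    from this[of "\<lambda>i. x i - 1"] show ?thesis unfolding R(2) by simp
  qed
qed

section \<open>Shifted symmetric functions as functions on partitions\<close>

abbreviation shifted_parts :: "partition \<Rightarrow> nat \<Rightarrow> complex" where
  "shifted_parts \<rho> \<equiv> \<lambda>i. of_nat (part \<rho> i) - of_nat i"

text \<open>
  The value of \<open>\<phi>\<close> at partitions with at most \<open>N\<close> parts is a symmetric polynomial of degree at most \<open>d\<close> in
  \<open>\<rho>\<^sub>i - i\<close>. The common function \<open>\<phi>\<close> ties the polynomials for different \<open>N\<close> together, which yields the
  stability condition.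
\<close>

definition shifted_rep :: "nat \<Rightarrow> int \<Rightarrow> (partition \<Rightarrow> complex) \<Rightarrow> bool" where
  "shifted_rep N d \<phi> \<longleftrightarrow> (\<exists>F. polyfun {1..N} d F \<and> symmetric_fun N F \<and>
     (\<forall>\<rho>. plength \<rho> \<le> N \<longrightarrow> \<phi> \<rho> = F (shifted_parts \<rho>)))"

lemma shifted_repI:
  assumes "polyfun {1..N} d F" "symmetric_fun N F"
    and "\<And>\<rho>. plength \<rho> \<le> N \<Longrightarrow> \<phi> \<rho> = F (shifted_parts \<rho>)"
  shows "shifted_rep N d \<phi>"
  using assms unfolding shifted_rep_def by blast

lemma shifted_rep_mono: "shifted_rep N d \<phi> \<Longrightarrow> d \<le> e \<Longrightarrow> shifted_rep N e \<phi>"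
  unfolding shifted_rep_def using polyfun_mono[OF _ order.refl] by blast

lemma shifted_rep_const: "0 \<le> d \<Longrightarrow> shifted_rep N d (\<lambda>_. c)"
  by (rule shifted_repI[of N d "\<lambda>_. c"]) (auto simp: symmetric_fun_def polyfun_const)

lemma shifted_rep_add:
  "shifted_rep N d \<phi> \<Longrightarrow> shifted_rep N d \<psi> \<Longrightarrow> shifted_rep N d (\<lambda>\<rho>. \<phi> \<rho> + \<psi> \<rho>)"
  unfolding shifted_rep_def[of N d \<phi>] shifted_rep_def[of N d \<psi>]
proof (elim exE conjE)
  fix F G assume "polyfun {1..N} d F" "polyfun {1..N} d G" "symmetric_fun N F" "symmetric_fun N G"
    "\<forall>\<rho>. plength \<rho> \<le> N \<longrightarrow> \<phi> \<rho> = F (shifted_parts \<rho>)"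
    "\<forall>\<rho>. plength \<rho> \<le> N \<longrightarrow> \<psi> \<rho> = G (shifted_parts \<rho>)"
  then show ?thesis
    by (intro shifted_repI[of N d "\<lambda>x. F x + G x"]) (auto simp: symmetric_fun_def polyfun_add)
qed

lemma shifted_rep_mult:
  "shifted_rep N d \<phi> \<Longrightarrow> shifted_rep N e \<psi> \<Longrightarrow> shifted_rep N (d + e) (\<lambda>\<rho>. \<phi> \<rho> * \<psi> \<rho>)"
  unfolding shifted_rep_def[of N d \<phi>] shifted_rep_def[of N e \<psi>]
proof (elim exE conjE)
  fix F G assume "polyfun {1..N} d F" "polyfun {1..N} e G" "symmetric_fun N F" "symmetric_fun N G"
    "\<forall>\<rho>. plength \<rho> \<le> N \<longrightarrow> \<phi> \<rho> = F (shifted_parts \<rho>)"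
    "\<forall>\<rho>. plength \<rho> \<le> N \<longrightarrow> \<psi> \<rho> = G (shifted_parts \<rho>)"
  then show ?thesis
    by (intro shifted_repI[of N "d + e" "\<lambda>x. F x * G x"]) (auto simp: symmetric_fun_def polyfun_mult)
qed

lemma shifted_rep_cmult: "shifted_rep N d \<phi> \<Longrightarrow> shifted_rep N d (\<lambda>\<rho>. c * \<phi> \<rho>)"
  using shifted_rep_mult[OF shifted_rep_const[of 0 N c]] by simp

lemma shifted_rep_sum:
  "0 \<le> d \<Longrightarrow> (\<And>a. a \<in> A \<Longrightarrow> shifted_rep N d (\<phi> a)) \<Longrightarrow> shifted_rep N d (\<lambda>\<rho>. \<Sum>a\<in>A. \<phi> a \<rho>)"
  by (induction A rule: infinite_finite_induct) (auto intro: shifted_rep_add shifted_rep_const)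

lemma shifted_rep_eq_0:
  assumes "shifted_rep N d \<phi>"
    and "\<And>\<rho>. plength \<rho> \<le> N \<Longrightarrow> int (psize \<rho>) \<le> d \<Longrightarrow> \<phi> \<rho> = 0"
    and "plength \<rho> \<le> N"
  shows "\<phi> \<rho> = 0"
proof -
  obtain F where F: "polyfun {1..N} d F" "symmetric_fun N F"
    "\<And>\<rho>. plength \<rho> \<le> N \<Longrightarrow> \<phi> \<rho> = F (shifted_parts \<rho>)"
    using assms(1) unfolding shifted_rep_def by blast
  let ?F = "\<lambda>y. F (\<lambda>i. y i + - of_nat N)"
  have "?F y = 0" for y
  proof (rule sym_polyfun_eq_0[where F = ?F])
    show "polyfun {1..N} d ?F" by (rule polyfun_shift[OF F(1)])
    show "symmetric_fun N ?F" unfolding symmetric_fun_def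
    proof (intro allI impI)
      fix \<pi> y assume "\<pi> permutes {1..N}"
      then have "F ((\<lambda>i. y i + - of_nat N) \<circ> \<pi>) = F (\<lambda>i. y i + - of_nat N)"
        using F(2) unfolding symmetric_fun_def by blast
      then show "?F (y \<circ> \<pi>) = ?F y" by (simp add: o_def)
    qed
    fix \<rho> assume \<rho>: "plength \<rho> \<le> N" "int (psize \<rho>) \<le> d"
    have "F (\<lambda>i. node N \<rho> i + - of_nat N) = F (shifted_parts \<rho>)"
      by (rule polyfun_cong[OF F(1)]) (simp add: node_def of_nat_diff)
    then show "F (\<lambda>i. node N \<rho> i + - of_nat N) = 0" using F(3)[OF \<rho>(1)] assms(2)[OF \<rho>] by simp
  qed
  from this[of "\<lambda>i. of_nat (part \<rho> i) - of_nat i + of_nat N"] show ?thesis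
    using F(3)[OF assms(3)] by simp
qed

lemma shifted_value_rep:
  assumes g: "shifted_symmetric g"
  shows "\<exists>d. \<forall>N\<ge>1. shifted_rep N d (shifted_value g)"
proof -
  obtain d where d: "\<And>N m. N \<ge> 1 \<Longrightarrow> m \<in> keys (g N) \<Longrightarrow> mdeg m \<le> d"
    and vars: "\<And>N. N \<ge> 1 \<Longrightarrow> variables (g N) \<subseteq> {1..N}"
    and sym: "\<And>N. N \<ge> 1 \<Longrightarrow> \<exists>q. symmetric_poly N q \<and> g N = mpoly_subst (\<lambda>i. mpoly_var i - of_nat i) q"
    and stable: "\<And>N. N \<ge> 1 \<Longrightarrow> mpoly_subst (mpoly_var (N + 1 := 0)) (g (N + 1)) = g N"
    using g unfolding shifted_symmetric_def by blast
  have eval_stable: "mpoly_eval (\<lambda>i. of_nat (part \<rho> i)) (g N) = shifted_value g \<rho>"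
    if "N \<ge> 1" "plength \<rho> \<le> N" for N \<rho>
  proof -
    have "max 1 (plength \<rho>) \<le> N" using that by simp
    then show ?thesis
    proof (induction N rule: dec_induct)
      case base
      then show ?case by (simp add: shifted_value_def)
    next
      case (step n)
      let ?x = "\<lambda>i. of_nat (part \<rho> i) :: complex"
      have "part \<rho> (n + 1) = 0" using part_eq_0_iff[of "n + 1" \<rho>] step by simp
      then have x: "(\<lambda>i. mpoly_eval ?x ((mpoly_var (n + 1 := 0)) i)) = ?x" by auto
      have "mpoly_eval ?x (g n) = mpoly_eval ?x (g (n + 1))"
        unfolding stable[of n, symmetric] using stable[of n] step(1) x
        by (metis max.bounded_iff mpoly_eval_subst)
      then show ?case using step by simp
    qed
  qed
  have "shifted_rep N (int d) (shifted_value g)" if N: "N \<ge> 1" for N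
  proof -
    obtain q where q: "symmetric_poly N q" "g N = mpoly_subst (\<lambda>i. mpoly_var i - of_nat i) q"
      using sym[OF N] by blast
    have eval: "mpoly_eval x (g N) = mpoly_eval (\<lambda>i. x i - of_nat i) q" for x
      by (simp add: q(2))
    show ?thesis
    proof (rule shifted_repI[of N "int d" "\<lambda>y. mpoly_eval y q"])
      have "polyfun {1..N} (int d) (\<lambda>x. mpoly_eval x (g N))"
        unfolding polyfun_def using d[OF N] vars[OF N] by (intro exI[of _ "g N"]) auto
      from polyfun_shift[OF this, of of_nat] show "polyfun {1..N} (int d) (\<lambda>y. mpoly_eval y q)"
        by (simp add: eval)
      show "symmetric_fun N (\<lambda>y. mpoly_eval y q)" using q(1) by (simp add: symmetric_poly_iff symmetric_fun_def)
      show "shifted_value g \<rho> = mpoly_eval (shifted_parts \<rho>) q" if "plength \<rho> \<le> N" for \<rho>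
        using eval_stable[OF N that] by (simp add: eval)
    qed
  qed
  then show ?thesis by blast
qed

text \<open>
  The polynomials for \<open>N\<close> and \<open>N + 1\<close> agree at all partitions with at most \<open>N\<close> parts, since both give \<open>\<phi>\<close>. These
  arguments include all strictly decreasing ones, so the polynomials satisfy the stability condition
  formally.
\<close>

lemma rep_shifted_value:
  assumes "\<And>N. N \<ge> 1 \<Longrightarrow> shifted_rep N d \<phi>"
  shows "\<exists>g. shifted_symmetric g \<and> \<phi> = shifted_value g"
proof -
  from assms have "\<exists>F. \<forall>N\<ge>1. polyfun {1..N} d (F N) \<and> symmetric_fun N (F N) \<and>
     (\<forall>\<rho>. plength \<rho> \<le> N \<longrightarrow> \<phi> \<rho> = F N (shifted_parts \<rho>))"
    unfolding shifted_rep_def by metis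
  then obtain F where pF: "\<And>N. N \<ge> 1 \<Longrightarrow> polyfun {1..N} d (F N)" and sF: "\<And>N. N \<ge> 1 \<Longrightarrow> symmetric_fun N (F N)"
    and vF: "\<And>N \<rho>. N \<ge> 1 \<Longrightarrow> plength \<rho> \<le> N \<Longrightarrow> \<phi> \<rho> = F N (shifted_parts \<rho>)"
    by blast
  have "\<exists>q. \<forall>N\<ge>1. variables (q N) \<subseteq> {1..N} \<and> (\<forall>x. mpoly_eval x (q N) = F N x)"
    using pF unfolding polyfun_def by metis
  then obtain q where vq: "\<And>N. N \<ge> 1 \<Longrightarrow> variables (q N) \<subseteq> {1..N}"
    and eq: "\<And>N x. N \<ge> 1 \<Longrightarrow> mpoly_eval x (q N) = F N x" by blast
  define g where "g N = mpoly_subst (\<lambda>i. mpoly_var i - of_nat i) (q N)" for N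
  have eg: "mpoly_eval x (g N) = F N (\<lambda>i. x i - of_nat i)" if "N \<ge> 1" for N x
    by (simp add: g_def eq[OF that])
  have pg: "polyfun {1..N} d (\<lambda>x. mpoly_eval x (g N))" if "N \<ge> 1" for N
    using polyfun_shift[OF pF[OF that], of "\<lambda>i. - of_nat i"] by (simp add: eg[OF that])
  have vg: "variables (g N) \<subseteq> {1..N} \<and> (\<forall>m\<in>keys (g N). int (mdeg m) \<le> d)" if N: "N \<ge> 1" for N
  proof -
    obtain p where p: "variables p \<subseteq> {1..N}" "\<forall>m\<in>keys p. int (mdeg m) \<le> d" "\<forall>x. mpoly_eval x p = mpoly_eval x (g N)"
      using pg[OF N] unfolding polyfun_def by blast
    have "p = g N" by (rule mpoly_eqI) (simp add: p(3))
    then show ?thesis using p by simp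
  qed
  have "shifted_symmetric g"
    unfolding shifted_symmetric_def
  proof (intro conjI allI impI)
    show "variables (g N) \<subseteq> {1..N}" if "N \<ge> 1" for N using vg[OF that] by simp
    show "\<exists>d. \<forall>N\<ge>1. \<forall>m\<in>keys (g N). mdeg m \<le> d"
    proof (intro exI[of _ "nat d"] allI impI ballI)
      fix N m assume "N \<ge> 1" "m \<in> keys (g N)"
      then have "int (mdeg m) \<le> d" using vg by blast
      then show "mdeg m \<le> nat d" by linarith
    qed
    show "\<exists>q. symmetric_poly N q \<and> g N = mpoly_subst (\<lambda>i. mpoly_var i - of_nat i) q" if N: "N \<ge> 1" for N
    proof (intro exI[of _ "q N"] conjI)
      show "symmetric_poly N (q N)"
        using vq[OF N] sF[OF N] by (simp add: symmetric_poly_iff eq[OF N] symmetric_fun_def)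
      show "g N = mpoly_subst (\<lambda>i. mpoly_var i - of_nat i) (q N)" by (simp add: g_def)
    qed
    fix N :: nat assume N: "N \<ge> 1"
    then have N1: "N + 1 \<ge> 1" by simp
    show "mpoly_subst (mpoly_var (N + 1 := 0)) (g (N + 1)) = g N"
    proof (rule mpoly_eqI)
      fix x
      let ?E = "\<lambda>x. mpoly_eval (\<lambda>i. mpoly_eval x ((mpoly_var (N + 1 := 0)) i)) (g (N + 1))"
      have "?E x - mpoly_eval x (g N) = 0"
      proof (rule polyfun_eq_0[of N d "\<lambda>x. ?E x - mpoly_eval x (g N)"])
        have "polyfun {1..N} d ?E"
        proof (rule polyfun_compose[OF pg[OF N1]])
          show "polyfun {1..N} 1 (\<lambda>x. mpoly_eval x ((mpoly_var (N + 1 := 0)) i))" if "i \<in> {1..N + 1}" for i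
            using that by (cases "i = N + 1") (auto intro!: polyfun_0 polyfun_var)
        qed
        then show "polyfun {1..N} d (\<lambda>x. ?E x - mpoly_eval x (g N))" by (rule polyfun_diff[OF _ pg[OF N]])
        fix a :: "nat \<Rightarrow> nat" assume a: "\<And>i. 1 \<le> i \<Longrightarrow> i < N \<Longrightarrow> a (Suc i) < a i"
        (* The strictly decreasing argument \<open>a\<close>, read as a partition. *)
        define \<rho> where "\<rho> = partition_of_fun (\<lambda>i. if i \<le> N then a i else 0)"
        have \<rho>: "part \<rho> i = (if i \<le> N then a i else 0)" if "1 \<le> i" for i
          unfolding \<rho>_def
        proof (rule part_partition_of_fun[where N = N, OF _ _ that])
          show "(if Suc i \<le> N then a (Suc i) else 0) \<le> (if i \<le> N then a i else 0)" if "1 \<le> i" for i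
            using a[OF that] by (cases "i < N") auto
        qed simp
        have len: "plength \<rho> \<le> N" using \<rho>[of "Suc N"] part_eq_0_iff[of "Suc N" \<rho>] by simp
        have "?E (\<lambda>i. of_nat (a i)) = mpoly_eval (\<lambda>i. of_nat (part \<rho> i)) (g (N + 1))"
          by (rule polyfun_cong[OF pg[OF N1]]) (auto simp: \<rho>)
        also have "\<dots> = \<phi> \<rho>" using vF[OF N1, of \<rho>] len by (simp only: eg[OF N1] trans_le_add1)
        also have "\<dots> = mpoly_eval (\<lambda>i. of_nat (part \<rho> i)) (g N)" using vF[OF N len] by (simp add: eg[OF N])
        also have "\<dots> = mpoly_eval (\<lambda>i. of_nat (a i)) (g N)"
          by (rule polyfun_cong[OF pg[OF N]]) (auto simp: \<rho>)
        finally show "?E (\<lambda>i. of_nat (a i)) - mpoly_eval (\<lambda>i. of_nat (a i)) (g N) = 0" by simp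
      qed
      then show "mpoly_eval x (mpoly_subst (mpoly_var (N + 1 := 0)) (g (N + 1))) = mpoly_eval x (g N)" by simp
    qed
  qed
  moreover have "\<phi> \<rho> = shifted_value g \<rho>" for \<rho>
    using vF[of "max 1 (plength \<rho>)" \<rho>] by (simp add: shifted_value_def eg)
  ultimately show ?thesis by blast
qed

theorem shifted_functions_iff:
  "\<phi> \<in> shifted_value ` Collect shifted_symmetric \<longleftrightarrow> (\<exists>d. \<forall>N\<ge>1. shifted_rep N d \<phi>)"
  using shifted_value_rep rep_shifted_value by blast

section \<open>The eigenvalue functions are the shifted symmetric functions\<close>

lemma factorial_schur_cong:
  assumes "plength \<mu> \<le> N" "\<And>i. i < N \<Longrightarrow> y i = z i"
  shows "factorial_schur N \<mu> y = factorial_schur N \<mu> z"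
  by (rule polyfun_cong[OF polyfun_factorial_schur[OF assms(1)]]) (use assms(2) in simp)

text \<open>
  For \<open>plength \<mu> \<le> N\<close> the polynomial is \<open>factorial_schur\<close>, read in the variables \<open>x\<^sub>i\<close> with
  \<open>x\<^bsub>N-i\<^esub> + N = l\<^sub>i\<close>. It is symmetric at arguments with distinct coordinates, where it is a quotient of
  alternating functions, and hence everywhere. For \<open>N < plength \<mu>\<close> the function vanishes at all partitions with
  at most \<open>N\<close> parts.
\<close>

lemma shifted_rep_Phi_schur: "shifted_rep N (int (psize \<mu>)) (Phi (schur \<mu>))"
proof (cases "plength \<mu> \<le> N")
  case False
  have "Phi (schur \<mu>) \<rho> = 0" if "plength \<rho> \<le> N" for \<rho>
    using Phi_schur_eq_0[of \<rho> "Suc N" \<mu>] that False part_eq_0_iff[of "Suc N" \<mu>] part_eq_0_iff[of "Suc N" \<rho>] by simp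
  then show ?thesis
    by (intro shifted_repI[of N _ "\<lambda>_. 0"]) (simp_all add: polyfun_0 symmetric_fun_def)
next
  case len: True
  define rows where "rows x i = x (N - i) + of_nat N" for x :: "nat \<Rightarrow> complex" and i
  let ?F = "\<lambda>x. factorial_schur N \<mu> (rows x)"
  have F: "polyfun {1..N} (int (psize \<mu>)) ?F"
  proof (rule polyfun_compose[OF polyfun_factorial_schur[OF len]])
    show "polyfun {1..N} 1 (\<lambda>x. rows x i)" if "i \<in> {..<N}" for i
      unfolding rows_def using that by (intro polyfun_add polyfun_var polyfun_const) auto
  qed
  show ?thesis
  proof (rule shifted_repI[OF F])
    show "symmetric_fun N ?F" unfolding symmetric_fun_def
    proof (intro allI impI)
      fix \<pi> x assume \<pi>: "\<pi> permutes {1..N}"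
      have "?F (x \<circ> \<pi>) - ?F x = 0"
      proof (rule polyfun_eq_0[where F = "\<lambda>x. ?F (x \<circ> \<pi>) - ?F x"])
        show "polyfun {1..N} (int (psize \<mu>)) (\<lambda>x. ?F (x \<circ> \<pi>) - ?F x)"
          by (intro polyfun_diff polyfun_permute F \<pi>)
        fix a :: "nat \<Rightarrow> nat" assume a: "\<And>i. 1 \<le> i \<Longrightarrow> i < N \<Longrightarrow> a (Suc i) < a i"
        have dec: "a j < a i" if "1 \<le> i" "i < j" "j \<le> N" for i j
        proof -
          have "Suc i \<le> j" using that by simp
          then show ?thesis using that(3)
          proof (induction j rule: dec_induct)
            case base
            then show ?case using a[of i] that(1) by simp
          next
            case (step n)
            then show ?case using a[of n] by simp
          qed
        qed
        define x where "x i = (of_nat (a i) :: complex)" for i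
        have inj: "inj_on (rows x) {..<N}"
        proof (rule inj_onI, rule ccontr)
          fix i j assume ij: "i \<in> {..<N}" "j \<in> {..<N}" "rows x i = rows x j" "i \<noteq> j"
          then have "a (N - i) = a (N - j)" by (simp add: rows_def x_def)
          moreover have "N - j < N - i \<or> N - i < N - j" using ij(1,2,4)
            by (cases "i < j") (auto simp: diff_less_mono2)
          moreover have "1 \<le> N - i" "1 \<le> N - j" using ij(1,2) by auto
          ultimately show False using dec[of "N - i" "N - j"] dec[of "N - j" "N - i"] by auto
        qed
        (* The permutation \<open>\<pi>\<close> of the variables, as a permutation of the rows. *)
        define \<sigma> where "\<sigma> i = (if i < N then N - \<pi> (N - i) else i)" for i
        have \<pi>in: "\<pi> k \<in> {1..N}" if "k \<in> {1..N}" for k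
          using that by (simp only: permutes_in_image[OF \<pi>])
        have "\<sigma> permutes {0..<N}"
        proof (rule bij_imp_permutes)
          have inj\<sigma>: "inj_on \<sigma> {0..<N}"
          proof (rule inj_onI)
            fix i j assume ij: "i \<in> {0..<N}" "j \<in> {0..<N}" "\<sigma> i = \<sigma> j"
            have "\<pi> (N - i) \<in> {1..N}" by (rule \<pi>in) (use ij(1) in auto)
            moreover have "\<pi> (N - j) \<in> {1..N}" by (rule \<pi>in) (use ij(2) in auto)
            moreover have "N - \<pi> (N - i) = N - \<pi> (N - j)" using ij by (simp add: \<sigma>_def)
            ultimately have "\<pi> (N - i) = \<pi> (N - j)" by (simp only: atLeastAtMost_iff) linarith
            then have "N - i = N - j" using permutes_inj[OF \<pi>] by (simp add: inj_eq)
            then show "i = j" using ij(1,2) by simp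
          qed
          moreover have "\<sigma> ` {0..<N} \<subseteq> {0..<N}"
          proof clarify
            fix i assume i: "i \<in> {0..<N}"
            then have "\<pi> (N - i) \<in> {1..N}" by (intro \<pi>in) auto
            then show "\<sigma> i \<in> {0..<N}" using i by (simp add: \<sigma>_def)
          qed
          ultimately show "bij_betw \<sigma> {0..<N} {0..<N}"
            unfolding bij_betw_def using endo_inj_surj[of "{0..<N}" \<sigma>] by blast
        qed (simp add: \<sigma>_def)
        then have "factorial_schur N \<mu> (rows x \<circ> \<sigma>) = factorial_schur N \<mu> (rows x)"
          by (rule factorial_schur_permute[OF _ inj])
        moreover have "factorial_schur N \<mu> (rows (x \<circ> \<pi>)) = factorial_schur N \<mu> (rows x \<circ> \<sigma>)"
        proof (rule factorial_schur_cong[OF len])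
          fix i assume i: "i < N"
          then have "\<pi> (N - i) \<in> {1..N}" by (intro \<pi>in) auto
          then show "rows (x \<circ> \<pi>) i = (rows x \<circ> \<sigma>) i" using i by (simp add: rows_def \<sigma>_def)
        qed
        ultimately have "?F (x \<circ> \<pi>) - ?F x = 0" by simp
        then show "?F ((\<lambda>i. of_nat (a i)) \<circ> \<pi>) - ?F (\<lambda>i. of_nat (a i)) = 0" by (simp add: x_def[abs_def])
      qed
      then show "?F (x \<circ> \<pi>) = ?F x" by simp
    qed
    fix \<rho> assume \<rho>: "plength \<rho> \<le> N"
    have "factorial_schur N \<mu> (rows (shifted_parts \<rho>)) = factorial_schur N \<mu> (betas N \<rho>)"
      by (rule factorial_schur_cong[OF len]) (simp add: rows_def beta_def of_nat_diff)
    then show "Phi (schur \<mu>) \<rho> = ?F (shifted_parts \<rho>)"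
      using Phi_schur_factorial_schur[OF len \<rho>] by simp
  qed
qed

definition shifted_functions :: "(partition \<Rightarrow> complex) set" where
  "shifted_functions = shifted_value ` Collect shifted_symmetric"

lemma shifted_functionsI: "(\<And>N. N \<ge> 1 \<Longrightarrow> shifted_rep N d \<phi>) \<Longrightarrow> \<phi> \<in> shifted_functions"
  unfolding shifted_functions_def shifted_functions_iff by blast

lemma shifted_functionsE:
  assumes "\<phi> \<in> shifted_functions"
  obtains d where "\<And>N. N \<ge> 1 \<Longrightarrow> shifted_rep N (int d) \<phi>"
proof -
  obtain d where "\<forall>N\<ge>1. shifted_rep N d \<phi>"
    using assms unfolding shifted_functions_def shifted_functions_iff by blast
  then have "shifted_rep N (int (nat d)) \<phi>" if "N \<ge> 1" for N
    using shifted_rep_mono[of N d \<phi> "int (nat d)"] that by simp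
  then show thesis by (rule that)
qed

text \<open>
  The partitions of size at most \<open>d\<close> are enough to interpolate: \<open>Phi (schur \<mu>)\<close> for \<open>|\<mu>| \<le> d\<close> is a triangular
  system there, and a shifted symmetric function of degree at most \<open>d\<close> is determined by its values there.
\<close>

lemma Phi_image: "Phi ` Lambda = shifted_functions"
proof (intro Set.equalityI subsetI)
  fix \<phi> assume "\<phi> \<in> Phi ` Lambda"
  then obtain f where f: "f \<in> Lambda" "\<phi> = Phi f" by blast
  obtain d c where e: "f = (\<Sum>\<mu> | psize \<mu> \<le> d. scale (c \<mu>) (schur \<mu>))"
    using Lambda_expansion[OF f(1)] by blast
  have "Phi f = (\<lambda>\<rho>. \<Sum>\<mu> | psize \<mu> \<le> d. c \<mu> * Phi (schur \<mu>) \<rho>)" by (rule ext, rule Phi_expansion[OF e])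
  then show "\<phi> \<in> shifted_functions" unfolding f(2)
    by (intro shifted_functionsI[of "int d"])
       (auto intro!: shifted_rep_sum shifted_rep_cmult shifted_rep_mono[OF shifted_rep_Phi_schur])
next
  fix \<phi> assume "\<phi> \<in> shifted_functions"
  then obtain d where \<phi>: "\<And>N. N \<ge> 1 \<Longrightarrow> shifted_rep N (int d) \<phi>" by (rule shifted_functionsE) blast
  let ?A = "{\<mu>. psize \<mu> \<le> d}"
  obtain c where c: "\<And>\<rho>. psize \<rho> \<le> d \<Longrightarrow> (\<Sum>\<mu>\<in>?A. c \<mu> * Phi (schur \<mu>) \<rho>) = \<phi> \<rho>"
    using triangular_solvable[of ?A "\<lambda>\<mu>. Phi (schur \<mu>)" psize \<phi>, OF finite_psize_le Phi_schur_self Phi_schur_triangular]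
    by blast
  define f where "f = (\<Sum>\<mu>\<in>?A. scale (c \<mu>) (schur \<mu>))"
  have Phi_f: "Phi f \<rho> = (\<Sum>\<mu>\<in>?A. c \<mu> * Phi (schur \<mu>) \<rho>)" for \<rho> by (rule Phi_expansion[OF f_def])
  have "\<phi> \<rho> = Phi f \<rho>" for \<rho>
  proof -
    define N where "N = max 1 (plength \<rho>)"
    have N: "N \<ge> 1" "plength \<rho> \<le> N" by (auto simp: N_def)
    have "shifted_rep N (int d) (\<lambda>\<rho>. \<Sum>\<mu>\<in>?A. c \<mu> * Phi (schur \<mu>) \<rho>)"
      by (auto intro!: shifted_rep_sum shifted_rep_cmult shifted_rep_mono[OF shifted_rep_Phi_schur])
    then have "shifted_rep N (int d) (\<lambda>\<rho>. \<phi> \<rho> + (- 1) * (\<Sum>\<mu>\<in>?A. c \<mu> * Phi (schur \<mu>) \<rho>))"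
      by (intro shifted_rep_add \<phi> N shifted_rep_cmult)
    then have "\<phi> \<rho> + (- 1) * (\<Sum>\<mu>\<in>?A. c \<mu> * Phi (schur \<mu>) \<rho>) = 0"
      by (rule shifted_rep_eq_0[OF _ _ N(2)]) (simp add: c)
    then show ?thesis by (simp add: Phi_f)
  qed
  then have "\<phi> = Phi f" by (rule ext)
  moreover have "f \<in> Lambda" unfolding f_def by (rule sum_schur_in_Lambda)
  ultimately show "\<phi> \<in> Phi ` Lambda" by blast
qed

section \<open>The two algebras\<close>

text \<open>
  The inverse of \<open>eigenvalue\<close>. It turns \<open>\<times>\<close> into the pointwise product, so the algebra laws on
  \<open>from_eigenvalues ` shifted_functions\<close> are those of functions.
\<close>

definition from_eigenvalues :: "(partition \<Rightarrow> complex) \<Rightarrow> completed" where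
  "from_eigenvalues \<phi> = (\<lambda>n. \<Sum>\<rho>\<in>partitions_of n. scale (of_nat (num_syt \<rho>) * \<phi> \<rho>) (schur \<rho>))"

definition eigenvalue :: "completed \<Rightarrow> partition \<Rightarrow> complex" where
  "eigenvalue F \<rho> = schur_coord (psize \<rho>) (F (psize \<rho>)) \<rho> / of_nat (num_syt \<rho>)"

lemma eigenvalue_from_eigenvalues [simp]: "eigenvalue (from_eigenvalues \<phi>) = \<phi>"
proof
  fix \<rho>
  have "\<rho> \<in> partitions_of (psize \<rho>)" by (simp add: partitions_of_def)
  then show "eigenvalue (from_eigenvalues \<phi>) \<rho> = \<phi> \<rho>"
    by (simp add: eigenvalue_def from_eigenvalues_def schur_coord_sum num_syt_nonzero)
qed

lemma hat_eq_from_eigenvalues: "f \<in> Lambda \<Longrightarrow> hat f = from_eigenvalues (Phi f)"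
  unfolding from_eigenvalues_def by (rule ext) (rule hat_eq_sum_Phi)

lemma from_eigenvalues_mult: "completed_class_prod (from_eigenvalues \<phi>) (from_eigenvalues \<psi>) = from_eigenvalues (\<lambda>\<rho>. \<phi> \<rho> * \<psi> \<rho>)"
proof
  fix n
  have "class_prod n (from_eigenvalues \<phi> n) (from_eigenvalues \<psi> n) = (\<Sum>\<rho>\<in>partitions_of n.
      scale ((of_nat (num_syt \<rho>) * \<phi> \<rho>) * (of_nat (num_syt \<rho>) * \<psi> \<rho>) / of_nat (num_syt \<rho>)) (schur \<rho>))"
    by (rule class_prod_expansions) (simp_all add: from_eigenvalues_def)
  also have "\<dots> = from_eigenvalues (\<lambda>\<rho>. \<phi> \<rho> * \<psi> \<rho>) n"
    unfolding from_eigenvalues_def by (intro sum.cong refl) (simp add: num_syt_nonzero)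
  finally show "completed_class_prod (from_eigenvalues \<phi>) (from_eigenvalues \<psi>) n = from_eigenvalues (\<lambda>\<rho>. \<phi> \<rho> * \<psi> \<rho>) n"
    by (simp add: completed_class_prod_def)
qed

lemma from_eigenvalues_add: "(\<lambda>n. from_eigenvalues \<phi> n + from_eigenvalues \<psi> n) = from_eigenvalues (\<lambda>\<rho>. \<phi> \<rho> + \<psi> \<rho>)"
  by (simp add: from_eigenvalues_def sum.distrib[symmetric] series.scale_left_distrib[symmetric] distrib_left)

lemma from_eigenvalues_scale: "(\<lambda>n. scale c (from_eigenvalues \<phi> n)) = from_eigenvalues (\<lambda>\<rho>. c * \<phi> \<rho>)"
  by (simp add: from_eigenvalues_def series.scale_sum_right mult.left_commute)

lemma from_eigenvalues_0: "(\<lambda>n. 0) = from_eigenvalues (\<lambda>\<rho>. 0)"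
  by (simp add: from_eigenvalues_def)

lemma one_in_Lambda: "1 \<in> Lambda"
  using sum_schur_in_Lambda[of "\<lambda>_. 1" 0] by (simp add: psize_eq_0_iff schur_empty)

lemma from_eigenvalues_1: "hat 1 = from_eigenvalues (\<lambda>\<rho>. 1)"
  using hat_eq_from_eigenvalues[OF one_in_Lambda] Phi_1 by (simp add: schur_empty)

lemma stable_algebra_eq:
  "stable_algebra = \<lparr> carrier = from_eigenvalues ` shifted_functions, monoid.mult = completed_class_prod,
     one = from_eigenvalues (\<lambda>\<rho>. 1), ring.zero = from_eigenvalues (\<lambda>\<rho>. 0), add = (\<lambda>F G n. F n + G n),
     module.smult = (\<lambda>c F n. scale c (F n)) \<rparr>"
proof -
  have "hat ` Lambda = from_eigenvalues ` shifted_functions"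
    unfolding Phi_image[symmetric] image_image by (intro image_cong refl) (rule hat_eq_from_eigenvalues)
  then show ?thesis by (simp add: stable_algebra_def from_eigenvalues_1 from_eigenvalues_0)
qed

lemma shifted_functions_const: "(\<lambda>\<rho>. c) \<in> shifted_functions"
  by (rule shifted_functionsI[of 0]) (rule shifted_rep_const, simp)

lemma shifted_functions_add:
  assumes "\<phi> \<in> shifted_functions" "\<psi> \<in> shifted_functions"
  shows "(\<lambda>\<rho>. \<phi> \<rho> + \<psi> \<rho>) \<in> shifted_functions"
proof -
  obtain d where d: "\<And>N. N \<ge> 1 \<Longrightarrow> shifted_rep N (int d) \<phi>" using assms(1) by (rule shifted_functionsE) blast
  obtain e where e: "\<And>N. N \<ge> 1 \<Longrightarrow> shifted_rep N (int e) \<psi>" using assms(2) by (rule shifted_functionsE) blast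
  show ?thesis
  proof (rule shifted_functionsI[of "int d + int e"])
    fix N :: nat assume N: "N \<ge> 1"
    show "shifted_rep N (int d + int e) (\<lambda>\<rho>. \<phi> \<rho> + \<psi> \<rho>)"
      by (rule shifted_rep_add[OF shifted_rep_mono[OF d[OF N]] shifted_rep_mono[OF e[OF N]]]) auto
  qed
qed

lemma shifted_functions_mult:
  assumes "\<phi> \<in> shifted_functions" "\<psi> \<in> shifted_functions"
  shows "(\<lambda>\<rho>. \<phi> \<rho> * \<psi> \<rho>) \<in> shifted_functions"
proof -
  obtain d where d: "\<And>N. N \<ge> 1 \<Longrightarrow> shifted_rep N (int d) \<phi>" using assms(1) by (rule shifted_functionsE) blast
  obtain e where e: "\<And>N. N \<ge> 1 \<Longrightarrow> shifted_rep N (int e) \<psi>" using assms(2) by (rule shifted_functionsE) blast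
  show ?thesis
    by (rule shifted_functionsI[of "int d + int e"]) (intro shifted_rep_mult d e)
qed

lemma shifted_functions_cmult: "\<phi> \<in> shifted_functions \<Longrightarrow> (\<lambda>\<rho>. c * \<phi> \<rho>) \<in> shifted_functions"
  by (rule shifted_functions_mult[OF shifted_functions_const])

lemma cring_complex_ring: "cring complex_ring"
proof (rule cringI)
  show "abelian_group complex_ring"
    by (rule abelian_groupI) (auto simp: complex_ring_def intro: exI[of _ "- x" for x])
  show "comm_monoid complex_ring"
    by (rule comm_monoidI) (auto simp: complex_ring_def)
qed (auto simp: complex_ring_def distrib_right)

lemma algebra_shifted: "algebra complex_ring shifted_symmetric_algebra"
proof -
  have S: "shifted_symmetric_algebra = \<lparr> carrier = shifted_functions, monoid.mult = (\<lambda>\<phi> \<psi> \<mu>. \<phi> \<mu> * \<psi> \<mu>),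
     one = (\<lambda>\<mu>. 1), ring.zero = (\<lambda>\<mu>. 0), add = (\<lambda>\<phi> \<psi> \<mu>. \<phi> \<mu> + \<psi> \<mu>), module.smult = (\<lambda>c \<phi> \<mu>. c * \<phi> \<mu>) \<rparr>"
    by (simp add: shifted_symmetric_algebra_def shifted_functions_def)
  have inv: "\<exists>\<psi>\<in>shifted_functions. (\<lambda>\<rho>. \<psi> \<rho> + \<phi> \<rho>) = (\<lambda>\<rho>. 0)" if "\<phi> \<in> shifted_functions" for \<phi>
    using shifted_functions_cmult[OF that, of "- 1"] by (intro bexI[of _ "\<lambda>\<rho>. - 1 * \<phi> \<rho>"]) auto
  have add: "abelian_group shifted_symmetric_algebra"
  proof (rule abelian_groupI)
    show "\<exists>y\<in>carrier shifted_symmetric_algebra. y \<oplus>\<^bsub>shifted_symmetric_algebra\<^esub> x = \<zero>\<^bsub>shifted_symmetric_algebra\<^esub>"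
      if "x \<in> carrier shifted_symmetric_algebra" for x
      using inv[of x] that by (simp add: S)
  qed (auto simp: S add.assoc add.commute add.left_commute shifted_functions_add shifted_functions_const)
  have "cring shifted_symmetric_algebra"
  proof (rule cringI)
    show "abelian_group shifted_symmetric_algebra" by (rule add)
    show "comm_monoid shifted_symmetric_algebra"
      by (rule comm_monoidI)
         (auto simp: S mult.assoc mult.commute mult.left_commute shifted_functions_mult shifted_functions_const)
  qed (auto simp: S distrib_right)
  then show ?thesis
    by (intro algebraI cring_complex_ring)
       (auto simp: S complex_ring_def shifted_functions_cmult algebra_simps)
qed

lemma algebra_stable: "algebra complex_ring stable_algebra"
proof -
  note S = stable_algebra_eq and from_eigenvalues = from_eigenvalues_mult from_eigenvalues_add from_eigenvalues_scale
  have inv: "\<exists>\<psi>\<in>shifted_functions. from_eigenvalues (\<lambda>\<rho>. \<psi> \<rho> + \<phi> \<rho>) = from_eigenvalues (\<lambda>\<rho>. 0)" if "\<phi> \<in> shifted_functions" for \<phi>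
    using shifted_functions_cmult[OF that, of "- 1"] by (intro bexI[of _ "\<lambda>\<rho>. - 1 * \<phi> \<rho>"]) auto
  have add: "abelian_group stable_algebra"
  proof (rule abelian_groupI)
    show "\<exists>y\<in>carrier stable_algebra. y \<oplus>\<^bsub>stable_algebra\<^esub> x = \<zero>\<^bsub>stable_algebra\<^esub>"
      if "x \<in> carrier stable_algebra" for x
      using inv that by (auto simp: S from_eigenvalues)
  qed (auto simp: S from_eigenvalues add.assoc add.commute add.left_commute shifted_functions_add shifted_functions_const)
  have "cring stable_algebra"
  proof (rule cringI)
    show "abelian_group stable_algebra" by (rule add)
    show "comm_monoid stable_algebra"
      by (rule comm_monoidI)
         (auto simp: S from_eigenvalues mult.assoc mult.commute mult.left_commute shifted_functions_mult shifted_functions_const)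
  qed (auto simp: S from_eigenvalues distrib_right)
  then show ?thesis
    by (intro algebraI cring_complex_ring)
       (auto simp: S from_eigenvalues complex_ring_def shifted_functions_cmult algebra_simps)
qed

lemma eigenvalue_iso: "eigenvalue \<in> algebra_iso complex_ring stable_algebra shifted_symmetric_algebra"
  unfolding algebra_iso_def ring_iso_def Ring.ring_hom_def
proof (intro CollectI conjI allI impI ballI)
  have car: "carrier stable_algebra = from_eigenvalues ` shifted_functions"
    "carrier shifted_symmetric_algebra = shifted_functions"
    by (simp_all add: stable_algebra_eq shifted_symmetric_algebra_def shifted_functions_def)
  show "eigenvalue \<in> carrier stable_algebra \<rightarrow> carrier shifted_symmetric_algebra"
    by (auto simp: car)
  show "bij_betw eigenvalue (carrier stable_algebra) (carrier shifted_symmetric_algebra)"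
    by (rule bij_betw_byWitness[where f' = from_eigenvalues]) (auto simp: car)
qed (auto simp: stable_algebra_eq shifted_symmetric_algebra_def from_eigenvalues_mult from_eigenvalues_add from_eigenvalues_scale)

theorem proposition4p1:
  shows "algebra complex_ring stable_algebra \<and>
         algebra complex_ring shifted_symmetric_algebra \<and>
         (\<exists>\<theta> \<in> algebra_iso complex_ring stable_algebra shifted_symmetric_algebra.
            \<forall>f\<in>Lambda. \<theta> (hat f) = Phi f) \<and>
         (\<forall>f\<in>Lambda. \<forall>g\<in>Lambda. \<forall>h\<in>Lambda.
            completed_class_prod (hat f) (hat g) = hat h \<longrightarrow>
            Phi h = (\<lambda>\<mu>. Phi f \<mu> * Phi g \<mu>))"
proof (intro conjI ballI impI)
  show "\<exists>\<theta> \<in> algebra_iso complex_ring stable_algebra shifted_symmetric_algebra. \<forall>f\<in>Lambda. \<theta> (hat f) = Phi f"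
    using eigenvalue_iso by (intro bexI[of _ eigenvalue]) (simp_all add: hat_eq_from_eigenvalues)
  fix f g h assume "f \<in> Lambda" "g \<in> Lambda" "h \<in> Lambda" "completed_class_prod (hat f) (hat g) = hat h"
  then have "from_eigenvalues (Phi h) = from_eigenvalues (\<lambda>\<mu>. Phi f \<mu> * Phi g \<mu>)" by (simp add: hat_eq_from_eigenvalues from_eigenvalues_mult)
  then have "eigenvalue (from_eigenvalues (Phi h)) = eigenvalue (from_eigenvalues (\<lambda>\<mu>. Phi f \<mu> * Phi g \<mu>))" by (rule arg_cong)
  then show "Phi h = (\<lambda>\<mu>. Phi f \<mu> * Phi g \<mu>)" by simp
qed (rule algebra_stable algebra_shifted)+

end
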